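(* Let $l$ be a positive integer, let $S$ be a finite (additively written) abelian group of order $2l+1$, and let $\chi:S\to\mathbb{C}^\times$ be an injective group homomorphism. Then the Lie algebra $D_S$ is isomorphic to the affine Kac-Moody algebra of type $B_l^{(1)}$.
   Context: All Lie algebras are over $\mathbb{C}$. For $q\in\mathbb{C}^\times$, $[n]_q=\frac{q^n-q^{-n}}{q-q^{-1}}$ if $q\neq\pm1$, $[n]_1=n$, $[n]_{-1}=n(-1)^{n-1}$. $D_S$ is the Lie algebra with generators $\mathbf{c}$ and $D^{\alpha}(n)$ ($\alpha\in S$, $n\in\mathbb{Z}$), subject to: $\mathbf{c}$ is central, $D^{-\alpha}(n)=-D^{\alpha}(n)$, and $$[D^{\alpha}(n),D^{\beta}(m)]=(\chi(m\alpha-n\beta)-\chi(n\beta-m\alpha))D^{\alpha+\beta}(m+n)-(\chi(m\alpha+n\beta)-\chi(-m\alpha-n\beta))D^{\alpha-\beta}(m+n)+\left([m]_{\chi(\alpha+\beta)}-[m]_{\chi(\alpha-\beta)}\right)\delta_{m+n,0}\mathbf{c}$$ for $m,n\in\mathbb{Z}$, $\alpha,\beta\in S$. The affine Kac-Moody algebra of type $B_l^{(1)}$ here means (without derivation) $\hat{\mathfrak g}=\mathfrak{g}\otimes\mathbb{C}[t,t^{-1}]\oplus\mathbb{C}\mathbf{k}$, where $\mathfrak{g}$ is the simple Lie algebra of type $B_l$ (i.e. $\mathfrak{so}(2l+1,\mathbb{C})$; $B_1=A_1$), $\mathbf{k}$ is central, and $[a\otimes t^m,b\otimes t^n]=[a,b]\otimes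 t^{m+n}+m\delta_{m+n,0}\langle a,b\rangle\mathbf{k}$ with $\langle\cdot,\cdot\rangle$ a nondegenerate symmetric invariant bilinear form on $\mathfrak{g}$. *)

theory Defs
  imports
    "HOL-Algebra.Module"
    "HOL-Algebra.Algebraic_Closure_Type"
    "Jordan_Normal_Form.Matrix"
begin

section \<open>Complex Lie algebras\<close>

text \<open>The fields \<open>mult\<close> and \<open>one\<close>, which \<open>module\<close> inherits from the ring record,
  play no role for vector spaces; they are left \<open>undefined\<close> in all structures below.\<close>

record 'a lie_structure = "(complex, 'a) module" +
  lie_bracket :: "'a \<Rightarrow> 'a \<Rightarrow> 'a"

abbreviation complex_field :: "complex ring" where
  "complex_field \<equiv> ring_of_type_algebra"

locale complex_lie_algebra = module complex_field L for L :: "('a, 'm) lie_structure_scheme" (structure) +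
  assumes bracket_closed: "\<lbrakk>x \<in> carrier L; y \<in> carrier L\<rbrakk> \<Longrightarrow> lie_bracket L x y \<in> carrier L"
    and bracket_add_left: "\<lbrakk>x \<in> carrier L; y \<in> carrier L; z \<in> carrier L\<rbrakk> \<Longrightarrow>
      lie_bracket L (x \<oplus> y) z = lie_bracket L x z \<oplus> lie_bracket L y z"
    and bracket_add_right: "\<lbrakk>x \<in> carrier L; y \<in> carrier L; z \<in> carrier L\<rbrakk> \<Longrightarrow>
      lie_bracket L x (y \<oplus> z) = lie_bracket L x y \<oplus> lie_bracket L x z"
    and bracket_smult_left: "\<lbrakk>x \<in> carrier L; y \<in> carrier L\<rbrakk> \<Longrightarrow>
      lie_bracket L (a \<odot> x) y = a \<odot> lie_bracket L x y"
    and bracket_smult_right: "\<lbrakk>x \<in> carrier L; y \<in> carrier L\<rbrakk> \<Longrightarrow>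
      lie_bracket L x (a \<odot> y) = a \<odot> lie_bracket L x y"
    and bracket_self: "x \<in> carrier L \<Longrightarrow> lie_bracket L x x = \<zero>"
    and jacobi: "\<lbrakk>x \<in> carrier L; y \<in> carrier L; z \<in> carrier L\<rbrakk> \<Longrightarrow>
      lie_bracket L x (lie_bracket L y z) \<oplus> lie_bracket L y (lie_bracket L z x)
        \<oplus> lie_bracket L z (lie_bracket L x y) = \<zero>"

definition lie_hom :: "('a, 'm) lie_structure_scheme \<Rightarrow> ('b, 'n) lie_structure_scheme \<Rightarrow> ('a \<Rightarrow> 'b) set"
  where "lie_hom L M = {h. h \<in> carrier L \<rightarrow> carrier M \<and>
    (\<forall>x\<in>carrier L. \<forall>y\<in>carrier L. h (x \<oplus>\<^bsub>L\<^esub> y) = h x \<oplus>\<^bsub>M\<^esub> h y) \<and>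
    (\<forall>a. \<forall>x\<in>carrier L. h (a \<odot>\<^bsub>L\<^esub> x) = a \<odot>\<^bsub>M\<^esub> h x) \<and>
    (\<forall>x\<in>carrier L. \<forall>y\<in>carrier L. h (lie_bracket L x y) = lie_bracket M (h x) (h y))}"

definition lie_isomorphic :: "('a, 'm) lie_structure_scheme \<Rightarrow> ('b, 'n) lie_structure_scheme \<Rightarrow> bool"
  where "lie_isomorphic L M \<longleftrightarrow> (\<exists>h \<in> lie_hom L M. bij_betw h (carrier L) (carrier M))"

definition nondegenerate_invariant_form ::
    "('a, 'm) lie_structure_scheme \<Rightarrow> ('a \<Rightarrow> 'a \<Rightarrow> complex) \<Rightarrow> bool" where
  "nondegenerate_invariant_form L B \<longleftrightarrow>
    (\<forall>x\<in>carrier L. \<forall>y\<in>carrier L. \<forall>z\<in>carrier L. B (x \<oplus>\<^bsub>L\<^esub> y) z = B x z + B y z) \<and>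
    (\<forall>a. \<forall>x\<in>carrier L. \<forall>y\<in>carrier L. B (a \<odot>\<^bsub>L\<^esub> x) y = a * B x y) \<and>
    (\<forall>x\<in>carrier L. \<forall>y\<in>carrier L. B x y = B y x) \<and>
    (\<forall>x\<in>carrier L. \<forall>y\<in>carrier L. \<forall>z\<in>carrier L. B (lie_bracket L x y) z = B x (lie_bracket L y z)) \<and>
    (\<forall>x\<in>carrier L. (\<forall>y\<in>carrier L. B x y = 0) \<longrightarrow> x = \<zero>\<^bsub>L\<^esub>)"


section \<open>Lie algebras given by generators and relations\<close>

datatype 'g lie_term =
    Gen 'g
  | Zero
  | Plus "'g lie_term" "'g lie_term"
  | Scale complex "'g lie_term"
  | Bracket "'g lie_term" "'g lie_term"

text \<open>The least congruence on terms that contains the relations \<open>R\<close> and the axioms of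
  complex Lie algebras; the presented Lie algebra is the quotient by it.  That this is the
  universal Lie algebra on the given generators and relations is shown in
  \<open>presented_lie_universal\<close> below.\<close>

inductive lie_eq :: "('g lie_term \<times> 'g lie_term) set \<Rightarrow> 'g lie_term \<Rightarrow> 'g lie_term \<Rightarrow> bool"
  for R where
  rel: "(s, t) \<in> R \<Longrightarrow> lie_eq R s t"
| refl: "lie_eq R s s"
| sym: "lie_eq R s t \<Longrightarrow> lie_eq R t s"
| trans: "lie_eq R s t \<Longrightarrow> lie_eq R t u \<Longrightarrow> lie_eq R s u"
| Plus_cong: "lie_eq R s s' \<Longrightarrow> lie_eq R t t' \<Longrightarrow> lie_eq R (Plus s t) (Plus s' t')"
| Scale_cong: "lie_eq R s s' \<Longrightarrow> lie_eq R (Scale a s) (Scale a s')"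
| Bracket_cong: "lie_eq R s s' \<Longrightarrow> lie_eq R t t' \<Longrightarrow> lie_eq R (Bracket s t) (Bracket s' t')"
| Plus_assoc: "lie_eq R (Plus (Plus s t) u) (Plus s (Plus t u))"
| Plus_comm: "lie_eq R (Plus s t) (Plus t s)"
| Plus_Zero: "lie_eq R (Plus Zero s) s"
| Plus_inverse: "lie_eq R (Plus (Scale (-1) s) s) Zero"
| Scale_Plus: "lie_eq R (Scale a (Plus s t)) (Plus (Scale a s) (Scale a t))"
| Scale_add: "lie_eq R (Scale (a + b) s) (Plus (Scale a s) (Scale b s))"
| Scale_mult: "lie_eq R (Scale (a * b) s) (Scale a (Scale b s))"
| Scale_one: "lie_eq R (Scale 1 s) s"
| Bracket_Plus_left: "lie_eq R (Bracket (Plus s t) u) (Plus (Bracket s u) (Bracket t u))"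
| Bracket_Plus_right: "lie_eq R (Bracket s (Plus t u)) (Plus (Bracket s t) (Bracket s u))"
| Bracket_Scale_left: "lie_eq R (Bracket (Scale a s) t) (Scale a (Bracket s t))"
| Bracket_Scale_right: "lie_eq R (Bracket s (Scale a t)) (Scale a (Bracket s t))"
| Bracket_self: "lie_eq R (Bracket s s) Zero"
| Jacobi: "lie_eq R (Plus (Plus (Bracket s (Bracket t u)) (Bracket t (Bracket u s)))
                          (Bracket u (Bracket s t))) Zero"

definition lie_class :: "('g lie_term \<times> 'g lie_term) set \<Rightarrow> 'g lie_term \<Rightarrow> 'g lie_term set" where
  "lie_class R s = {t. lie_eq R s t}"

definition presented_lie ::
    "('g lie_term \<times> 'g lie_term) set \<Rightarrow> 'g lie_term set lie_structure" where
  "presented_lie R = \<lparr>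
     carrier = range (lie_class R),
     monoid.mult = undefined, one = undefined,
     ring.zero = lie_class R Zero,
     add = (\<lambda>P Q. \<Union>s\<in>P. \<Union>t\<in>Q. lie_class R (Plus s t)),
     module.smult = (\<lambda>a P. \<Union>s\<in>P. lie_class R (Scale a s)),
     lie_bracket = (\<lambda>P Q. \<Union>s\<in>P. \<Union>t\<in>Q. lie_class R (Bracket s t))\<rparr>"

lemma lie_class_eq_iff: "lie_class R s = lie_class R t \<longleftrightarrow> lie_eq R s t"
proof
  assume "lie_class R s = lie_class R t"
  moreover have "t \<in> lie_class R t" by (simp add: lie_class_def lie_eq.refl)
  ultimately show "lie_eq R s t" unfolding lie_class_def by blast
next
  assume "lie_eq R s t"
  then have "lie_eq R s u \<longleftrightarrow> lie_eq R t u" for u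
    by (metis lie_eq.sym lie_eq.trans)
  then show "lie_class R s = lie_class R t" by (simp add: lie_class_def)
qed

lemma presented_lie_simps:
  "carrier (presented_lie R) = range (lie_class R)"
  "\<zero>\<^bsub>presented_lie R\<^esub> = lie_class R Zero"
  "lie_class R s \<oplus>\<^bsub>presented_lie R\<^esub> lie_class R t = lie_class R (Plus s t)"
  "a \<odot>\<^bsub>presented_lie R\<^esub> lie_class R s = lie_class R (Scale a s)"
  "lie_bracket (presented_lie R) (lie_class R s) (lie_class R t) = lie_class R (Bracket s t)"
proof -
  have mem: "u' \<in> lie_class R u \<longleftrightarrow> lie_eq R u u'" for u u'
    by (simp add: lie_class_def)
  have plus: "lie_class R (Plus s' t') = lie_class R (Plus s t)"
    if "s' \<in> lie_class R s" "t' \<in> lie_class R t" for s' t'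
    using that unfolding mem lie_class_eq_iff by (intro lie_eq.sym[OF lie_eq.Plus_cong])
  have scale: "lie_class R (Scale a s') = lie_class R (Scale a s)"
    if "s' \<in> lie_class R s" for s'
    using that unfolding mem lie_class_eq_iff by (intro lie_eq.sym[OF lie_eq.Scale_cong])
  have brac: "lie_class R (Bracket s' t') = lie_class R (Bracket s t)"
    if "s' \<in> lie_class R s" "t' \<in> lie_class R t" for s' t'
    using that unfolding mem lie_class_eq_iff by (intro lie_eq.sym[OF lie_eq.Bracket_cong])
  have UN1: "(\<Union>s'\<in>A. F s') = E" if "x \<in> A" "\<And>s'. s' \<in> A \<Longrightarrow> F s' = E"
    for A :: "'a lie_term set" and x F and E :: "'a lie_term set"
    using that by blast
  have ne: "s \<in> lie_class R s" "t \<in> lie_class R t"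
    by (simp_all add: mem lie_eq.refl)
  show "carrier (presented_lie R) = range (lie_class R)"
    "\<zero>\<^bsub>presented_lie R\<^esub> = lie_class R Zero"
    by (simp_all add: presented_lie_def)
  show "lie_class R s \<oplus>\<^bsub>presented_lie R\<^esub> lie_class R t = lie_class R (Plus s t)"
    unfolding presented_lie_def by simp (intro UN1[OF ne(1)] UN1[OF ne(2)] plus)
  show "a \<odot>\<^bsub>presented_lie R\<^esub> lie_class R s = lie_class R (Scale a s)"
    unfolding presented_lie_def by simp (intro UN1[OF ne(1)] scale)
  show "lie_bracket (presented_lie R) (lie_class R s) (lie_class R t) = lie_class R (Bracket s t)"
    unfolding presented_lie_def by simp (intro UN1[OF ne(1)] UN1[OF ne(2)] brac)
qed

lemma complex_field_simps:
  "carrier complex_field = UNIV" "a \<otimes>\<^bsub>complex_field\<^esub> b = a * b"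
  "a \<oplus>\<^bsub>complex_field\<^esub> b = a + b" "\<one>\<^bsub>complex_field\<^esub> = 1" "\<zero>\<^bsub>complex_field\<^esub> = 0"
  by (simp_all add: ring_of_type_algebra_def)

lemma complex_lie_algebra_presented_lie: "complex_lie_algebra (presented_lie R)"
proof -
  let ?c = "lie_class R"
  have car: "x \<in> carrier (presented_lie R) \<longleftrightarrow> (\<exists>s. x = ?c s)" for x
    by (auto simp: presented_lie_simps)
  note s = presented_lie_simps(2-5) lie_class_eq_iff
  have inv: "\<exists>y\<in>carrier (presented_lie R). y \<oplus>\<^bsub>presented_lie R\<^esub> x = \<zero>\<^bsub>presented_lie R\<^esub>"
    if "x \<in> carrier (presented_lie R)" for x
  proof -
    from that obtain s where x: "x = ?c s" unfolding car by blast
    have "?c (Scale (-1) s) \<oplus>\<^bsub>presented_lie R\<^esub> x = \<zero>\<^bsub>presented_lie R\<^esub>"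
      unfolding x s by (rule lie_eq.Plus_inverse)
    moreover have "?c (Scale (-1) s) \<in> carrier (presented_lie R)" unfolding car by blast
    ultimately show ?thesis by (rule bexI)
  qed
  have abel: "abelian_group (presented_lie R)"
    by (rule abelian_groupI; (erule inv |
        (unfold car; (elim exE)?; (simp only: s)?; (rule exI)?;
         rule lie_eq.refl lie_eq.Plus_assoc lie_eq.Plus_comm lie_eq.Plus_Zero)))
  have "module complex_field (presented_lie R)"
    by (rule moduleI; (rule abel | rule cring_from_type_algebra |
        (unfold car complex_field_simps; (elim exE)?; (simp only: s)?; (rule exI)?;
         rule lie_eq.refl lie_eq.Scale_Plus lie_eq.Scale_add lie_eq.Scale_mult lie_eq.Scale_one)))
  moreover have "complex_lie_algebra_axioms (presented_lie R)"
    by (rule complex_lie_algebra_axioms.intro; unfold car; (elim exE)?; (simp only: s)?;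
        (rule exI)?; rule lie_eq.refl lie_eq.Bracket_Plus_left lie_eq.Bracket_Plus_right lie_eq.Bracket_Scale_left
          lie_eq.Bracket_Scale_right lie_eq.Bracket_self lie_eq.Jacobi)
  ultimately show ?thesis by (rule complex_lie_algebra.intro)
qed

primrec lie_eval :: "('b, 'm) lie_structure_scheme \<Rightarrow> ('g \<Rightarrow> 'b) \<Rightarrow> 'g lie_term \<Rightarrow> 'b" where
  "lie_eval L f (Gen g) = f g"
| "lie_eval L f Zero = \<zero>\<^bsub>L\<^esub>"
| "lie_eval L f (Plus s t) = lie_eval L f s \<oplus>\<^bsub>L\<^esub> lie_eval L f t"
| "lie_eval L f (Scale a s) = a \<odot>\<^bsub>L\<^esub> lie_eval L f s"
| "lie_eval L f (Bracket s t) = lie_bracket L (lie_eval L f s) (lie_eval L f t)"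

lemma (in complex_lie_algebra) lie_eval_closed:
  assumes "\<And>g. f g \<in> carrier L"
  shows "lie_eval L f s \<in> carrier L"
  by (induction s) (simp_all add: assms bracket_closed complex_field_simps)

lemma (in complex_lie_algebra) lie_eval_cong:
  assumes f: "\<And>g. f g \<in> carrier L"
    and R: "\<And>s t. (s, t) \<in> R \<Longrightarrow> lie_eval L f s = lie_eval L f t"
    and "lie_eq R s t"
  shows "lie_eval L f s = lie_eval L f t"
proof -
  note c = lie_eval_closed[of f, OF f]
  have neg: "(-1) \<odot> x \<oplus> x = \<zero>" if "x \<in> carrier L" for x
    using smult_l_distr[of "-1" 1 x] smult_one[OF that] smult_l_null[OF that] that
    by (simp add: complex_field_simps)
  show ?thesis
    using assms(3)
  proof (induction rule: lie_eq.induct)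
    case (Scale_add a b s)
    show ?case using smult_l_distr[of a b "lie_eval L f s"] c by (simp add: complex_field_simps)
  next
    case (Scale_mult a b s)
    show ?case using smult_assoc1[of a b "lie_eval L f s"] c by (simp add: complex_field_simps)
  next
    case (Scale_one s)
    show ?case using smult_one[of "lie_eval L f s"] c by (simp add: complex_field_simps)
  next
    case (Scale_Plus a s t)
    show ?case
      using smult_r_distr[of a "lie_eval L f s" "lie_eval L f t"] c by (simp add: complex_field_simps)
  next
    case (Plus_assoc s t u)
    show ?case using a_assoc[of "lie_eval L f s" "lie_eval L f t" "lie_eval L f u"] c by simp
  next
    case (Plus_comm s t)
    show ?case using a_comm[of "lie_eval L f s" "lie_eval L f t"] c by simp
  qed (simp_all add: R c neg bracket_add_left bracket_add_right bracket_smult_left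
        bracket_smult_right bracket_self jacobi)
qed

theorem presented_lie_universal:
  assumes L: "complex_lie_algebra L"
    and f: "\<And>g. f g \<in> carrier L"
    and R: "\<And>s t. (s, t) \<in> R \<Longrightarrow> lie_eval L f s = lie_eval L f t"
  shows "\<exists>h \<in> lie_hom (presented_lie R) L. (\<forall>g. h (lie_class R (Gen g)) = f g) \<and>
    (\<forall>h' \<in> lie_hom (presented_lie R) L. (\<forall>g. h' (lie_class R (Gen g)) = f g) \<longrightarrow>
      (\<forall>x \<in> carrier (presented_lie R). h' x = h x))"
proof -
  interpret complex_lie_algebra L by (rule L)
  define h where "h P = lie_eval L f (SOME s. lie_class R s = P)" for P
  have h: "h (lie_class R s) = lie_eval L f s" for s
  proof -
    have "lie_class R (SOME s'. lie_class R s' = lie_class R s) = lie_class R s"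
      by (rule someI[of _ s]) simp
    then show ?thesis
      unfolding h_def lie_class_eq_iff using lie_eval_cong[OF f R] by blast
  qed
  have "h \<in> lie_hom (presented_lie R) L"
    using lie_eval_closed[OF f] by (auto simp: lie_hom_def presented_lie_simps h)
  moreover have "h' (lie_class R s) = lie_eval L f s"
    if h': "h' \<in> lie_hom (presented_lie R) L" and g: "\<forall>g. h' (lie_class R (Gen g)) = f g" for h' s
  proof (induction s)
    case Zero
    have "lie_class R Zero = 0 \<odot>\<^bsub>presented_lie R\<^esub> lie_class R Zero"
    proof -
      interpret pres: complex_lie_algebra "presented_lie R" by (rule complex_lie_algebra_presented_lie)
      show ?thesis
        using pres.smult_l_null[of "lie_class R Zero"] by (simp add: presented_lie_simps complex_field_simps)
    qed
    moreover have "h' (0 \<odot>\<^bsub>presented_lie R\<^esub> lie_class R Zero) = 0 \<odot>\<^bsub>L\<^esub> h' (lie_class R Zero)"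
      using h' unfolding lie_hom_def by (auto simp: presented_lie_simps(1))
    ultimately have "h' (lie_class R Zero) = 0 \<odot>\<^bsub>L\<^esub> h' (lie_class R Zero)"
      by simp
    also have "\<dots> = \<zero>\<^bsub>L\<^esub>"
      using h' smult_l_null[of "h' (lie_class R Zero)"]
      by (auto simp: lie_hom_def presented_lie_simps complex_field_simps)
    finally show ?case by simp
  next
    case (Plus s t)
    have "h' (lie_class R s \<oplus>\<^bsub>presented_lie R\<^esub> lie_class R t) = h' (lie_class R s) \<oplus>\<^bsub>L\<^esub> h' (lie_class R t)"
      using h' unfolding lie_hom_def by (auto simp: presented_lie_simps(1))
    then show ?case by (simp add: presented_lie_simps Plus)
  next
    case (Scale a s)
    have "h' (a \<odot>\<^bsub>presented_lie R\<^esub> lie_class R s) = a \<odot>\<^bsub>L\<^esub> h' (lie_class R s)"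
      using h' unfolding lie_hom_def by (auto simp: presented_lie_simps(1))
    then show ?case by (simp add: presented_lie_simps Scale)
  next
    case (Bracket s t)
    have "h' (lie_bracket (presented_lie R) (lie_class R s) (lie_class R t))
        = lie_bracket L (h' (lie_class R s)) (h' (lie_class R t))"
      using h' unfolding lie_hom_def by (auto simp: presented_lie_simps(1))
    then show ?case by (simp add: presented_lie_simps Bracket)
  qed (simp add: g)
  ultimately have "\<forall>h' \<in> lie_hom (presented_lie R) L. (\<forall>g. h' (lie_class R (Gen g)) = f g) \<longrightarrow>
      (\<forall>x \<in> carrier (presented_lie R). h' x = h x)"
    by (simp add: h presented_lie_simps(1))
  then show ?thesis
    using \<open>h \<in> lie_hom (presented_lie R) L\<close> h by (intro bexI[of _ h] conjI) simp_all
qed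


section \<open>The Lie algebra \<open>D\<^sub>S\<close>\<close>

definition int_multiple :: "int \<Rightarrow> 's::ab_group_add \<Rightarrow> 's" (infixr \<open>\<cdot>\<^sub>Z\<close> 75) where
  "m \<cdot>\<^sub>Z a = (if 0 \<le> m then (((+) a) ^^ nat m) 0 else - (((+) a) ^^ nat (- m)) 0)"

definition q_int :: "complex \<Rightarrow> int \<Rightarrow> complex" where
  "q_int q n =
    (if q = 1 then of_int n
     else if q = -1 then of_int n * (-1) powi (n - 1)
     else (q powi n - q powi (- n)) / (q - inverse q))"

datatype 's D_gen = C | D 's int

text \<open>\<open>D_relations \<chi>\<close> for \<open>\<chi> : S \<rightarrow> \<complex>\<^sup>\<times>\<close>, where the group \<open>S\<close> is the whole type \<open>'s\<close>.\<close>

inductive_set D_relations ::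
    "('s::ab_group_add \<Rightarrow> complex) \<Rightarrow> ('s D_gen lie_term \<times> 's D_gen lie_term) set"
  for \<chi> :: "'s \<Rightarrow> complex" where
  central: "(Bracket (Gen C) t, Zero) \<in> D_relations \<chi>"
| neg: "(Gen (D (- \<alpha>) n), Scale (-1) (Gen (D \<alpha> n))) \<in> D_relations \<chi>"
| bracket: "(Bracket (Gen (D \<alpha> n)) (Gen (D \<beta> m)),
     Plus (Plus
       (Scale (\<chi> (m \<cdot>\<^sub>Z \<alpha> - n \<cdot>\<^sub>Z \<beta>) - \<chi> (n \<cdot>\<^sub>Z \<beta> - m \<cdot>\<^sub>Z \<alpha>)) (Gen (D (\<alpha> + \<beta>) (m + n))))
       (Scale (- (\<chi> (m \<cdot>\<^sub>Z \<alpha> + n \<cdot>\<^sub>Z \<beta>) - \<chi> (- (m \<cdot>\<^sub>Z \<alpha>) - n \<cdot>\<^sub>Z \<beta>))) (Gen (D (\<alpha> - \<beta>) (m + n)))))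
       (Scale ((q_int (\<chi> (\<alpha> + \<beta>)) m - q_int (\<chi> (\<alpha> - \<beta>)) m) * (if m + n = 0 then 1 else 0)) (Gen C)))
     \<in> D_relations \<chi>"

definition D_lie :: "('s::ab_group_add \<Rightarrow> complex) \<Rightarrow> 's D_gen lie_term set lie_structure" where
  "D_lie \<chi> = presented_lie (D_relations \<chi>)"


section \<open>Affine Lie algebras without derivation\<close>

text \<open>An element \<open>(\<Sum>n. f n \<otimes> t\<^sup>n) + a k\<close> of \<open>\<gg> \<otimes> \<complex>[t, t\<^sup>-\<^sup>1] \<oplus> \<complex> k\<close> is the pair \<open>(f, a)\<close>
  with \<open>f\<close> finitely supported.\<close>

definition laurent_support :: "('a, 'm) lie_structure_scheme \<Rightarrow> (int \<Rightarrow> 'a) \<Rightarrow> int set" where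
  "laurent_support \<gg> f = {n. f n \<noteq> \<zero>\<^bsub>\<gg>\<^esub>}"

definition affine_lie ::
    "('a, 'm) lie_structure_scheme \<Rightarrow> ('a \<Rightarrow> 'a \<Rightarrow> complex) \<Rightarrow> ((int \<Rightarrow> 'a) \<times> complex) lie_structure" where
  "affine_lie \<gg> B = \<lparr>
     carrier = {f. (\<forall>n. f n \<in> carrier \<gg>) \<and> finite (laurent_support \<gg> f)} \<times> UNIV,
     monoid.mult = undefined, one = undefined,
     ring.zero = ((\<lambda>n. \<zero>\<^bsub>\<gg>\<^esub>), 0),
     add = (\<lambda>(f, a) (g, b). ((\<lambda>n. f n \<oplus>\<^bsub>\<gg>\<^esub> g n), a + b)),
     module.smult = (\<lambda>c (f, a). ((\<lambda>n. c \<odot>\<^bsub>\<gg>\<^esub> f n), c * a)),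
     lie_bracket = (\<lambda>(f, a) (g, b).
       ((\<lambda>k. \<Oplus>\<^bsub>\<gg>\<^esub>m\<in>laurent_support \<gg> f. lie_bracket \<gg> (f m) (g (k - m))),
        (\<Sum>m\<in>laurent_support \<gg> f. of_int m * B (f m) (g (- m)))))\<rparr>"

lemma affine_lie_bracket_monomials:
  assumes "complex_lie_algebra \<gg>" "nondegenerate_invariant_form \<gg> B"
    and x: "x \<in> carrier \<gg>" and y: "y \<in> carrier \<gg>"
  defines "single \<equiv> \<lambda>z m. (\<lambda>k::int. if k = m then z else \<zero>\<^bsub>\<gg>\<^esub>)"
  shows "lie_bracket (affine_lie \<gg> B) (single x m, a) (single y n, b) =
    (single (lie_bracket \<gg> x y) (m + n), of_int m * (if m + n = 0 then 1 else 0) * B x y)"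
proof -
  interpret complex_lie_algebra \<gg> by fact
  have zr: "lie_bracket \<gg> z \<zero>\<^bsub>\<gg>\<^esub> = \<zero>\<^bsub>\<gg>\<^esub>" if "z \<in> carrier \<gg>" for z
    using bracket_smult_right[of z "\<zero>\<^bsub>\<gg>\<^esub>" 0] that bracket_closed[of z "\<zero>\<^bsub>\<gg>\<^esub>"]
      smult_l_null[of "\<zero>\<^bsub>\<gg>\<^esub>"] smult_l_null[of "lie_bracket \<gg> z \<zero>\<^bsub>\<gg>\<^esub>"]
    by (simp add: complex_field_simps)
  have zl: "lie_bracket \<gg> \<zero>\<^bsub>\<gg>\<^esub> z = \<zero>\<^bsub>\<gg>\<^esub>" if "z \<in> carrier \<gg>" for z
    using bracket_smult_left[of "\<zero>\<^bsub>\<gg>\<^esub>" z 0] that bracket_closed[of "\<zero>\<^bsub>\<gg>\<^esub>" z]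
      smult_l_null[of "\<zero>\<^bsub>\<gg>\<^esub>"] smult_l_null[of "lie_bracket \<gg> \<zero>\<^bsub>\<gg>\<^esub> z"]
    by (simp add: complex_field_simps)
  have "B (0 \<odot>\<^bsub>\<gg>\<^esub> \<zero>\<^bsub>\<gg>\<^esub>) z = 0 * B \<zero>\<^bsub>\<gg>\<^esub> z" if "z \<in> carrier \<gg>" for z
    using assms(2) that unfolding nondegenerate_invariant_form_def by blast
  then have Bl: "B \<zero>\<^bsub>\<gg>\<^esub> z = 0" if "z \<in> carrier \<gg>" for z
    using that smult_l_null[of "\<zero>\<^bsub>\<gg>\<^esub>"] by (simp add: complex_field_simps)
  have Br: "B z \<zero>\<^bsub>\<gg>\<^esub> = 0" if "z \<in> carrier \<gg>" for z
  proof -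
    have "B z \<zero>\<^bsub>\<gg>\<^esub> = B \<zero>\<^bsub>\<gg>\<^esub> z"
      using assms(2) that zero_closed unfolding nondegenerate_invariant_form_def by blast
    then show ?thesis using Bl[OF that] by simp
  qed
  show ?thesis
  proof (cases "x = \<zero>\<^bsub>\<gg>\<^esub>")
    case True
    then have "laurent_support \<gg> (single x m) = {}"
      by (auto simp: laurent_support_def single_def)
    then show ?thesis using True y by (auto simp: affine_lie_def zl Bl) (auto simp: single_def)
  next
    case False
    then have supp: "laurent_support \<gg> (single x m) = {m}"
      by (auto simp: laurent_support_def single_def)
    have "(\<Oplus>\<^bsub>\<gg>\<^esub>i\<in>{m}. lie_bracket \<gg> (single x m i) (single y n (k - i)))
        = single (lie_bracket \<gg> x y) (m + n) k" for k
      using x y bracket_closed[OF x y] by (auto simp: single_def zr)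
    then show ?thesis using x by (auto simp: affine_lie_def supp) (auto simp: single_def Br)
  qed
qed

text \<open>\<open>so(n, \<complex>)\<close> as the skew-symmetric matrices; for \<open>n = 2 l + 1\<close> it is of type \<open>B\<^sub>l\<close>.\<close>

definition so_lie :: "nat \<Rightarrow> complex mat lie_structure" where
  "so_lie n = \<lparr>
     carrier = {A \<in> carrier_mat n n. transpose_mat A = - A},
     monoid.mult = undefined, one = undefined,
     ring.zero = 0\<^sub>m n n,
     add = (+),
     module.smult = (\<cdot>\<^sub>m),
     lie_bracket = (\<lambda>A B. A * B - B * A)\<rparr>"

lemma so_lie_simps:
  "A \<in> carrier (so_lie n) \<longleftrightarrow> A \<in> carrier_mat n n \<and> transpose_mat A = - A"
  "\<zero>\<^bsub>so_lie n\<^esub> = 0\<^sub>m n n" "A \<oplus>\<^bsub>so_lie n\<^esub> B = A + B"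
  "a \<odot>\<^bsub>so_lie n\<^esub> A = a \<cdot>\<^sub>m A" "lie_bracket (so_lie n) A B = A * B - B * A"
  by (simp_all add: so_lie_def)

lemma complex_lie_algebra_so_lie: "complex_lie_algebra (so_lie n)"
proof -
  have ext: "A = B"
    if "A \<in> carrier_mat n n" "B \<in> carrier_mat n n" "\<And>i j. i < n \<Longrightarrow> j < n \<Longrightarrow> A $$ (i, j) = B $$ (i, j)"
    for A B :: "complex mat"
    using that by (intro eq_matI) auto
  have closed: "0\<^sub>m n n \<in> carrier (so_lie n)"
    "\<And>A. A \<in> carrier (so_lie n) \<Longrightarrow> - A \<in> carrier (so_lie n)"
    "\<And>A B. A \<in> carrier (so_lie n) \<Longrightarrow> B \<in> carrier (so_lie n) \<Longrightarrow> A + B \<in> carrier (so_lie n)"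
    "\<And>a A. A \<in> carrier (so_lie n) \<Longrightarrow> a \<cdot>\<^sub>m A \<in> carrier (so_lie n)"
    unfolding so_lie_simps
       apply (intro conjI; (simp; fail | rule ext; simp))
      apply (simp add: transpose_uminus)
     apply (clarsimp simp: transpose_add[of _ n n])
     apply (rule ext; simp)
    apply clarsimp
    subgoal premises p for a A
    proof -
      have "transpose_mat (a \<cdot>\<^sub>m A) = a \<cdot>\<^sub>m transpose_mat A"
        using p(1) by (intro eq_matI) auto
      also have "\<dots> = - (a \<cdot>\<^sub>m A)"
        unfolding p(2) using p(1) by (intro eq_matI) auto
      finally show ?thesis .
    qed
    done
  have mat: "A \<in> carrier_mat n n" if "A \<in> carrier (so_lie n)" for A
    using that by (simp add: so_lie_simps)
  have dim: "dim_row A = n" "dim_col A = n" if "A \<in> carrier (so_lie n)" for A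
    using mat[OF that] by auto
  have abel: "abelian_group (so_lie n)"
  proof (rule abelian_groupI)
    fix A assume "A \<in> carrier (so_lie n)"
    then show "\<exists>B\<in>carrier (so_lie n). B \<oplus>\<^bsub>so_lie n\<^esub> A = \<zero>\<^bsub>so_lie n\<^esub>"
      using closed(2) mat by (intro bexI[of _ "- A"]) (simp_all add: so_lie_simps(2-4))
  qed (use closed mat in \<open>auto simp: dim so_lie_simps(2-4) intro!: ext\<close>)
  note distribs = add_mult_distrib_mat[of _ n n _ _ n] mult_add_distrib_mat[of _ n n _ n]
    mult_smult_distrib[of _ n n _ n] mult_smult_assoc_mat[of _ n n _ n] right_diff_distrib
  have "module complex_field (so_lie n)"
    by (rule moduleI)
       (use closed mat abel in \<open>auto simp: dim so_lie_simps(2-4) complex_field_simps algebra_simps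
          cring_from_type_algebra intro!: ext\<close>)
  moreover have bracket: "A * B - B * A \<in> carrier (so_lie n)"
    if "A \<in> carrier (so_lie n)" "B \<in> carrier (so_lie n)" for A B
  proof -
    have A: "A \<in> carrier_mat n n" "transpose_mat A = - A" and B: "B \<in> carrier_mat n n" "transpose_mat B = - B"
      using that by (simp_all add: so_lie_simps)
    have "transpose_mat (A * B - B * A) = transpose_mat (A * B) - transpose_mat (B * A)"
      using A(1) B(1) by (intro transpose_minus[of _ n n]) auto
    also have "\<dots> = (- B) * (- A) - (- A) * (- B)"
      using A B by (simp add: transpose_mult[of _ n n _ n])
    also have "\<dots> = B * A - A * B"
      using A(1) B(1) by simp
    also have "\<dots> = - (A * B - B * A)"
      using A(1) B(1) by (intro ext) (auto simp del: index_mult_mat(1))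
    finally show ?thesis
      using A(1) B(1) by (auto simp: so_lie_simps)
  qed
  moreover have "A * (B * E - E * B) - (B * E - E * B) * A
      + (B * (E * A - A * E) - (E * A - A * E) * B)
      + (E * (A * B - B * A) - (A * B - B * A) * E) = 0\<^sub>m n n"
    if A: "A \<in> carrier_mat n n" and B: "B \<in> carrier_mat n n" and E: "E \<in> carrier_mat n n"
    for A B E :: "complex mat"
  proof -
    have e: "P * (Q * T - T * Q) - (Q * T - T * Q) * P
        = (P * (Q * T) - P * (T * Q)) - (Q * (T * P) - T * (Q * P))"
      if "P \<in> carrier_mat n n" "Q \<in> carrier_mat n n" "T \<in> carrier_mat n n" for P Q T :: "complex mat"
      using that by (simp add: mult_minus_distrib_mat[of _ n n _ n] minus_mult_distrib_mat[of _ n n _ _ n]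
          assoc_mult_mat[of _ n n _ n _ n])
    show ?thesis
      unfolding e[OF A B E] e[OF B E A] e[OF E A B]
      using A B E by (intro eq_matI) (auto simp del: index_mult_mat(1))
  qed
  moreover have "(A + B) * E - E * (A + B) = (A * E - E * A) + (B * E - E * B)"
    if "A \<in> carrier_mat n n" "B \<in> carrier_mat n n" "E \<in> carrier_mat n n" for A B E :: "complex mat"
    using that by (intro eq_matI) (simp_all add: distribs del: index_mult_mat(1))
  moreover have "E * (A + B) - (A + B) * E = (E * A - A * E) + (E * B - B * E)"
    if "A \<in> carrier_mat n n" "B \<in> carrier_mat n n" "E \<in> carrier_mat n n" for A B E :: "complex mat"
    using that by (intro eq_matI) (simp_all add: distribs del: index_mult_mat(1))
  moreover have "(a \<cdot>\<^sub>m A) * B - B * (a \<cdot>\<^sub>m A) = a \<cdot>\<^sub>m (A * B - B * A)"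
    if "A \<in> carrier_mat n n" "B \<in> carrier_mat n n" for A B :: "complex mat" and a
    using that by (intro eq_matI) (simp_all add: distribs del: index_mult_mat(1))
  moreover have "A * (a \<cdot>\<^sub>m B) - (a \<cdot>\<^sub>m B) * A = a \<cdot>\<^sub>m (A * B - B * A)"
    if "A \<in> carrier_mat n n" "B \<in> carrier_mat n n" for A B :: "complex mat" and a
    using that by (intro eq_matI) (simp_all add: distribs del: index_mult_mat(1))
  moreover have "A * A - A * A = 0\<^sub>m n n"
    if "A \<in> carrier_mat n n" for A :: "complex mat"
    using that by (intro eq_matI) (simp_all add: distribs del: index_mult_mat(1))
  ultimately show ?thesis
    by (intro complex_lie_algebra.intro complex_lie_algebra_axioms.intro)
       (simp_all only: so_lie_simps(2-5) mat)
qed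

text \<open>Forms as required by \<open>affine_B\<close> below exist:\<close>

lemma trace_form_so_lie:
  "nondegenerate_invariant_form (so_lie n) (\<lambda>A B. \<Sum>i<n. (A * B) $$ (i, i))"
proof -
  define tr where "tr A = (\<Sum>i<n. A $$ (i, i))" for A :: "complex mat"
  have entry: "(A * B) $$ (i, j) = (\<Sum>k<n. A $$ (i, k) * B $$ (k, j))"
    if "A \<in> carrier_mat n n" "B \<in> carrier_mat n n" "i < n" "j < n" for A B :: "complex mat" and i j
    using that by (auto simp: scalar_prod_def atLeast0LessThan intro!: sum.cong)
  have tr_prod: "tr (A * B) = (\<Sum>i<n. \<Sum>k<n. A $$ (i, k) * B $$ (k, i))"
    if "A \<in> carrier_mat n n" "B \<in> carrier_mat n n" for A B :: "complex mat"
    unfolding tr_def using that by (intro sum.cong) (auto simp: entry simp del: index_mult_mat(1))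
  have comm: "tr (A * B) = tr (B * A)"
    if "A \<in> carrier_mat n n" "B \<in> carrier_mat n n" for A B :: "complex mat"
    unfolding tr_prod[OF that] tr_prod[OF that(2,1)] by (subst sum.swap) (simp add: mult.commute)
  have diff: "tr (A - B) = tr A - tr B"
    if "A \<in> carrier_mat n n" "B \<in> carrier_mat n n" for A B :: "complex mat"
    using that by (simp add: tr_def sum_subtractf)
  have inv: "tr ((A * B - B * A) * E) = tr (A * (B * E - E * B))"
    if A: "A \<in> carrier_mat n n" and B: "B \<in> carrier_mat n n" and E: "E \<in> carrier_mat n n"
    for A B E :: "complex mat"
  proof -
    have "tr ((A * B - B * A) * E) = tr (A * (B * E)) - tr (B * (A * E))"
      using that by (simp add: minus_mult_distrib_mat[of _ n n _ _ n] assoc_mult_mat[of _ n n _ n _ n] diff)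
    also have "tr (B * (A * E)) = tr (A * (E * B))"
      using comm[of B "A * E"] that by (simp add: assoc_mult_mat[of _ n n _ n _ n])
    also have "tr (A * (B * E)) - tr (A * (E * B)) = tr (A * (B * E - E * B))"
      using that by (simp add: mult_minus_distrib_mat[of _ n n _ n] diff)
    finally show ?thesis .
  qed
  have nondeg: "A = 0\<^sub>m n n"
    if A: "A \<in> carrier_mat n n" and skew: "transpose_mat A = - A"
      and 0: "\<And>B. B \<in> carrier_mat n n \<Longrightarrow> transpose_mat B = - B \<Longrightarrow> tr (A * B) = 0"
    for A :: "complex mat"
  proof -
    define E where "E = mat n n (\<lambda>(i, j). cnj (A $$ (j, i)))"
    have sk: "A $$ (j, i) = - A $$ (i, j)" if "i < n" "j < n" for i j
      using arg_cong[OF skew, of "\<lambda>M. M $$ (i, j)"] A that by simp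
    have "transpose_mat E = - E"
    proof (rule eq_matI)
      fix i j assume "i < dim_row (- E)" "j < dim_col (- E)"
      then show "transpose_mat E $$ (i, j) = (- E) $$ (i, j)"
        using sk[of i j] by (simp add: E_def)
    qed (simp_all add: E_def)
    then have E: "E \<in> carrier_mat n n" "transpose_mat E = - E"
      by (simp_all add: E_def)
    have "0 = tr (A * E)" using 0[OF E] by simp
    also have "\<dots> = of_real (\<Sum>i<n. \<Sum>k<n. (cmod (A $$ (i, k)))\<^sup>2)"
      unfolding tr_prod[OF A E(1)] of_real_sum complex_norm_square
      by (intro sum.cong refl) (simp_all add: E_def)
    finally have "complex_of_real (\<Sum>i<n. \<Sum>k<n. (cmod (A $$ (i, k)))\<^sup>2) = 0"
      by (rule HOL.sym)
    then have *: "(\<Sum>i<n. \<Sum>k<n. (cmod (A $$ (i, k)))\<^sup>2) = 0"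
      by (rule of_real_eq_0_iff[THEN iffD1])
    have "A $$ (i, k) = 0" if "i < n" "k < n" for i k
    proof -
      have "(\<Sum>k<n. (cmod (A $$ (i, k)))\<^sup>2) = 0"
        using sum_nonneg_0[OF _ _ *, of i] that(1) by (simp add: sum_nonneg)
      from sum_nonneg_0[OF _ _ this, of k] that(2) show ?thesis by simp
    qed
    then show ?thesis using A by (intro eq_matI) auto
  qed
  have add: "tr ((A + B) * E) = tr (A * E) + tr (B * E)"
    if "A \<in> carrier_mat n n" "B \<in> carrier_mat n n" "E \<in> carrier_mat n n" for A B E :: "complex mat"
    using that by (simp add: add_mult_distrib_mat[of _ n n _ _ n] tr_def sum.distrib del: index_mult_mat(1))
  have smult: "tr ((a \<cdot>\<^sub>m A) * B) = a * tr (A * B)"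
    if "A \<in> carrier_mat n n" "B \<in> carrier_mat n n" for a and A B :: "complex mat"
    using that by (simp add: mult_smult_assoc_mat[of _ n n _ n] tr_def sum_distrib_left del: index_mult_mat(1))
  have mat: "A \<in> carrier_mat n n" if "A \<in> carrier (so_lie n)" for A
    using that by (simp add: so_lie_simps)
  have nondeg': "A = 0\<^sub>m n n"
    if "A \<in> carrier (so_lie n)" "\<forall>B\<in>carrier (so_lie n). tr (A * B) = 0" for A
    using that by (intro nondeg) (simp_all add: so_lie_simps)
  show ?thesis
    unfolding nondegenerate_invariant_form_def so_lie_simps(2-5) tr_def[symmetric]
    by (intro conjI ballI allI impI;
        ((rule nondeg'; assumption) | (rule add smult comm inv; rule mat; assumption)))
qed

abbreviation affine_B :: "nat \<Rightarrow> (complex mat \<Rightarrow> complex mat \<Rightarrow> complex)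
    \<Rightarrow> ((int \<Rightarrow> complex mat) \<times> complex) lie_structure" where
  "affine_B l B \<equiv> affine_lie (so_lie (2 * l + 1)) B"

end

theory Submission
  imports Defs
begin

text \<open>Write \<open>N = 2 l + 1\<close>.  The elements \<open>E\<^sup>\<alpha>(n)\<close> of the quantum torus with product
  \<open>E\<^sup>\<alpha>(n) E\<^sup>\<beta>(m) = \<chi>(m \<alpha> - n \<beta>) E\<^sup>\<alpha>\<^sup>+\<^sup>\<beta>(n + m)\<close> act as banded \<open>\<int> \<times> \<int>\<close> matrices of period \<open>N\<close>
  along the diagonal, with entry \<open>\<chi>(\<alpha>)\<^sup>p\<^sup>+\<^sup>q\<close> where \<open>p - q = n\<close>.  Since \<open>\<chi>\<close> identifies \<open>S\<close> with the
  group of all \<open>N\<close>-th roots of unity and \<open>N\<close> is odd, Fourier inversion shows that they form a basis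
  of all such matrices.  Up to central terms \<open>D\<^sup>\<alpha>(n)\<close> is \<open>E\<^sup>\<alpha>(n) - E\<^sup>-\<^sup>\<alpha>(n)\<close>, so \<open>D\<^sub>S\<close> is a central extension of
  the matrices that are skew for the reflection \<open>(p, q) \<mapsto> (-q, -p)\<close>.

  Cutting a periodic matrix into \<open>N \<times> N\<close> blocks with rows and columns indexed by \<open>-l, \<dots>, l\<close> turns it
  into a Laurent polynomial of matrices.  The discrete Fourier vectors form a basis dual to itself
  under \<open>a \<mapsto> -a\<close> for the standard symmetric form, hence conjugation by them turns the reflection into
  transposition, and the skew matrices become the loop algebra of \<open>so(N)\<close>.  All invariant forms on
  \<open>so(N)\<close> are proportional, so the cocycles agree up to a scalar and two explicit coboundaries: one
  for the \<open>q\<close>-integers, one for the change from the grading by \<open>p - q\<close> to the loop grading.\<close>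

section \<open>Banded matrices\<close>

text \<open>The obstacle is that \<open>D\<^sub>S\<close> is only presented: nothing says beforehand
  that the classes of its generators are as independent as the visible relations allow. A
  homomorphism to a concrete algebra and its surjectivity are cheap; injectivity comes from a
  candidate inverse. By the relations, every bracket of two generators is a linear combination of
  generators, so these span, and it suffices to write Fourier inversion as a linear map back and to
  check it on generators. Averaging over all of S with a factor 1/2 avoids choosing representatives
  of the pairs \<alpha>, -\<alpha>.

  That N is odd enters in three ways. The entries have exponent p + q, so a diagonal sees only the
  square of \<chi>(\<alpha>), and squaring has to be injective on the values of \<chi>. The value -1
  does not occur, so the q-integers have a single exceptional parameter. And a period can be
  represented by an interval symmetric about 0, which the reflection respects.

  The central generator goes to -2 N: the identity has trace N over one period, and the four
  products in a pairing of two skew elements agree in pairs.\<close>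

typedef (overloaded) 'a banded =
  "{A :: int \<Rightarrow> int \<Rightarrow> 'a::zero. \<exists>w. \<forall>p q. A p q \<noteq> 0 \<longrightarrow> \<bar>p - q\<bar> \<le> w}"
  morphisms entry Banded
  by (rule exI[of _ "\<lambda>_ _. 0"]) simp

setup_lifting type_definition_banded

lemma banded_eqI: "(\<And>p q. entry A p q = entry B p q) \<Longrightarrow> A = B"
  by (metis entry_inject ext)

lemma finite_int_near: "finite {r::int. \<bar>p - r\<bar> \<le> w}"
  by (rule finite_subset[of _ "{p - w..p + w}"]) auto

lemma entry_bandE:
  obtains w where "\<And>p q. entry A p q \<noteq> 0 \<Longrightarrow> \<bar>p - q\<bar> \<le> w"
  using entry[of A] by auto

lemma finite_row: "finite {r. entry A p r \<noteq> 0}"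
proof -
  obtain w where "\<And>p q. entry A p q \<noteq> 0 \<Longrightarrow> \<bar>p - q\<bar> \<le> w" using entry_bandE by blast
  then show ?thesis by (intro finite_subset[OF _ finite_int_near[of p w]]) auto
qed

text \<open>Bandedness makes all rows finite, so a product is a finite sum for arbitrary entries.
  With the ring laws available, the identities for commutators below are pure algebra.\<close>

instantiation banded :: (ring) ring
begin

lift_definition zero_banded :: "'a banded" is "\<lambda>_ _. 0" by simp

lift_definition plus_banded :: "'a banded \<Rightarrow> 'a banded \<Rightarrow> 'a banded" is "\<lambda>A B p q. A p q + B p q"
proof -
  fix A B :: "int \<Rightarrow> int \<Rightarrow> 'a"
  assume "\<exists>w. \<forall>p q. A p q \<noteq> 0 \<longrightarrow> \<bar>p - q\<bar> \<le> w" "\<exists>w. \<forall>p q. B p q \<noteq> 0 \<longrightarrow> \<bar>p - q\<bar> \<le> w"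
  then obtain v w where
    "\<And>p q. A p q \<noteq> 0 \<Longrightarrow> \<bar>p - q\<bar> \<le> v" "\<And>p q. B p q \<noteq> 0 \<Longrightarrow> \<bar>p - q\<bar> \<le> w" by blast
  then show "\<exists>w. \<forall>p q. A p q + B p q \<noteq> 0 \<longrightarrow> \<bar>p - q\<bar> \<le> w"
    by (intro exI[of _ "max v w"] allI impI) (metis add.right_neutral add_0 max.coboundedI1 max.coboundedI2)
qed

lift_definition uminus_banded :: "'a banded \<Rightarrow> 'a banded" is "\<lambda>A p q. - A p q" by simp

definition minus_banded :: "'a banded \<Rightarrow> 'a banded \<Rightarrow> 'a banded" where
  "minus_banded A B = A + - B"

lift_definition times_banded :: "'a banded \<Rightarrow> 'a banded \<Rightarrow> 'a banded"
  is "\<lambda>A B p q. \<Sum>r | A p r \<noteq> 0. A p r * B r q"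
proof -
  fix A B :: "int \<Rightarrow> int \<Rightarrow> 'a"
  assume "\<exists>w. \<forall>p q. A p q \<noteq> 0 \<longrightarrow> \<bar>p - q\<bar> \<le> w" "\<exists>w. \<forall>p q. B p q \<noteq> 0 \<longrightarrow> \<bar>p - q\<bar> \<le> w"
  then obtain v w where
    *: "\<And>p q. A p q \<noteq> 0 \<Longrightarrow> \<bar>p - q\<bar> \<le> v" "\<And>p q. B p q \<noteq> 0 \<Longrightarrow> \<bar>p - q\<bar> \<le> w" by blast
  show "\<exists>w. \<forall>p q. (\<Sum>r | A p r \<noteq> 0. A p r * B r q) \<noteq> 0 \<longrightarrow> \<bar>p - q\<bar> \<le> w"
  proof (intro exI[of _ "v + w"] allI impI)
    fix p q assume "(\<Sum>r | A p r \<noteq> 0. A p r * B r q) \<noteq> 0"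
    then obtain r where "A p r * B r q \<noteq> 0" by (rule sum.not_neutral_contains_not_neutral)
    then have "\<bar>p - r\<bar> \<le> v" "\<bar>r - q\<bar> \<le> w" using * mult_not_zero by blast+
    then show "\<bar>p - q\<bar> \<le> v + w" by linarith
  qed
qed

text \<open>Frees products from the index set of their definition, which depends on
  \<open>A\<close>, so that sums for different factors can be compared over a common one.\<close>

lemma entry_times:
  assumes "finite R" "\<And>r. entry A p r \<noteq> 0 \<Longrightarrow> entry B r q \<noteq> 0 \<Longrightarrow> r \<in> R"
  shows "entry (A * B) p q = (\<Sum>r\<in>R. entry A p r * entry B r q)"
proof -
  have "(\<Sum>r | entry A p r \<noteq> 0. entry A p r * entry B r q)
      = (\<Sum>r \<in> R \<inter> {r. entry A p r \<noteq> 0}. entry A p r * entry B r q)"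
    by (rule sum.mono_neutral_right) (use assms finite_row in \<open>auto dest: mult_not_zero\<close>)
  also have "\<dots> = (\<Sum>r\<in>R. entry A p r * entry B r q)"
    by (rule sum.mono_neutral_left) (use assms in \<open>auto dest: mult_not_zero\<close>)
  finally show ?thesis by (simp add: times_banded.rep_eq)
qed

lemma entry_simps_aux:
  "entry (0 :: 'a banded) p q = 0" "entry (A + B) p q = entry A p q + entry B p q"
  "entry (- A) p q = - entry A p q" "entry (A - B) p q = entry A p q - entry B p q"
  for A B :: "'a banded"
  by (simp_all only: zero_banded.rep_eq plus_banded.rep_eq uminus_banded.rep_eq minus_banded_def
      diff_conv_add_uminus)

instance
proof
  fix A B D :: "'a banded"
  show "A * B * D = A * (B * D)"
  proof (rule banded_eqI)
    fix p q
    let ?R = "{r. entry A p r \<noteq> 0}"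
    \<comment> \<open>The columns that row \<open>p\<close> reaches in two steps, through
      \<open>A\<close> and then \<open>B\<close>; both iterated sums live there.\<close>
    let ?S = "\<Union>r\<in>?R. {s. entry B r s \<noteq> 0}"
    have fR: "finite ?R" by (rule finite_row)
    then have fS: "finite ?S" by (auto intro: finite_row)
    have "entry (A * B) p s \<noteq> 0 \<Longrightarrow> s \<in> ?S" for s
    proof -
      assume "entry (A * B) p s \<noteq> 0"
      then have "\<exists>r\<in>?R. entry A p r * entry B r s \<noteq> 0"
        by (metis (no_types, lifting) sum.neutral times_banded.rep_eq)
      then show "s \<in> ?S" by force
    qed
    then have "entry (A * B * D) p q = (\<Sum>s\<in>?S. entry (A * B) p s * entry D s q)"
      by (intro entry_times fS)
    also have "\<dots> = (\<Sum>s\<in>?S. \<Sum>r\<in>?R. entry A p r * entry B r s * entry D s q)"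
      by (simp add: times_banded.rep_eq[of A] sum_distrib_right)
    also have "\<dots> = (\<Sum>r\<in>?R. \<Sum>s\<in>?S. entry A p r * (entry B r s * entry D s q))"
      by (subst sum.swap) (simp add: mult.assoc)
    also have "\<dots> = (\<Sum>r\<in>?R. entry A p r * entry (B * D) r q)"
      unfolding sum_distrib_left[symmetric]
      by (intro sum.cong HOL.refl arg_cong2[of _ _ _ _ "(*)"] entry_times[symmetric] fS) auto
    also have "\<dots> = entry (A * (B * D)) p q"
      by (intro entry_times[symmetric] fR) auto
    finally show "entry (A * B * D) p q = entry (A * (B * D)) p q" .
  qed
  show "A * (B + D) = A * B + A * D"
    by (rule banded_eqI)
      (simp add: times_banded.rep_eq entry_simps_aux distrib_left sum.distrib)
  show "(A + B) * D = A * D + B * D"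
  proof (rule banded_eqI)
    fix p q
    let ?R = "{r. entry A p r \<noteq> 0} \<union> {r. entry B p r \<noteq> 0}"
    have f: "finite ?R" by (simp add: finite_row)
    have "entry (T * D) p q = (\<Sum>r\<in>?R. entry T p r * entry D r q)" if "T \<in> {A, B, A + B}" for T
      using that by (intro entry_times[OF f]) (auto simp: entry_simps_aux)
    then show "entry ((A + B) * D) p q = entry (A * D + B * D) p q"
      by (simp add: entry_simps_aux distrib_right sum.distrib)
  qed
  show "A + B + D = A + (B + D)" "A + B = B + A" "0 + A = A" "- A + A = 0" "A - B = A + - B"
    by (auto intro!: banded_eqI simp: entry_simps_aux algebra_simps)
qed

end

lemmas entry_simps [simp] = entry_simps_aux

lemma entry_sum: "entry (sum f S) p q = (\<Sum>i\<in>S. entry (f i) p q)"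
  by (induction S rule: infinite_finite_induct) simp_all

lift_definition scale_banded :: "'a::ring \<Rightarrow> 'a banded \<Rightarrow> 'a banded" is "\<lambda>c A p q. c * A p q"
proof -
  fix c and A :: "int \<Rightarrow> int \<Rightarrow> 'a"
  assume "\<exists>w. \<forall>p q. A p q \<noteq> 0 \<longrightarrow> \<bar>p - q\<bar> \<le> w"
  then show "\<exists>w. \<forall>p q. c * A p q \<noteq> 0 \<longrightarrow> \<bar>p - q\<bar> \<le> w" by (metis mult_zero_right)
qed

lemmas entry_scale [simp] = scale_banded.rep_eq

lemma scale_banded_times:
  "scale_banded c A * B = scale_banded c (A * B)"
  "A * scale_banded c B = scale_banded c (A * B)" for c :: "'a::comm_ring"
proof -
  show "scale_banded c A * B = scale_banded c (A * B)"
  proof (rule banded_eqI)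
    fix p q
    have "entry (scale_banded c A * B) p q
        = (\<Sum>r | entry A p r \<noteq> 0. entry (scale_banded c A) p r * entry B r q)"
      by (rule entry_times[OF finite_row]) auto
    also have "\<dots> = c * (\<Sum>r | entry A p r \<noteq> 0. entry A p r * entry B r q)"
      by (simp add: sum_distrib_left mult.assoc)
    finally show "entry (scale_banded c A * B) p q = entry (scale_banded c (A * B)) p q"
      by (simp add: times_banded.rep_eq)
  qed
  show "A * scale_banded c B = scale_banded c (A * B)"
    by (rule banded_eqI) (simp add: times_banded.rep_eq sum_distrib_left mult.left_commute)
qed

text \<open>This is the commutator with the diagonal matrix with entries \<open>p\<close>. Over
  \<open>complex\<close> that matrix has no nonzero period, so among periodic matrices the
  derivation is not visibly inner, and the cocycle built from it need not be trivial.\<close>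

lift_definition grade_derivation :: "'a::ring_1 banded \<Rightarrow> 'a banded" is "\<lambda>A p q. of_int (p - q) * A p q"
proof -
  fix A :: "int \<Rightarrow> int \<Rightarrow> 'a"
  assume "\<exists>w. \<forall>p q. A p q \<noteq> 0 \<longrightarrow> \<bar>p - q\<bar> \<le> w"
  then show "\<exists>w. \<forall>p q. of_int (p - q) * A p q \<noteq> 0 \<longrightarrow> \<bar>p - q\<bar> \<le> w"
    by (metis mult_zero_right)
qed

lemmas entry_grade_derivation [simp] = grade_derivation.rep_eq

lemma grade_derivation_linear:
  "grade_derivation (A + B) = grade_derivation A + grade_derivation B"
  "grade_derivation (A - B) = grade_derivation A - grade_derivation B"
  "grade_derivation (scale_banded c A) = scale_banded c (grade_derivation A)"
  for c :: "'a::comm_ring_1"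
  by (auto intro!: banded_eqI simp: algebra_simps)

lemma grade_derivation_times:
  "grade_derivation (A * B) = grade_derivation A * B + A * grade_derivation B"
  for A :: "'a::comm_ring_1 banded"
proof (rule banded_eqI)
  fix p q
  have "entry (grade_derivation A * B) p q
      = (\<Sum>r | entry A p r \<noteq> 0. entry (grade_derivation A) p r * entry B r q)"
    by (rule entry_times[OF finite_row]) auto
  then show "entry (grade_derivation (A * B)) p q
      = entry (grade_derivation A * B + A * grade_derivation B) p q"
    by (simp add: times_banded.rep_eq sum_distrib_left flip: sum.distrib)
      (simp add: algebra_simps)
qed

section \<open>Periodic matrices and the reflection\<close>

definition periodic :: "int \<Rightarrow> 'a::zero banded \<Rightarrow> bool" where
  "periodic N A \<longleftrightarrow> (\<forall>p q. entry A (p + N) (q + N) = entry A p q)"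

lemma periodic_shift:
  assumes "periodic N A"
  shows "entry A (p + k * N) (q + k * N) = entry A p q"
proof -
  have step: "entry A (p + N) (q + N) = entry A p q" for p q
    using assms unfolding periodic_def by blast
  show ?thesis
  proof (induction k rule: int_induct[of _ 0])
    case (step1 i)
    then show ?case using step[of "p + i * N" "q + i * N"] by (simp add: algebra_simps)
  next
    case (step2 i)
    then show ?case using step[of "p + (i - 1) * N" "q + (i - 1) * N"] by (simp add: algebra_simps)
  qed simp
qed

lemma periodic_times:
  assumes A: "periodic N A" and B: "periodic N B"
  shows "periodic N (A * B)"
  unfolding periodic_def
proof (intro allI)
  fix p q
  have "entry (A * B) (p + N) (q + N)
      = (\<Sum>r\<in>(\<lambda>r. r + N) ` {r. entry A p r \<noteq> 0}. entry A (p + N) r * entry B r (q + N))"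
  proof (rule entry_times)
    fix r assume "entry A (p + N) r \<noteq> 0"
    moreover have "entry A (p + N) (r - N + N) = entry A p (r - N)"
      using A unfolding periodic_def by blast
    ultimately show "r \<in> (\<lambda>r. r + N) ` {r. entry A p r \<noteq> 0}"
      by (intro image_eqI[of _ _ "r - N"]) auto
  qed (simp add: finite_row)
  also have "\<dots> = (\<Sum>r | entry A p r \<noteq> 0. entry A p r * entry B r q)"
    using A B unfolding periodic_def by (subst sum.reindex) auto
  finally show "entry (A * B) (p + N) (q + N) = entry (A * B) p q"
    by (simp add: times_banded.rep_eq)
qed

lemma periodic_linear:
  fixes A B :: "'a::ring banded"
  shows "periodic N (0 :: 'a banded)"
    "periodic N A \<Longrightarrow> periodic N B \<Longrightarrow> periodic N (A + B)"
    "periodic N A \<Longrightarrow> periodic N B \<Longrightarrow> periodic N (A - B)"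
    "periodic N A \<Longrightarrow> periodic N (- A)"
    "periodic N A \<Longrightarrow> periodic N (scale_banded c A)"
  by (simp_all add: periodic_def)

lemma periodic_grade_derivation: "periodic N A \<Longrightarrow> periodic N (grade_derivation A)"
  by (simp add: periodic_def)

definition skew :: "'a::ring banded \<Rightarrow> bool" where
  "skew A \<longleftrightarrow> (\<forall>p q. entry A (- q) (- p) = - entry A p q)"

lemma skew_linear:
  fixes A B :: "'a::ring banded"
  shows "skew (0 :: 'a banded)"
    "skew A \<Longrightarrow> skew B \<Longrightarrow> skew (A + B)"
    "skew A \<Longrightarrow> skew (- A)"
    "skew A \<Longrightarrow> skew (scale_banded c A)"
  by (simp_all add: skew_def)

text \<open>The reflection is an anti-automorphism and the two signs cancel. So skew matrices are
  closed under commutators, though not under products.\<close>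

lemma entry_times_skew:
  fixes A B :: "'a::comm_ring banded"
  assumes A: "skew A" and B: "skew B"
  shows "entry (A * B) (- q) (- p) = entry (B * A) p q"
proof -
  have "entry (A * B) (- q) (- p)
      = (\<Sum>r\<in>uminus ` {r. entry B p r \<noteq> 0}. entry A (- q) r * entry B r (- p))"
  proof (rule entry_times)
    fix r assume "entry B r (- p) \<noteq> 0"
    moreover have "entry B (- (- r)) (- p) = - entry B p (- r)"
      using B unfolding skew_def by blast
    ultimately show "r \<in> uminus ` {r. entry B p r \<noteq> 0}"
      by (intro image_eqI[of _ _ "- r"]) auto
  qed (simp add: finite_row)
  also have "\<dots> = (\<Sum>r | entry B p r \<noteq> 0. entry B p r * entry A r q)"
    using A B unfolding skew_def by (subst sum.reindex) (auto simp: mult.commute)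
  finally show ?thesis by (simp add: times_banded.rep_eq)
qed

lemma skew_commutator:
  "skew A \<Longrightarrow> skew B \<Longrightarrow> skew (A * B - B * A)" for A B :: "'a::comm_ring banded"
  by (simp add: entry_times_skew skew_def[of "A * B - B * A"])

section \<open>Block decomposition and the trace over one period\<close>

definition block :: "nat \<Rightarrow> int set" where
  "block l = {- int l..int l}"

lemma finite_block [simp]: "finite (block l)"
  by (simp add: block_def)

definition period_trace :: "nat \<Rightarrow> 'a::comm_monoid_add banded \<Rightarrow> 'a" where
  "period_trace l A = (\<Sum>p\<in>block l. entry A p p)"

lemma period_trace_linear:
  "period_trace l (A + B) = period_trace l A + period_trace l B"
  "period_trace l (A - B) = period_trace l A - period_trace l B"
  "period_trace l (scale_banded c A) = c * period_trace l A"
  for A B :: "'a::ring banded"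
  by (simp_all add: period_trace_def sum.distrib sum_subtractf sum_distrib_left)

text \<open>Residues are taken from -l to l rather than from 0 to 2 l, so that they commute with
  negation (\<open>centred_minus\<close>) and hence with the reflection.\<close>

definition centred_mod :: "nat \<Rightarrow> int \<Rightarrow> int" where
  "centred_mod l p = (p + int l) mod (2 * int l + 1) - int l"

definition centred_div :: "nat \<Rightarrow> int \<Rightarrow> int" where
  "centred_div l p = (p + int l) div (2 * int l + 1)"

lemma centred_mod_div: "centred_mod l p + centred_div l p * (2 * int l + 1) = p"
  unfolding centred_mod_def centred_div_def
  by (smt (verit) div_mult_mod_eq mult.commute)

lemma centred_mod_in_block [simp]: "centred_mod l p \<in> block l"
  unfolding centred_mod_def block_def
  using pos_mod_bound[of "2 * int l + 1" "p + int l"] pos_mod_sign[of "2 * int l + 1" "p + int l"]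
  by auto

lemma centred_unique:
  assumes "a \<in> block l"
  shows "centred_mod l (a + k * (2 * int l + 1)) = a" "centred_div l (a + k * (2 * int l + 1)) = k"
proof -
  have "0 \<le> a + int l" "a + int l < 2 * int l + 1" using assms by (auto simp: block_def)
  then have "(a + int l) mod (2 * int l + 1) = a + int l" "(a + int l) div (2 * int l + 1) = 0"
    by simp_all
  moreover have e: "a + k * (2 * int l + 1) + int l = (a + int l) + k * (2 * int l + 1)" by simp
  ultimately show "centred_mod l (a + k * (2 * int l + 1)) = a"
    "centred_div l (a + k * (2 * int l + 1)) = k"
    unfolding centred_mod_def centred_div_def e
    by simp_all
qed

text \<open>Each summation index is \<open>b - m * N\<close> for exactly one \<open>b\<close> in the
  block, and periodicity moves the shift into the row index of \<open>A\<close>. The product thus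
  becomes a convolution of blocks over finitely many degrees.\<close>

lemma entry_times_blocks:
  fixes A B :: "'a::ring banded"
  assumes N_def: "N = 2 * int l + 1" and A: "periodic N A" and M: "finite M"
    and supp: "\<And>m b. b \<in> block l \<Longrightarrow> entry A (p + m * N) b \<noteq> 0 \<Longrightarrow> entry B (b - m * N) q \<noteq> 0 \<Longrightarrow> m \<in> M"
  shows "entry (A * B) p q = (\<Sum>m\<in>M. \<Sum>b\<in>block l. entry A (p + m * N) b * entry B (b - m * N) q)"
proof -
  let ?f = "\<lambda>(m, b). b - m * N"
  have inj: "inj_on ?f (M \<times> block l)"
  proof (intro inj_onI; clarify)
    fix m b m' b' assume "b \<in> block l" "b' \<in> block l" "b - m * N = b' - m' * N"
    then show "m = m' \<and> b = b'"
      using centred_unique[of b l "- m"] centred_unique[of b' l "- m'"] unfolding N_def by simp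
  qed
  have shift: "entry A (p + m * N) b = entry A p (b - m * N)" for m b
    using periodic_shift[OF A, of p m "b - m * N"] by simp
  have "entry (A * B) p q = (\<Sum>r\<in>?f ` (M \<times> block l). entry A p r * entry B r q)"
  proof (rule entry_times)
    fix r assume r: "entry A p r \<noteq> 0" "entry B r q \<noteq> 0"
    let ?m = "- centred_div l r" and ?b = "centred_mod l r"
    have e: "?b - ?m * N = r" using centred_mod_div[of l r] unfolding N_def by simp
    have "?m \<in> M"
      using r shift[of ?m ?b] by (intro supp[of ?b]) (simp_all only: e centred_mod_in_block not_False_eq_True)
    then show "r \<in> ?f ` (M \<times> block l)"
      using e by (intro image_eqI[of _ _ "(?m, ?b)"]) auto
  qed (simp add: M)
  also have "\<dots> = (\<Sum>(m, b)\<in>M \<times> block l. entry A (p + m * N) b * entry B (b - m * N) q)"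
    by (subst sum.reindex[OF inj]) (auto simp: shift intro: sum.cong)
  finally show ?thesis by (simp add: sum.cartesian_product)
qed

lemma finite_block_shifts:
  fixes A :: "'a::zero banded"
  shows "finite {m. \<exists>a\<in>block l. \<exists>b\<in>block l. entry A (a + m * (2 * int l + 1)) b \<noteq> 0}"
proof -
  obtain w where w: "\<And>p q. entry A p q \<noteq> 0 \<Longrightarrow> \<bar>p - q\<bar> \<le> w" using entry_bandE by blast
  have "\<bar>m\<bar> \<le> w + 2 * int l"
    if "a \<in> block l" "b \<in> block l" "entry A (a + m * (2 * int l + 1)) b \<noteq> 0" for m a b
  proof -
    have "\<bar>a + m * (2 * int l + 1) - b\<bar> \<le> w" using w that by blast
    moreover have "\<bar>a - b\<bar> \<le> 2 * int l" using that by (auto simp: block_def)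
    moreover have "\<bar>m * (2 * int l + 1)\<bar> \<ge> \<bar>m\<bar>"
      using mult_left_mono[of 1 "2 * int l + 1" "\<bar>m\<bar>"] by (simp only: abs_mult) simp
    ultimately show ?thesis by linarith
  qed
  then have "{m. \<exists>a\<in>block l. \<exists>b\<in>block l. entry A (a + m * (2 * int l + 1)) b \<noteq> 0}
      \<subseteq> {- (w + 2 * int l)..w + 2 * int l}" by fastforce
  then show ?thesis by (rule finite_subset) simp
qed

text \<open>Not the usual cyclicity, because the inner index leaves the block. In block form an
  exchange of the factors replaces the degree \<open>m\<close> by \<open>- m\<close>, and the
  support of \<open>A\<close> serves both orders.\<close>

lemma period_trace_commute:
  fixes A B :: "'a::comm_ring banded"
  assumes A: "periodic (2 * int l + 1) A" and B: "periodic (2 * int l + 1) B"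
  shows "period_trace l (A * B) = period_trace l (B * A)"
proof -
  let ?N = "2 * int l + 1"
  let ?M = "{m. \<exists>a\<in>block l. \<exists>b\<in>block l. entry A (a + m * ?N) b \<noteq> 0}"
  have f: "finite ?M" by (rule finite_block_shifts)
  have "period_trace l (A * B)
      = (\<Sum>a\<in>block l. \<Sum>m\<in>?M. \<Sum>b\<in>block l. entry A (a + m * ?N) b * entry B (b - m * ?N) a)"
    unfolding period_trace_def by (intro sum.cong HOL.refl entry_times_blocks[OF HOL.refl A f]) auto
  also have "\<dots> = (\<Sum>b\<in>block l. \<Sum>m\<in>?M. \<Sum>a\<in>block l. entry B (b - m * ?N) a * entry A (a + m * ?N) b)"
    by (subst sum.swap, subst (2) sum.swap, subst sum.swap) (simp add: mult.commute)
  also have "\<dots> = (\<Sum>b\<in>block l. \<Sum>m\<in>uminus ` ?M. \<Sum>a\<in>block l. entry B (b + m * ?N) a * entry A (a - m * ?N) b)"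
    by (subst sum.reindex) simp_all
  also have "\<dots> = period_trace l (B * A)"
    unfolding period_trace_def
  proof (intro sum.cong HOL.refl entry_times_blocks[OF HOL.refl B, symmetric])
    fix b m a assume "b \<in> block l" "a \<in> block l" "entry A (a - m * ?N) b \<noteq> 0"
    then show "m \<in> uminus ` ?M"
      by (intro image_eqI[of _ _ "- m"]) auto
  qed (use f in simp)
  finally show ?thesis .
qed

section \<open>Invariant forms on \<open>so(n)\<close>\<close>

text \<open>Defined for all index pairs, not only for ordered ones, so that the bracket formula has
  no case distinction. Sums over all pairs then count every basis element twice.\<close>

definition skew_unit :: "nat \<Rightarrow> nat \<Rightarrow> nat \<Rightarrow> complex mat" where
  "skew_unit n a b = mat n n (\<lambda>(i, j). of_bool (i = a) * of_bool (j = b) - of_bool (i = b) * of_bool (j = a))"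

lemma skew_unit_index:
  "i < n \<Longrightarrow> j < n \<Longrightarrow> skew_unit n a b $$ (i, j)
    = of_bool (i = a) * of_bool (j = b) - of_bool (i = b) * of_bool (j = a)"
  by (simp add: skew_unit_def)

lemma skew_unit_carrier [simp]: "skew_unit n a b \<in> carrier_mat n n"
  by (simp add: skew_unit_def)

lemma skew_unit_dim [simp]: "dim_row (skew_unit n a b) = n" "dim_col (skew_unit n a b) = n"
  by (simp_all add: skew_unit_def)

lemma skew_unit_so: "skew_unit n a b \<in> carrier (so_lie n)"
  unfolding so_lie_simps by (auto intro!: eq_matI simp: skew_unit_index)

lemma mat_times_index:
  assumes "A \<in> carrier_mat n n" "B \<in> carrier_mat n n" "i < n" "j < n"
  shows "(A * B) $$ (i, j) = (\<Sum>k<n. A $$ (i, k) * B $$ (k, j))"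
  using assms by (auto simp: scalar_prod_def atLeast0LessThan intro!: sum.cong)

lemma skew_unit_bracket:
  assumes "a < n" "b < n" "c < n" "d < n"
  shows "lie_bracket (so_lie n) (skew_unit n a b) (skew_unit n c d)
    = of_bool (b = c) \<cdot>\<^sub>m skew_unit n a d + of_bool (a = d) \<cdot>\<^sub>m skew_unit n b c
      - of_bool (a = c) \<cdot>\<^sub>m skew_unit n b d - of_bool (b = d) \<cdot>\<^sub>m skew_unit n a c"
proof (rule eq_matI)
  fix i j
  assume "i < dim_row (of_bool (b = c) \<cdot>\<^sub>m skew_unit n a d + of_bool (a = d) \<cdot>\<^sub>m skew_unit n b c
      - of_bool (a = c) \<cdot>\<^sub>m skew_unit n b d - of_bool (b = d) \<cdot>\<^sub>m skew_unit n a c)"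
    "j < dim_col (of_bool (b = c) \<cdot>\<^sub>m skew_unit n a d + of_bool (a = d) \<cdot>\<^sub>m skew_unit n b c
      - of_bool (a = c) \<cdot>\<^sub>m skew_unit n b d - of_bool (b = d) \<cdot>\<^sub>m skew_unit n a c)"
  then have ij: "i < n" "j < n" by simp_all
  have s: "(\<Sum>k<n. of_bool (k = u) * of_bool (k = v) :: complex) = of_bool (u = v)" if "u < n" for u v
  proof -
    have "(\<Sum>k<n. of_bool (k = u) * of_bool (k = v) :: complex)
        = (\<Sum>k<n. if u = k then of_bool (k = v) else 0)" by (intro sum.cong) auto
    also have "\<dots> = of_bool (u = v)" using that by (subst sum.delta') auto
    finally show ?thesis .
  qed
  have prod: "(skew_unit n u v * skew_unit n x y) $$ (i, j)
      = of_bool (i = u) * of_bool (j = y) * of_bool (v = x) - of_bool (i = u) * of_bool (j = x) * of_bool (v = y)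
        - of_bool (i = v) * of_bool (j = y) * of_bool (u = x) + of_bool (i = v) * of_bool (j = x) * of_bool (u = y)"
    if "u < n" "v < n" "x < n" "y < n" for u v x y
  proof -
    have "(skew_unit n u v * skew_unit n x y) $$ (i, j)
      = (\<Sum>k<n. (of_bool (i = u) * of_bool (k = v) - of_bool (i = v) * of_bool (k = u))
          * (of_bool (k = x) * of_bool (j = y) - of_bool (k = y) * of_bool (j = x)))"
      using ij by (subst mat_times_index[of _ n]) (auto simp: skew_unit_index simp del: of_bool_eq_0_iff mult_cancel_left intro!: sum.cong)
    also have "\<dots> = (\<Sum>k<n. of_bool (i = u) * of_bool (j = y) * (of_bool (k = v) * of_bool (k = x))
        - of_bool (i = u) * of_bool (j = x) * (of_bool (k = v) * of_bool (k = y))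
        - of_bool (i = v) * of_bool (j = y) * (of_bool (k = u) * of_bool (k = x))
        + of_bool (i = v) * of_bool (j = x) * (of_bool (k = u) * of_bool (k = y)))"
      by (intro sum.cong HOL.refl) (simp only: algebra_simps)
    also have "\<dots> = of_bool (i = u) * of_bool (j = y) * of_bool (v = x) - of_bool (i = u) * of_bool (j = x) * of_bool (v = y)
        - of_bool (i = v) * of_bool (j = y) * of_bool (u = x) + of_bool (i = v) * of_bool (j = x) * of_bool (u = y)"
      by (simp only: sum.distrib sum_subtractf sum_distrib_left[symmetric] s[OF that(1)] s[OF that(2)])
    finally show ?thesis .
  qed
  have e: "(d = a) = (a = d)" "(d = b) = (b = d)" "(c = a) = (a = c)" "(c = b) = (b = c)" by auto
  show "lie_bracket (so_lie n) (skew_unit n a b) (skew_unit n c d) $$ (i, j)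
    = (of_bool (b = c) \<cdot>\<^sub>m skew_unit n a d + of_bool (a = d) \<cdot>\<^sub>m skew_unit n b c
      - of_bool (a = c) \<cdot>\<^sub>m skew_unit n b d - of_bool (b = d) \<cdot>\<^sub>m skew_unit n a c) $$ (i, j)"
    using ij assms unfolding so_lie_simps
    by (simp add: prod skew_unit_index e del: index_mult_mat(1) of_bool_eq_0_iff)
qed (simp_all add: so_lie_simps)

text \<open>The half compensates for the equal contributions of \<open>(a, b)\<close> and
  \<open>(b, a)\<close>.\<close>

lemma so_linear_functional:
  assumes add: "\<And>A C. A \<in> carrier (so_lie n) \<Longrightarrow> C \<in> carrier (so_lie n) \<Longrightarrow> \<phi> (A + C) = \<phi> A + \<phi> C"
    and smult: "\<And>c A. A \<in> carrier (so_lie n) \<Longrightarrow> \<phi> (c \<cdot>\<^sub>m A) = c * \<phi> A"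
    and A: "A \<in> carrier (so_lie n)"
  shows "\<phi> A = (\<Sum>a<n. \<Sum>b<n. A $$ (a, b) / 2 * \<phi> (skew_unit n a b))"
proof -
  \<comment> \<open>Linear combinations as entrywise sums: linearity of \<phi> extends to them by
    induction on the index set.\<close>
  define comb where "comb c P = mat n n (\<lambda>(i, j). \<Sum>(a, b)\<in>P. c a b * skew_unit n a b $$ (i, j))"
    for c :: "nat \<Rightarrow> nat \<Rightarrow> complex" and P
  have so: "comb c P \<in> carrier (so_lie n)" for c P
    unfolding so_lie_simps comb_def
    by (auto intro!: eq_matI sum.cong simp: skew_unit_index sum_negf[symmetric] algebra_simps)
  interpret complex_lie_algebra "so_lie n" by (rule complex_lie_algebra_so_lie)
  have \<phi>_comb: "\<phi> (comb c P) = (\<Sum>(a, b)\<in>P. c a b * \<phi> (skew_unit n a b))" if "finite P" for c P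
    using that
  proof induction
    case empty
    have "comb c {} = 0 \<cdot>\<^sub>m comb c {}" by (auto simp: comb_def intro!: eq_matI)
    then show ?case using smult[OF so, of 0 c "{}"] by simp
  next
    case (insert p P)
    obtain a b where p: "p = (a, b)" by force
    have "comb c (insert p P) = c a b \<cdot>\<^sub>m skew_unit n a b + comb c P"
      using insert(1,2) by (auto simp: comb_def p intro!: eq_matI)
    moreover have "c a b \<cdot>\<^sub>m skew_unit n a b \<in> carrier (so_lie n)"
      using smult_closed[of "c a b" "skew_unit n a b"]
      by (simp add: so_lie_simps(4) skew_unit_so complex_field_simps)
    ultimately show ?case
      using insert by (simp add: add so smult skew_unit_so p)
  qed
  have "A = comb (\<lambda>a b. A $$ (a, b) / 2) ({..<n} \<times> {..<n})"
  proof (rule eq_matI)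
    fix i j
    assume "i < dim_row (comb (\<lambda>a b. A $$ (a, b) / 2) ({..<n} \<times> {..<n}))"
      "j < dim_col (comb (\<lambda>a b. A $$ (a, b) / 2) ({..<n} \<times> {..<n}))"
    then have ij: "i < n" "j < n" by (simp_all add: comb_def)
    have "A $$ (j, i) = transpose_mat A $$ (i, j)"
      using A ij unfolding so_lie_simps by (subst index_transpose_mat(1)) auto
    also have "\<dots> = - A $$ (i, j)" using A ij unfolding so_lie_simps by auto
    finally have sk: "A $$ (j, i) = - A $$ (i, j)" .
    have s: "(\<Sum>a<n. \<Sum>b<n. f a b * (of_bool (u = a) * of_bool (v = b))) = f u v"
      if "u < n" "v < n" for u v and f :: "nat \<Rightarrow> nat \<Rightarrow> complex"
    proof -
      have "(\<Sum>b<n. f a b * (of_bool (u = a) * of_bool (v = b))) = (if u = a then f a v else 0)" for a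
      proof -
        have "(\<Sum>b<n. f a b * (of_bool (u = a) * of_bool (v = b)))
            = (\<Sum>b<n. if v = b then f a b * of_bool (u = a) else 0)" by (intro sum.cong) auto
        then show ?thesis using that by simp
      qed
      then show ?thesis using that by simp
    qed
    have "comb (\<lambda>a b. A $$ (a, b) / 2) ({..<n} \<times> {..<n}) $$ (i, j)
      = (\<Sum>a<n. \<Sum>b<n. A $$ (a, b) / 2 * (of_bool (i = a) * of_bool (j = b)))
        - (\<Sum>a<n. \<Sum>b<n. A $$ (a, b) / 2 * (of_bool (j = a) * of_bool (i = b)))"
      using ij unfolding comb_def sum_subtractf[symmetric] sum.cartesian_product
      by (auto simp: skew_unit_index intro!: sum.cong)
    also have "\<dots> = A $$ (i, j)" using ij by (simp only: s sk) simp
    finally show "A $$ (i, j) = comb (\<lambda>a b. A $$ (a, b) / 2) ({..<n} \<times> {..<n}) $$ (i, j)" by simp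
  qed (use A in \<open>auto simp: comb_def so_lie_simps\<close>)
  then have "\<phi> A = \<phi> (comb (\<lambda>a b. A $$ (a, b) / 2) ({..<n} \<times> {..<n}))" by simp
  also have "\<dots> = (\<Sum>a<n. \<Sum>b<n. A $$ (a, b) / 2 * \<phi> (skew_unit n a b))"
    by (subst \<phi>_comb) (simp_all add: sum.cartesian_product)
  finally show ?thesis .
qed

text \<open>For \<open>n = 4\<close> the Pfaffian pairing is a second invariant form.\<close>

proposition so_invariant_form_unique:
  assumes form: "nondegenerate_invariant_form (so_lie n) B" and n: "n \<ge> 3" "n \<noteq> 4"
  obtains \<kappa> where "\<kappa> \<noteq> 0"
    "\<And>A C. A \<in> carrier (so_lie n) \<Longrightarrow> C \<in> carrier (so_lie n) \<Longrightarrow>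
      B A C = \<kappa> * (\<Sum>i<n. \<Sum>j<n. A $$ (i, j) * C $$ (i, j))"
proof -
  let ?M = "skew_unit n"
  let ?G = "carrier (so_lie n)"
  interpret L: complex_lie_algebra "so_lie n" by (rule complex_lie_algebra_so_lie)
  have B_add: "B (A + C) E = B A E + B C E" if "A \<in> ?G" "C \<in> ?G" "E \<in> ?G" for A C E
    using form that unfolding nondegenerate_invariant_form_def so_lie_simps(3) by blast
  have B_smult: "B (c \<cdot>\<^sub>m A) E = c * B A E" if "A \<in> ?G" "E \<in> ?G" for c A E
    using form that unfolding nondegenerate_invariant_form_def so_lie_simps(4) by blast
  have B_sym: "B A E = B E A" if "A \<in> ?G" "E \<in> ?G" for A E
    using form that unfolding nondegenerate_invariant_form_def by blast
  have B_inv: "B (lie_bracket (so_lie n) A C) E = B A (lie_bracket (so_lie n) C E)"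
    if "A \<in> ?G" "C \<in> ?G" "E \<in> ?G" for A C E
    using form that unfolding nondegenerate_invariant_form_def by blast
  have nondeg: "A = 0\<^sub>m n n" if "A \<in> ?G" "\<And>E. E \<in> ?G \<Longrightarrow> B A E = 0" for A
    using form that unfolding nondegenerate_invariant_form_def so_lie_simps(2) by blast
  have M [simp]: "?M a b \<in> ?G" for a b by (rule skew_unit_so)
  have neg: "?M b a = (- 1) \<cdot>\<^sub>m ?M a b" for a b
    by (auto intro!: eq_matI simp: skew_unit_index)
  have M_same: "?M a a = 0 \<cdot>\<^sub>m ?M a a" for a
    by (auto intro!: eq_matI simp: skew_unit_index)
  have neg_left: "B (?M b a) E = - B (?M a b) E" if "E \<in> ?G" for a b E
    using B_smult[of "?M a b" E "- 1"] that by (simp add: neg[of b a])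
  have neg_right: "B E (?M b a) = - B E (?M a b)" if "E \<in> ?G" for a b E
    using neg_left[OF that, of b a] that by (simp add: B_sym[of E])
  have "0 \<cdot>\<^sub>m ?M 0 0 = 0\<^sub>m n n" by (auto intro!: eq_matI simp: skew_unit_index)
  then have B_zero: "B (0\<^sub>m n n) E = 0" if "E \<in> ?G" for E
    using B_smult[of "?M 0 0" E 0] that by simp
  have M_same_zero: "B (?M a a) E = 0" if "E \<in> ?G" for a E
    using B_smult[of "?M a a" E 0] that by (simp flip: M_same)
  have br: "lie_bracket (so_lie n) (?M a b) (?M b c) = ?M a c"
    if "a < n" "b < n" "c < n" "a \<noteq> b" "b \<noteq> c" "a \<noteq> c" for a b c
    unfolding skew_unit_bracket[OF that(1,2,2,3)] using that by (auto intro!: eq_matI)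
  have br0: "lie_bracket (so_lie n) (?M a b) (?M c d) = 0\<^sub>m n n"
    if "a < n" "b < n" "c < n" "d < n" "a \<noteq> c" "a \<noteq> d" "b \<noteq> c" "b \<noteq> d" for a b c d
    unfolding skew_unit_bracket[OF that(1-4)] using that by (auto intro!: eq_matI)
  \<comment> \<open>Units that share one index are orthogonal: the second is a bracket with the
    first as a factor, and invariance produces the bracket of the first with itself.\<close>
  have share: "B (?M a c) (?M c y) = 0"
    if "a < n" "c < n" "y < n" "a \<noteq> c" "y \<noteq> c" "a \<noteq> y" for a c y
  proof -
    have "B (?M c a) (?M c y) = B (?M c a) (lie_bracket (so_lie n) (?M c a) (?M a y))"
      using br[of c a y] that by simp
    also have "\<dots> = B (lie_bracket (so_lie n) (?M c a) (?M c a)) (?M a y)"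
      by (simp add: B_inv)
    also have "\<dots> = 0" using L.bracket_self[of "?M c a"] by (simp add: so_lie_simps(2) B_zero)
    finally show ?thesis by (simp add: neg_left[of "?M c y" a c])
  qed
  have disjoint: "B (?M a c) (?M x y) = 0"
    if d: "a < n" "c < n" "x < n" "y < n" "a \<noteq> c" "x \<noteq> y" "a \<noteq> x" "a \<noteq> y" "c \<noteq> x" "c \<noteq> y" for a c x y
  proof -
    \<comment> \<open>Four distinct indices force n \<ge> 4, so \<open>n \<noteq> 4\<close> leaves a
      fifth index \<open>z\<close>. Splitting the second unit at \<open>z\<close> brings a bracket
      of commuting units to the left.\<close>
    have "card {a, c, x, y} = 4" using d by simp
    moreover have "card {a, c, x, y} \<le> card {..<n}" using d by (intro card_mono) auto
    ultimately have "card {a, c, x, y} < card {..<n}" using n by simp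
    then have "\<not> {..<n} \<subseteq> {a, c, x, y}" by (meson card_mono finite.emptyI finite.insertI not_le)
    then obtain z where z: "z < n" "z \<notin> {a, c, x, y}" by blast
    then have "B (?M a c) (?M x y) = B (?M a c) (lie_bracket (so_lie n) (?M x z) (?M z y))"
      using z d by (subst br) auto
    also have "\<dots> = B (lie_bracket (so_lie n) (?M a c) (?M x z)) (?M z y)"
      by (simp add: B_inv)
    also have "\<dots> = 0" by (subst br0) (use d z B_zero in auto)
    finally show ?thesis .
  qed
  \<comment> \<open>Splitting \<open>?M a c\<close> at \<open>b\<close> and carrying the factor
    \<open>?M b c\<close> over by invariance exchanges the index \<open>c\<close> for
    \<open>b\<close>.\<close>
  have move: "B (?M a c) (?M a c) = B (?M a b) (?M a b)"
    if "a < n" "b < n" "c < n" "a \<noteq> b" "b \<noteq> c" "a \<noteq> c" for a b c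
  proof -
    have "B (?M a c) (?M a c) = B (lie_bracket (so_lie n) (?M a b) (?M b c)) (?M a c)"
      using br[OF that] by simp
    also have "\<dots> = - B (?M a b) (lie_bracket (so_lie n) (?M b c) (?M c a))"
    proof -
      have "lie_bracket (so_lie n) (?M b c) (?M c a) = (- 1) \<cdot>\<^sub>m lie_bracket (so_lie n) (?M b c) (?M a c)"
        using L.bracket_smult_right[of "?M b c" "?M a c" "- 1"] by (simp add: neg[of c a] so_lie_simps(4))
      moreover have "B (?M a b) ((- 1) \<cdot>\<^sub>m E) = - B (?M a b) E" if "E \<in> ?G" for E
        using B_smult[of E "?M a b" "- 1"] that L.smult_closed[of "- 1" E]
        by (simp add: B_sym[of "?M a b"] so_lie_simps(4) complex_field_simps)
      ultimately show ?thesis using L.bracket_closed by (simp add: B_inv)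
    qed
    also have "\<dots> = B (?M a b) (?M a b)"
      using br[of b c a] that by (simp add: neg_right[of "?M a b" b a])
    finally show ?thesis .
  qed
  have flip: "B (?M a c) (?M a c) = B (?M c a) (?M c a)" for a c
    by (simp add: neg_left[of _ c a] neg_right[of _ c a])
  define \<kappa> where "\<kappa> = B (?M 0 1) (?M 0 1)"
  have first: "B (?M 0 c) (?M 0 c) = \<kappa>" if "c < n" "c \<noteq> 0" for c
    using move[of 0 1 c] that n unfolding \<kappa>_def by (cases "c = 1") simp_all
  \<comment> \<open>Every pair is reached from \<open>(0, 1)\<close> by exchanging one index at a
    time and flipping.\<close>
  have diag: "B (?M a c) (?M a c) = \<kappa>" if "a < n" "c < n" "a \<noteq> c" for a c
  proof -
    consider "a = 0" | "c = 0" | "a \<noteq> 0" "c \<noteq> 0" by blast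
    then show ?thesis
    proof cases
      case 3
      then show ?thesis using move[of a 0 c] first[of a] flip[of a 0] that by simp
    qed (use first flip[of a c] that in auto)
  qed
  have gram: "B (?M a c) (?M x y)
      = \<kappa> * (of_bool (a = x) * of_bool (c = y) - of_bool (a = y) * of_bool (c = x))"
    if d: "a < n" "c < n" "x < n" "y < n" for a c x y
  proof (cases "a = c \<or> x = y")
    case True
    then show ?thesis using M_same_zero B_sym[of "?M a c" "?M x x"] by auto
  next
    case False
    consider "a = x" "c = y" | "a = y" "c = x" | "a = x" "c \<noteq> y" | "a = y" "c \<noteq> x"
      | "c = x" "a \<noteq> y" | "c = y" "a \<noteq> x" | "a \<noteq> x" "a \<noteq> y" "c \<noteq> x" "c \<noteq> y" by blast
    then show ?thesis
    proof cases
      case 1 then show ?thesis using diag d False by auto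
    next
      case 2 then show ?thesis using diag[of a c] d False by (auto simp: neg_right[of _ x y])
    next
      case 3 then show ?thesis using share[of c a y] d False by (auto simp: neg_left[of _ x c])
    next
      case 4 then show ?thesis using share[of c a x] d False
        by (auto simp: neg_left[of _ y c] neg_right[of _ x y])
    next
      case 5 then show ?thesis using share[of a c y] d False by auto
    next
      case 6 then show ?thesis using share[of a c x] d False by (auto simp: neg_right[of _ x y])
    next
      case 7 then show ?thesis using disjoint d False by auto
    qed
  qed
  have sk: "C $$ (c, a) = - C $$ (a, c)" if "C \<in> ?G" "a < n" "c < n" for C a c
  proof -
    have "C $$ (c, a) = transpose_mat C $$ (a, c)"
      using that unfolding so_lie_simps by (subst index_transpose_mat(1)) auto
    also have "\<dots> = - C $$ (a, c)" using that unfolding so_lie_simps by auto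
    finally show ?thesis .
  qed
  have BM: "B (?M a c) C = \<kappa> * C $$ (a, c)" if C: "C \<in> ?G" and ac: "a < n" "c < n" for a c C
  proof -
    have "B (?M a c) C = B C (?M a c)" using C by (simp add: B_sym)
    also have "\<dots> = (\<Sum>x<n. \<Sum>y<n. C $$ (x, y) / 2 * B (?M x y) (?M a c))"
      by (rule so_linear_functional) (use B_add B_smult C in auto)
    also have "\<dots> = (\<Sum>x<n. if x = a then \<kappa> * C $$ (x, c) / 2 else 0)
        - (\<Sum>x<n. if x = c then \<kappa> * C $$ (x, a) / 2 else 0)"
    proof -
      have "(\<Sum>y<n. C $$ (x, y) / 2 * B (?M x y) (?M a c))
        = (\<Sum>y<n. if y = c then (if x = a then \<kappa> * C $$ (x, y) / 2 else 0) else 0)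
          - (\<Sum>y<n. if y = a then (if x = c then \<kappa> * C $$ (x, y) / 2 else 0) else 0)"
        if "x < n" for x
        unfolding sum_subtractf[symmetric] using that ac by (intro sum.cong) (auto simp: gram)
      then show ?thesis using ac by (simp add: sum_subtractf cong: if_cong)
    qed
    also have "\<dots> = \<kappa> * C $$ (a, c)" using ac by (simp add: sk[OF C, of a c])
    finally show ?thesis .
  qed
  \<comment> \<open>The entrywise pairing of a unit with itself is 2, hence the half.\<close>
  have formula: "B A C = \<kappa> / 2 * (\<Sum>i<n. \<Sum>j<n. A $$ (i, j) * C $$ (i, j))"
    if A: "A \<in> ?G" and C: "C \<in> ?G" for A C
  proof -
    have "B A C = (\<Sum>a<n. \<Sum>c<n. A $$ (a, c) / 2 * B (?M a c) C)"
      by (rule so_linear_functional[where \<phi> = "\<lambda>A. B A C"]) (use B_add B_smult A C in auto)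
    also have "\<dots> = (\<Sum>a<n. \<Sum>c<n. \<kappa> / 2 * (A $$ (a, c) * C $$ (a, c)))"
      by (intro sum.cong HOL.refl) (simp add: BM[OF C])
    finally show ?thesis by (simp add: sum_distrib_left)
  qed
  have "\<kappa> \<noteq> 0"
  proof
    assume "\<kappa> = 0"
    then have "?M 0 1 = 0\<^sub>m n n" using formula by (intro nondeg) auto
    then have "?M 0 1 $$ (0, 1) = 0" using n by simp
    then show False using n by (simp add: skew_unit_index)
  qed
  with formula that[of "\<kappa> / 2"] show ?thesis by simp
qed

section \<open>The Lie algebra of skew periodic matrices\<close>

lemma period_trace_grade_derivation [simp]: "period_trace l (grade_derivation A) = 0"
  by (simp add: period_trace_def)

text \<open>The standard cocycle of a derivation and a trace. The affine cocycle has the same form,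
  with the loop degree in place of \<open>p - q\<close>.\<close>

definition grade_cocycle :: "nat \<Rightarrow> 'a::ring_1 banded \<Rightarrow> 'a banded \<Rightarrow> 'a" where
  "grade_cocycle l A B = period_trace l (grade_derivation A * B)"

text \<open>The trace kills derivatives, and by cyclicity both Leibniz terms of \<open>A * A\<close>
  have the same trace; so twice the value is zero.\<close>

lemma grade_cocycle_self:
  fixes A :: "complex banded"
  assumes "periodic (2 * int l + 1) A"
  shows "grade_cocycle l A A = 0"
proof -
  have "period_trace l (grade_derivation A * A) = period_trace l (A * grade_derivation A)"
    by (rule period_trace_commute) (simp_all add: assms periodic_grade_derivation)
  moreover have "period_trace l (grade_derivation A * A) + period_trace l (A * grade_derivation A) = 0"
    unfolding period_trace_linear(1)[symmetric] grade_derivation_times[symmetric] by simp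
  ultimately show ?thesis unfolding grade_cocycle_def by simp
qed

text \<open>The cyclic sum is a difference of two cyclic sums, one for the order A, B, C and one for
  A, C, B. After cyclic rotation each is the trace of the derivative of a triple product, hence
  zero.\<close>

lemma grade_cocycle_jacobi:
  fixes A B C :: "'a::comm_ring_1 banded"
  assumes A: "periodic (2 * int l + 1) A" and B: "periodic (2 * int l + 1) B"
    and C: "periodic (2 * int l + 1) C"
  shows "grade_cocycle l A (B * C - C * B) + grade_cocycle l B (C * A - A * C)
    + grade_cocycle l C (A * B - B * A) = 0"
proof -
  let ?t = "period_trace l" and ?d = grade_derivation
  have leibniz: "?t (?d P * (Q * R)) + ?t (?d Q * (R * P)) + ?t (?d R * (P * Q)) = 0"
    if "periodic (2 * int l + 1) P" "periodic (2 * int l + 1) Q" "periodic (2 * int l + 1) R"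
    for P Q R :: "'a banded"
  proof -
    have "?t (?d Q * (R * P)) = ?t (P * ?d Q * R)"
      using period_trace_commute[of l "?d Q * R" P] that
      by (simp add: mult.assoc periodic_times periodic_grade_derivation)
    moreover have "?t (?d R * (P * Q)) = ?t (P * Q * ?d R)"
      using that by (intro period_trace_commute periodic_times periodic_grade_derivation)
    moreover have "?t (?d P * (Q * R)) + ?t (P * ?d Q * R) + ?t (P * Q * ?d R) = ?t (?d (P * Q * R))"
      by (simp add: grade_derivation_times period_trace_linear distrib_right distrib_left mult.assoc)
    ultimately show ?thesis by simp
  qed
  have "grade_cocycle l A (B * C - C * B) + grade_cocycle l B (C * A - A * C)
      + grade_cocycle l C (A * B - B * A)
    = (?t (?d A * (B * C)) + ?t (?d B * (C * A)) + ?t (?d C * (A * B)))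
      - (?t (?d A * (C * B)) + ?t (?d C * (B * A)) + ?t (?d B * (A * C)))"
    by (simp add: grade_cocycle_def right_diff_distrib period_trace_linear)
  then show ?thesis by (simp add: leibniz A B C)
qed

definition skew_loop_lie :: "nat \<Rightarrow> (complex banded \<times> complex) lie_structure" where
  "skew_loop_lie l = \<lparr>
     carrier = {A. periodic (2 * int l + 1) A \<and> skew A} \<times> UNIV,
     monoid.mult = undefined, one = undefined,
     ring.zero = (0, 0),
     add = (\<lambda>(A, a) (B, b). (A + B, a + b)),
     module.smult = (\<lambda>c (A, a). (scale_banded c A, c * a)),
     lie_bracket = (\<lambda>(A, a) (B, b). (A * B - B * A, grade_cocycle l A B))\<rparr>"

lemma skew_loop_lie_simps:
  "(A, a) \<in> carrier (skew_loop_lie l) \<longleftrightarrow> periodic (2 * int l + 1) A \<and> skew A"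
  "\<zero>\<^bsub>skew_loop_lie l\<^esub> = (0, 0)"
  "(A, a) \<oplus>\<^bsub>skew_loop_lie l\<^esub> (B, b) = (A + B, a + b)"
  "c \<odot>\<^bsub>skew_loop_lie l\<^esub> (A, a) = (scale_banded c A, c * a)"
  "lie_bracket (skew_loop_lie l) (A, a) (B, b) = (A * B - B * A, grade_cocycle l A B)"
  by (simp_all add: skew_loop_lie_def)

lemma scale_banded_module:
  fixes A B :: "'a::comm_ring_1 banded"
  shows "scale_banded (a + b) A = scale_banded a A + scale_banded b A"
    "scale_banded a (A + B) = scale_banded a A + scale_banded a B"
    "scale_banded a (A - B) = scale_banded a A - scale_banded a B"
    "scale_banded (a * b) A = scale_banded a (scale_banded b A)"
    "scale_banded 1 A = A"
  by (auto intro!: banded_eqI simp: algebra_simps)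

lemma complex_lie_algebra_skew_loop_lie: "complex_lie_algebra (skew_loop_lie l)"
proof -
  let ?L = "skew_loop_lie l"
  have car: "x \<in> carrier ?L \<longleftrightarrow> (\<exists>A a. x = (A, a) \<and> periodic (2 * int l + 1) A \<and> skew A)" for x
    by (cases x) (simp add: skew_loop_lie_simps)
  note s = skew_loop_lie_simps(2-5)
  have inv: "\<exists>y\<in>carrier ?L. y \<oplus>\<^bsub>?L\<^esub> x = \<zero>\<^bsub>?L\<^esub>" if x: "x \<in> carrier ?L" for x
  proof -
    obtain A a where "x = (A, a)" "periodic (2 * int l + 1) A" "skew A" using x unfolding car by blast
    then show ?thesis
      by (intro bexI[of _ "(- A, - a)"]) (simp_all add: s skew_loop_lie_simps(1) periodic_linear skew_linear)
  qed
  have abel: "abelian_group ?L"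
    by (rule abelian_groupI; (erule inv)?)
      (auto simp: car s periodic_linear skew_linear add.assoc add.commute)
  have "module complex_field ?L"
    by (rule moduleI)
      (use abel in \<open>auto simp: car s periodic_linear skew_linear complex_field_simps
        cring_from_type_algebra scale_banded_module distrib_left distrib_right mult.assoc\<close>)
  moreover have "complex_lie_algebra_axioms ?L"
  proof (rule complex_lie_algebra_axioms.intro; unfold car; clarify)
    fix A B C :: "complex banded" and a b c k :: complex
    assume A: "periodic (2 * int l + 1) A" "skew A"
    show "lie_bracket ?L (A, a) (A, a) = \<zero>\<^bsub>?L\<^esub>"
      by (simp add: s grade_cocycle_self A)
    assume B: "periodic (2 * int l + 1) B" "skew B"
    show "\<exists>D d. lie_bracket ?L (A, a) (B, b) = (D, d) \<and> periodic (2 * int l + 1) D \<and> skew D"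
      by (simp add: s periodic_linear periodic_times skew_commutator A B)
    show "lie_bracket ?L (k \<odot>\<^bsub>?L\<^esub> (A, a)) (B, b) = k \<odot>\<^bsub>?L\<^esub> lie_bracket ?L (A, a) (B, b)"
      by (simp add: s scale_banded_times scale_banded_module grade_cocycle_def grade_derivation_linear
          period_trace_linear)
    show "lie_bracket ?L (A, a) (k \<odot>\<^bsub>?L\<^esub> (B, b)) = k \<odot>\<^bsub>?L\<^esub> lie_bracket ?L (A, a) (B, b)"
      by (simp add: s scale_banded_times scale_banded_module grade_cocycle_def grade_derivation_linear
          period_trace_linear)
    assume C: "periodic (2 * int l + 1) C" "skew C"
    show "lie_bracket ?L ((A, a) \<oplus>\<^bsub>?L\<^esub> (B, b)) (C, c)
        = lie_bracket ?L (A, a) (C, c) \<oplus>\<^bsub>?L\<^esub> lie_bracket ?L (B, b) (C, c)"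
      by (simp add: s grade_cocycle_def grade_derivation_linear period_trace_linear algebra_simps)
    show "lie_bracket ?L (A, a) ((B, b) \<oplus>\<^bsub>?L\<^esub> (C, c))
        = lie_bracket ?L (A, a) (B, b) \<oplus>\<^bsub>?L\<^esub> lie_bracket ?L (A, a) (C, c)"
      by (simp add: s grade_cocycle_def grade_derivation_linear period_trace_linear algebra_simps)
    show "lie_bracket ?L (A, a) (lie_bracket ?L (B, b) (C, c))
        \<oplus>\<^bsub>?L\<^esub> lie_bracket ?L (B, b) (lie_bracket ?L (C, c) (A, a))
        \<oplus>\<^bsub>?L\<^esub> lie_bracket ?L (C, c) (lie_bracket ?L (A, a) (B, b)) = \<zero>\<^bsub>?L\<^esub>"
      using grade_cocycle_jacobi[OF A(1) B(1) C(1)] by (simp add: s algebra_simps)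
  qed
  ultimately show ?thesis by (rule complex_lie_algebra.intro)
qed

section \<open>Quantum torus elements\<close>

text \<open>\<open>torus_elem z n\<close> represents the quantum torus element written \<open>E\<^sup>\<alpha>(n)\<close> with \<open>z = \<chi>(\<alpha>)\<close>.\<close>

lift_definition torus_elem :: "complex \<Rightarrow> int \<Rightarrow> complex banded"
  is "\<lambda>z n p q. of_bool (p - q = n) * z powi (p + q)"
  by (intro exI) auto

lemmas entry_torus_elem = torus_elem.rep_eq

text \<open>Only the inner index \<open>p - n\<close> contributes. The symmetric exponent
  \<open>p + q\<close> is what makes the twist equal to \<chi>(m \<alpha> - n \<beta>), the
  character value in the relations.\<close>

lemma torus_elem_times:
  assumes "z \<noteq> 0" "w \<noteq> 0"
  shows "torus_elem z n * torus_elem w m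
    = scale_banded (z powi m * w powi (- n)) (torus_elem (z * w) (n + m))"
proof (rule banded_eqI)
  fix p q
  have "entry (torus_elem z n * torus_elem w m) p q
      = (\<Sum>r\<in>{p - n}. entry (torus_elem z n) p r * entry (torus_elem w m) r q)"
    by (rule entry_times) (auto simp: entry_torus_elem)
  also have "\<dots> = z powi (2 * p - n) * (of_bool (p - n - q = m) * w powi (p - n + q))"
    by (simp add: entry_torus_elem)
  also have "\<dots> = z powi m * w powi (- n) * (of_bool (p - q = n + m) * (z * w) powi (p + q))"
  proof (cases "p - q = n + m")
    case True
    have "z powi (2 * p - n) = z powi m * z powi (p + q)"
      unfolding power_int_add[symmetric, OF disjI1[OF assms(1)]] using True
      by (intro arg_cong[of _ _ "(powi) z"]) simp
    moreover have "w powi (p - n + q) = w powi (- n) * w powi (p + q)"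
      unfolding power_int_add[symmetric, OF disjI1[OF assms(2)]] by (simp add: algebra_simps)
    ultimately show ?thesis using True by (simp add: power_int_mult_distrib)
  qed auto
  finally show "entry (torus_elem z n * torus_elem w m) p q
      = entry (scale_banded (z powi m * w powi (- n)) (torus_elem (z * w) (n + m))) p q"
    by (simp add: entry_torus_elem)
qed

lemma grade_derivation_torus_elem: "grade_derivation (torus_elem z n) = scale_banded (of_int n) (torus_elem z n)"
  by (rule banded_eqI) (auto simp: entry_torus_elem)

lemma root_of_unity_powi_mod:
  fixes z :: complex
  assumes "z ^ N = 1" "int N dvd k - j" "N > 0"
  shows "z powi k = z powi j"
proof -
  obtain m where m: "k - j = int N * m" using assms by blast
  have "z \<noteq> 0" using assms by (metis power_0_left zero_neq_one not_gr_zero)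
  have "z powi k = z powi j * z powi (k - j)"
    using power_int_add[of z j "k - j"] \<open>z \<noteq> 0\<close> by simp
  also have "z powi (k - j) = 1" using assms(1) by (simp add: m power_int_mult)
  finally show ?thesis by simp
qed

text \<open>Squaring loses nothing on roots of unity of odd order. This is what makes the exponents
  \<open>2 * p\<close> on a diagonal as good as \<open>p\<close>.\<close>

lemma square_root_of_unity_odd:
  fixes z :: complex
  assumes "z ^ (2 * l + 1) = 1" "z\<^sup>2 = 1"
  shows "z = 1"
  using assms by (simp add: power_mult)

text \<open>Multiplication by \<open>z\<close> shifts the block by one, and the index
  \<open>l + 1\<close> that enters agrees modulo the period with the index \<open>- l\<close> that
  leaves. So \<open>z\<close> fixes the sum, which must vanish unless \<open>z = 1\<close>.\<close>

lemma sum_block_powi: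
  fixes z :: complex
  assumes z: "z ^ (2 * l + 1) = 1"
  shows "(\<Sum>p\<in>block l. z powi p) = (if z = 1 then of_nat (2 * l + 1) else 0)"
proof (cases "z = 1")
  case True
  then show ?thesis by (simp add: block_def)
next
  case False
  have "z \<noteq> 0" using z by auto
  have "z * (\<Sum>p\<in>block l. z powi p) = (\<Sum>p\<in>block l. z powi (p + 1))"
    using \<open>z \<noteq> 0\<close> by (simp add: sum_distrib_left power_int_add_1')
  also have "\<dots> = (\<Sum>p\<in>{- int l + 1..int l + 1}. z powi p)"
    unfolding block_def
    by (rule sum.reindex_bij_witness[of _ "\<lambda>p. p - 1" "\<lambda>p. p + 1"]) auto
  also have "{- int l + 1..int l + 1} = insert (int l + 1) {- int l + 1..int l}" by auto
  also have "(\<Sum>p\<in>\<dots>. z powi p) = z powi (int l + 1) + (\<Sum>p\<in>{- int l + 1..int l}. z powi p)"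
    by (subst sum.insert) auto
  also have "z powi (int l + 1) = z powi (- int l)"
    by (rule root_of_unity_powi_mod[OF z]) (auto intro: dvdI[of _ _ 1])
  also have "z powi (- int l) + (\<Sum>p\<in>{- int l + 1..int l}. z powi p)
      = (\<Sum>p\<in>insert (- int l) {- int l + 1..int l}. z powi p)"
    by (subst sum.insert) auto
  also have "insert (- int l) {- int l + 1..int l} = block l" by (auto simp: block_def)
  finally show ?thesis using False by (simp add: algebra_simps)
qed

lemma sum_block_powi_even:
  fixes z :: complex
  assumes z: "z ^ (2 * l + 1) = 1"
  shows "(\<Sum>p\<in>block l. z powi (2 * p)) = (if z = 1 then of_nat (2 * l + 1) else 0)"
proof -
  have e: "z powi (2 * p) = (z\<^sup>2) powi p" for p by (simp add: power_int_power)
  have "(z\<^sup>2) ^ (2 * l + 1) = 1" using z by (metis power_mult mult.commute power_one)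
  from sum_block_powi[OF this] show ?thesis
    unfolding e using square_root_of_unity_odd[OF z] by auto
qed

lemma period_trace_torus_elem:
  assumes "z ^ (2 * l + 1) = 1"
  shows "period_trace l (torus_elem z n) = of_bool (n = 0) * (of_bool (z = 1) * of_nat (2 * l + 1))"
  using sum_block_powi_even[OF assms]
  by (simp add: period_trace_def entry_torus_elem flip: mult_2)

lemma periodic_torus_elem:
  assumes z: "z ^ (2 * l + 1) = 1"
  shows "periodic (2 * int l + 1) (torus_elem z n)"
  unfolding periodic_def
proof (intro allI)
  fix p q
  have "z powi (p + (2 * int l + 1) + (q + (2 * int l + 1))) = z powi (p + q)"
    by (rule root_of_unity_powi_mod[OF z]) (auto intro: dvdI[of _ _ 2])
  then show "entry (torus_elem z n) (p + (2 * int l + 1)) (q + (2 * int l + 1))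
      = entry (torus_elem z n) p q"
    by (simp add: entry_torus_elem)
qed

definition skew_torus_elem :: "complex \<Rightarrow> int \<Rightarrow> complex banded" where
  "skew_torus_elem z n = torus_elem z n - torus_elem (inverse z) n"

text \<open>The reflection keeps \<open>p - q\<close> and negates \<open>p + q\<close>, hence
  exchanges \<open>z\<close> and \<open>inverse z\<close>.\<close>

lemma skew_skew_torus_elem: "skew (skew_torus_elem z n)"
proof -
  have "z powi (- q + - p) = inverse z powi (p + q)" "inverse z powi (- q + - p) = z powi (p + q)" for p q
  proof -
    have "- q + - p = - (p + q)" by simp
    then show "z powi (- q + - p) = inverse z powi (p + q)" "inverse z powi (- q + - p) = z powi (p + q)"
      by (metis power_int_inverse power_int_minus inverse_inverse_eq)+
  qed
  then show ?thesis by (simp add: skew_def skew_torus_elem_def entry_torus_elem add.commute)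
qed

lemma periodic_skew_torus_elem:
  assumes z: "z ^ (2 * l + 1) = 1"
  shows "periodic (2 * int l + 1) (skew_torus_elem z n)"
proof -
  have "inverse z ^ (2 * l + 1) = 1" using z by (simp only: power_inverse inverse_1)
  then show ?thesis unfolding skew_torus_elem_def
    by (intro periodic_linear periodic_torus_elem z)
qed

text \<open>The non-central part of the defining relation. Products of \<open>z\<close> with
  \<open>w\<close> and of both inverses combine to the element for \<open>z * w\<close>; the mixed
  products combine to that for \<open>z / w\<close>, with the opposite sign.\<close>

lemma skew_torus_elem_commutator:
  assumes "z \<noteq> 0" "w \<noteq> 0"
  shows "skew_torus_elem z n * skew_torus_elem w m - skew_torus_elem w m * skew_torus_elem z n
    = scale_banded (z powi m / w powi n - w powi n / z powi m) (skew_torus_elem (z * w) (m + n))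
      - scale_banded (z powi m * w powi n - inverse (z powi m * w powi n)) (skew_torus_elem (z / w) (m + n))"
proof -
  note t = torus_elem_times[OF assms] torus_elem_times[OF assms(2,1)]
    torus_elem_times[of "inverse z" w n m] torus_elem_times[of w "inverse z" m n]
    torus_elem_times[of z "inverse w" n m] torus_elem_times[of "inverse w" z m n]
    torus_elem_times[of "inverse z" "inverse w" n m] torus_elem_times[of "inverse w" "inverse z" m n]
  show ?thesis
    using assms
    by (simp add: skew_torus_elem_def t left_diff_distrib right_diff_distrib)
      (rule banded_eqI, simp add: power_int_minus power_int_inverse divide_inverse mult.commute
        add.commute algebra_simps)
qed

text \<open>The derivation acts by the scalar \<open>n\<close>, and a product has a trace only if
  \<open>n = - m\<close> and its two roots are inverse to each other. The four products agree in
  pairs, whence the factor 2; the sign comes from replacing \<open>n\<close> by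
  \<open>- m\<close>.\<close>

lemma skew_torus_elem_cocycle:
  assumes z: "z ^ (2 * l + 1) = 1" and w: "w ^ (2 * l + 1) = 1"
  shows "grade_cocycle l (skew_torus_elem z n) (skew_torus_elem w m)
    = of_bool (m + n = 0) * (of_int m * of_nat (2 * l + 1) * 2 * (of_bool (z = w) - of_bool (z * w = 1)))"
proof -
  have nz: "z \<noteq> 0" "w \<noteq> 0" using z w by auto
  have iz: "inverse z ^ (2 * l + 1) = 1" and iw: "inverse w ^ (2 * l + 1) = 1"
    using z w by (simp_all only: power_inverse inverse_1)
  have tr: "period_trace l (torus_elem u n * torus_elem v m)
      = u powi m * v powi m * (of_bool (m + n = 0) * (of_bool (u * v = 1) * of_nat (2 * l + 1)))"
    if "u ^ (2 * l + 1) = 1" "v ^ (2 * l + 1) = 1" for u v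
  proof -
    have "u \<noteq> 0" "v \<noteq> 0" using that by auto
    moreover have "(u * v) ^ (2 * l + 1) = 1" by (simp only: power_mult_distrib that) simp
    ultimately show ?thesis
    proof (cases "m + n = 0")
      case True
      then have "n = - m" by simp
      then show ?thesis using \<open>u \<noteq> 0\<close> \<open>v \<noteq> 0\<close> period_trace_torus_elem[OF \<open>(u * v) ^ (2 * l + 1) = 1\<close>]
        by (simp add: torus_elem_times period_trace_linear)
    next
      case False
      then show ?thesis using \<open>u \<noteq> 0\<close> \<open>v \<noteq> 0\<close> period_trace_torus_elem[OF \<open>(u * v) ^ (2 * l + 1) = 1\<close>]
        by (simp add: torus_elem_times period_trace_linear add.commute)
    qed
  qed
  \<comment> \<open>Where the trace survives, \<open>u * v = 1\<close>, so the twist is 1 as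
    well.\<close>
  have tr': "period_trace l (torus_elem u n * torus_elem v m)
      = of_bool (m + n = 0) * (of_bool (u * v = 1) * of_nat (2 * l + 1))"
    if "u ^ (2 * l + 1) = 1" "v ^ (2 * l + 1) = 1" for u v
    using tr[OF that] power_int_mult_distrib[of u v m] by (cases "u * v = 1") simp_all
  have "grade_derivation (skew_torus_elem z n) = scale_banded (of_int n) (skew_torus_elem z n)"
    by (simp add: skew_torus_elem_def grade_derivation_linear grade_derivation_torus_elem scale_banded_module)
  then have "grade_cocycle l (skew_torus_elem z n) (skew_torus_elem w m)
      = of_int n * period_trace l (skew_torus_elem z n * skew_torus_elem w m)"
    by (simp add: grade_cocycle_def scale_banded_times period_trace_linear)
  also have "period_trace l (skew_torus_elem z n * skew_torus_elem w m)
      = of_bool (m + n = 0) * (of_nat (2 * l + 1) * (of_bool (z * w = 1) - of_bool (z * inverse w = 1)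
        - of_bool (inverse z * w = 1) + of_bool (inverse z * inverse w = 1)))"
    unfolding skew_torus_elem_def left_diff_distrib right_diff_distrib period_trace_linear
      tr'[OF z w] tr'[OF z iw] tr'[OF iz w] tr'[OF iz iw]
    by (simp add: algebra_simps)
  finally have "grade_cocycle l (skew_torus_elem z n) (skew_torus_elem w m)
      = of_int n * (of_bool (m + n = 0) * (of_nat (2 * l + 1) * (of_bool (z * w = 1) - of_bool (z * inverse w = 1)
        - of_bool (inverse z * w = 1) + of_bool (inverse z * inverse w = 1))))" .
  moreover have "(z * inverse w = 1) = (z = w)" "(inverse z * w = 1) = (z = w)"
    "(inverse z * inverse w = 1) = (z * w = 1)"
    using nz by (auto simp: field_simps)
  moreover have "of_int n * (of_bool (m + n = 0) * (of_nat (2 * l + 1) * (u - v - v + u)))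
      = of_bool (m + n = 0) * (of_int m * of_nat (2 * l + 1) * 2 * (v - u))" for u v :: complex
  proof (cases "m + n = 0")
    case True
    then have "n = - m" by simp
    then show ?thesis by (simp add: algebra_simps)
  qed simp
  ultimately show ?thesis by (simp only:)
qed

text \<open>The coboundary that relates the \<open>q\<close>-integer cocycle to \<open>grade_cocycle\<close>; at \<open>z = 1\<close> it
  vanishes because \<open>x / 0 = 0\<close>.\<close>

definition central_shift :: "complex \<Rightarrow> complex" where
  "central_shift z = 1 / (z - inverse z)"

text \<open>Modulo this coboundary a \<open>q_int\<close> becomes \<open>m\<close> at
  \<open>z = 1\<close> and zero elsewhere, which is the shape of
  \<open>skew_torus_elem_cocycle\<close>. The odd order rules out \<open>z = -1\<close>.\<close>

lemma central_shift_q_int: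
  assumes z: "z ^ (2 * l + 1) = 1"
  shows "(z powi m - inverse (z powi m)) * central_shift z = q_int z m - of_int m * of_bool (z = 1)"
proof -
  have "z \<noteq> - 1" using z by auto
  then show ?thesis by (auto simp: q_int_def central_shift_def power_int_minus divide_inverse)
qed

section \<open>Injective characters and their orthogonality\<close>

locale injective_odd_character =
  fixes l :: nat and \<chi> :: "'s::{finite, ab_group_add} \<Rightarrow> complex"
  assumes card_group: "card (UNIV :: 's set) = 2 * l + 1"
    and nonzero: "\<chi> \<alpha> \<noteq> 0"
    and hom: "\<chi> (\<alpha> + \<beta>) = \<chi> \<alpha> * \<chi> \<beta>"
    and inj: "inj \<chi>"
begin

lemma chi_zero: "\<chi> 0 = 1"
  using hom[of 0 0] nonzero[of 0] by simp

lemma chi_minus: "\<chi> (- \<alpha>) = inverse (\<chi> \<alpha>)"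
  using hom[of \<alpha> "- \<alpha>"] by (simp add: chi_zero inverse_unique)

lemma chi_diff: "\<chi> (\<alpha> - \<beta>) = \<chi> \<alpha> / \<chi> \<beta>"
  using hom[of \<alpha> "- \<beta>"] by (simp add: chi_minus divide_inverse)

lemma chi_int_multiple: "\<chi> (m \<cdot>\<^sub>Z \<alpha>) = \<chi> \<alpha> powi m"
proof -
  have *: "\<chi> (((+) \<alpha> ^^ n) 0) = \<chi> \<alpha> ^ n" for n
    by (induction n) (simp_all add: hom chi_zero)
  show ?thesis
    by (auto simp: int_multiple_def power_int_def * chi_minus power_inverse)
qed

text \<open>Translation by \<alpha> permutes the group, so it leaves the product of all values
  unchanged while multiplying it by this power; the product is nonzero.\<close>

lemma chi_root: "\<chi> \<alpha> ^ (2 * l + 1) = 1"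
proof -
  have "(\<Prod>\<beta>\<in>UNIV. \<chi> \<beta>) = (\<Prod>\<beta>\<in>UNIV. \<chi> (\<alpha> + \<beta>))"
    by (rule prod.reindex_bij_witness[of _ "\<lambda>\<beta>. \<alpha> + \<beta>" "\<lambda>\<beta>. \<beta> - \<alpha>"]) auto
  also have "\<dots> = \<chi> \<alpha> ^ (2 * l + 1) * (\<Prod>\<beta>\<in>UNIV. \<chi> \<beta>)"
    by (simp add: hom prod.distrib card_group)
  finally show ?thesis by (simp add: nonzero)
qed

text \<open>Injectivity yields as many values as there are roots of unity. That the values exhaust
  the roots supplies the primitive root in \<open>sum_chi_powi\<close>.\<close>

lemma chi_range: "range \<chi> = {z. z ^ (2 * l + 1) = 1}"
proof (rule card_subset_eq)
  show "finite {z :: complex. z ^ (2 * l + 1) = 1}" by (rule finite_roots_unity) simp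
  show "range \<chi> \<subseteq> {z. z ^ (2 * l + 1) = 1}" using chi_root by auto
  have "card (range \<chi>) = 2 * l + 1" using card_image[OF inj] card_group by simp
  then show "card (range \<chi>) = card {z :: complex. z ^ (2 * l + 1) = 1}"
    by (subst card_roots_unity_eq) simp_all
qed

end

lemma of_nat_odd_nonzero: "of_nat (2 * l + 1) \<noteq> (0 :: complex)"
  by (simp only: of_nat_eq_0_iff)

definition primitive_root :: "nat \<Rightarrow> complex" where
  "primitive_root N = cis (2 * pi / real N)"

lemma primitive_root_power: "N > 0 \<Longrightarrow> primitive_root N ^ N = 1"
  by (simp add: primitive_root_def DeMoivre cis_2pi)

lemma primitive_root_powi_eq_1_iff:
  assumes "N > 0"
  shows "primitive_root N powi k = 1 \<longleftrightarrow> int N dvd k"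
proof
  assume "int N dvd k"
  then show "primitive_root N powi k = 1"
    using root_of_unity_powi_mod[OF primitive_root_power[OF assms], of k 0] assms by simp
next
  assume k: "primitive_root N powi k = 1"
  define j where "j = nat (k mod int N)"
  have j: "int j = k mod int N" "j < N"
    using assms pos_mod_bound[of "int N" k] pos_mod_sign[of "int N" k] unfolding j_def
    by (auto simp: nat_less_iff)
  have "primitive_root N powi k = primitive_root N powi (int j)"
    by (rule root_of_unity_powi_mod[OF primitive_root_power[OF assms] _ assms]) (simp add: j dvd_minus_mod)
  then have "cis (2 * pi * real j / real N) = cis (2 * pi * real 0 / real N)"
    using k by (simp add: primitive_root_def DeMoivre mult_ac)
  then have "j = 0"
    by (rule inj_onD[OF bij_betw_imp_inj_on[OF bij_betw_roots_unity[OF assms]]]) (use j assms in auto)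
  then show "int N dvd k" using j by auto
qed

context injective_odd_character
begin

text \<open>Translation by a group element whose value is a primitive root multiplies the sum by a
  number that is 1 only if the period divides \<open>k\<close>.\<close>

lemma sum_chi_powi:
  "(\<Sum>\<alpha>\<in>UNIV. \<chi> \<alpha> powi k) = (if (2 * int l + 1) dvd k then of_nat (2 * l + 1) else 0)"
proof (cases "(2 * int l + 1) dvd k")
  case True
  then have "\<chi> \<alpha> powi k = 1" for \<alpha>
    using root_of_unity_powi_mod[OF chi_root, of k 0 \<alpha>] by (simp add: add.commute)
  then show ?thesis using True card_group by simp
next
  case False
  have "primitive_root (2 * l + 1) \<in> range \<chi>"
    unfolding chi_range using primitive_root_power[of "2 * l + 1"] by simp
  then obtain \<gamma> where \<gamma>: "\<chi> \<gamma> = primitive_root (2 * l + 1)" by auto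
  have "\<chi> \<gamma> powi k \<noteq> 1"
    using False primitive_root_powi_eq_1_iff[of "2 * l + 1" k] by (simp add: \<gamma> add.commute)
  moreover have "(\<Sum>\<alpha>\<in>UNIV. \<chi> \<alpha> powi k) = (\<Sum>\<alpha>\<in>UNIV. \<chi> (\<gamma> + \<alpha>) powi k)"
    by (rule sum.reindex_bij_witness[of _ "\<lambda>\<beta>. \<gamma> + \<beta>" "\<lambda>\<beta>. \<beta> - \<gamma>"]) auto
  then have "(\<Sum>\<alpha>\<in>UNIV. \<chi> \<alpha> powi k) = \<chi> \<gamma> powi k * (\<Sum>\<alpha>\<in>UNIV. \<chi> \<alpha> powi k)"
    by (simp only: hom power_int_mult_distrib sum_distrib_left[symmetric])
  ultimately show ?thesis using False by simp
qed

end

text \<open>The exponent is the negative of \<open>p + q\<close> at \<open>q = p - n\<close>: the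
  diagonal of degree \<open>n\<close> is paired with the inverse entries of
  \<open>torus_elem z n\<close>.\<close>

definition torus_coeff :: "nat \<Rightarrow> complex banded \<Rightarrow> complex \<Rightarrow> int \<Rightarrow> complex" where
  "torus_coeff l A z n = (\<Sum>p\<in>block l. entry A p (p - n) * z powi (n - 2 * p)) / of_nat (2 * l + 1)"

lemma torus_coeff_linear:
  "torus_coeff l (A + B) z n = torus_coeff l A z n + torus_coeff l B z n"
  "torus_coeff l (A - B) z n = torus_coeff l A z n - torus_coeff l B z n"
  "torus_coeff l (scale_banded c A) z n = c * torus_coeff l A z n"
  "torus_coeff l 0 z n = 0"
  by (simp_all add: torus_coeff_def distrib_right left_diff_distrib sum.distrib sum_subtractf
      add_divide_distrib diff_divide_distrib mult.assoc flip: sum_distrib_left)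

lemma torus_coeff_torus_elem:
  assumes z: "z ^ (2 * l + 1) = 1" and w: "w ^ (2 * l + 1) = 1"
  shows "torus_coeff l (torus_elem w m) z n = of_bool (n = m) * of_bool (w = z)"
proof -
  have nz: "z \<noteq> 0" "w \<noteq> 0" using z w by auto
  have r: "(w / z) ^ (2 * l + 1) = 1" by (simp only: power_divide z w div_by_1)
  have "w powi (p + (p - n)) * z powi (n - 2 * p) = (w / z) powi (2 * p) * (z / w) powi n" for p
    using nz by (simp add: power_int_add power_int_diff power_int_divide_distrib field_simps flip: mult_2)
  then have e: "(\<Sum>p\<in>block l. w powi (p + (p - n)) * z powi (n - 2 * p))
      = (\<Sum>p\<in>block l. (w / z) powi (2 * p)) * (z / w) powi n"
    unfolding sum_distrib_right by (rule sum.cong[OF HOL.refl])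
  have "torus_coeff l (torus_elem w m) z n
      = of_bool (n = m) * (\<Sum>p\<in>block l. w powi (p + (p - n)) * z powi (n - 2 * p)) / of_nat (2 * l + 1)"
    unfolding torus_coeff_def entry_torus_elem sum_distrib_left
    by (intro arg_cong2[of _ _ _ _ "(/)"] sum.cong HOL.refl) simp
  also have "\<dots> = of_bool (n = m) * of_bool (w = z)"
    unfolding e sum_block_powi_even[OF r] using nz by (auto simp: of_nat_eq_0_iff simp flip: of_nat_Suc)
  finally show ?thesis .
qed

lemma torus_coeff_skew_torus_elem:
  assumes z: "z ^ (2 * l + 1) = 1" and w: "w ^ (2 * l + 1) = 1"
  shows "torus_coeff l (skew_torus_elem w m) z n
    = of_bool (n = m) * (of_bool (w = z) - of_bool (inverse w = z))"
proof -
  have "inverse w ^ (2 * l + 1) = 1" using w by (simp only: power_inverse inverse_1)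
  from torus_coeff_torus_elem[OF z this] torus_coeff_torus_elem[OF z w] show ?thesis
    by (simp add: skew_torus_elem_def torus_coeff_linear right_diff_distrib)
qed

text \<open>The factor 2 stems from the exponent \<open>2 * (p - a)\<close> in Fourier inversion,
  and it is coprime to the odd period.\<close>

lemma centred_mod_dvd_iff:
  assumes "a \<in> block l"
  shows "(2 * int l + 1) dvd 2 * (p - a) \<longleftrightarrow> a = centred_mod l p"
proof
  assume "(2 * int l + 1) dvd 2 * (p - a)"
  moreover have "coprime (2 * int l + 1) 2" by simp
  ultimately have "(2 * int l + 1) dvd p - a" using coprime_dvd_mult_right_iff by blast
  then obtain k where "p - a = (2 * int l + 1) * k" by blast
  then have "p = a + k * (2 * int l + 1)" by (simp add: algebra_simps)
  then show "a = centred_mod l p" using centred_unique[OF assms] by simp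
next
  assume "a = centred_mod l p"
  then have "p - a = centred_div l p * (2 * int l + 1)" using centred_mod_div[of l p] by simp
  then show "(2 * int l + 1) dvd 2 * (p - a)" by simp
qed

context injective_odd_character
begin

text \<open>Inversion along the diagonal through \<open>(p, q)\<close>: orthogonality of characters
  isolates the representative of \<open>p\<close> in the block, and periodicity leads back from
  there to \<open>p\<close>.\<close>

lemma torus_fourier_entry:
  assumes A: "periodic (2 * int l + 1) A" and T: "finite T" "\<And>p q. entry A p q \<noteq> 0 \<Longrightarrow> p - q \<in> T"
  shows "entry A p q = (\<Sum>(\<alpha>, n)\<in>UNIV \<times> T. torus_coeff l A (\<chi> \<alpha>) n * entry (torus_elem (\<chi> \<alpha>) n) p q)"
proof -
  let ?n = "p - q"
  have inner: "(\<Sum>\<alpha>\<in>UNIV. torus_coeff l A (\<chi> \<alpha>) ?n * \<chi> \<alpha> powi (p + q)) = entry A p q"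
  proof -
    have "(\<Sum>\<alpha>\<in>UNIV. torus_coeff l A (\<chi> \<alpha>) ?n * \<chi> \<alpha> powi (p + q))
        = (\<Sum>\<alpha>\<in>UNIV. \<Sum>a\<in>block l. entry A a (a - ?n) * \<chi> \<alpha> powi (2 * (p - a))) / of_nat (2 * l + 1)"
      unfolding torus_coeff_def sum_divide_distrib sum_distrib_right
    proof (intro sum.cong HOL.refl)
      fix \<alpha> a
      have "\<chi> \<alpha> powi (2 * (p - a)) = \<chi> \<alpha> powi (?n - 2 * a) * \<chi> \<alpha> powi (p + q)"
        using nonzero[of \<alpha>] by (subst power_int_add[symmetric]) (simp_all add: algebra_simps)
      then show "entry A a (a - ?n) * \<chi> \<alpha> powi (?n - 2 * a) / of_nat (2 * l + 1) * \<chi> \<alpha> powi (p + q)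
          = entry A a (a - ?n) * \<chi> \<alpha> powi (2 * (p - a)) / of_nat (2 * l + 1)" by simp
    qed
    also have "\<dots> = (\<Sum>a\<in>block l. entry A a (a - ?n) * (\<Sum>\<alpha>\<in>UNIV. \<chi> \<alpha> powi (2 * (p - a)))) / of_nat (2 * l + 1)"
      by (subst sum.swap) (simp add: sum_distrib_left)
    also have "\<dots> = (\<Sum>a\<in>block l. if a = centred_mod l p then entry A a (a - ?n) * of_nat (2 * l + 1) else 0)
        / of_nat (2 * l + 1)"
      unfolding sum_chi_powi by (intro arg_cong2[of _ _ _ _ "(/)"] sum.cong HOL.refl) (simp only: centred_mod_dvd_iff if_distrib[of "(*) _"] mult_zero_right)
    also have "\<dots> = entry A (centred_mod l p) (centred_mod l p - ?n)"
    proof -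
      show ?thesis using of_nat_odd_nonzero[of l] by (simp add: sum.delta del: of_nat_add of_nat_Suc of_nat_mult)
    qed
    also have "\<dots> = entry A p q"
    proof -
      have e: "centred_mod l p - ?n + centred_div l p * (2 * int l + 1) = q"
        using centred_mod_div[of l p] by linarith
      show ?thesis
        using periodic_shift[OF A, of "centred_mod l p" "centred_div l p" "centred_mod l p - ?n"]
        unfolding e centred_mod_div by (rule HOL.sym)
    qed
    finally show ?thesis .
  qed
  have "(\<Sum>(\<alpha>, n)\<in>UNIV \<times> T. torus_coeff l A (\<chi> \<alpha>) n * entry (torus_elem (\<chi> \<alpha>) n) p q)
      = (\<Sum>\<alpha>\<in>UNIV. \<Sum>n\<in>T. if n = ?n then torus_coeff l A (\<chi> \<alpha>) n * \<chi> \<alpha> powi (p + q) else 0)"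
    unfolding sum.cartesian_product[symmetric] by (intro sum.cong HOL.refl) (simp add: entry_torus_elem)
  also have "\<dots> = entry A p q"
  proof (cases "?n \<in> T")
    case True
    then show ?thesis using T(1) inner by (simp add: sum.delta)
  next
    case False
    then have "entry A p q = 0" using T(2) by blast
    then show ?thesis using False T(1) by (simp add: sum.delta)
  qed
  finally show ?thesis by simp
qed

text \<open>Half the difference of the inversion formulas at \<open>(p, q)\<close> and at the
  reflected place. It turns each \<open>torus_elem\<close> into half a
  \<open>skew_torus_elem\<close>, so the sum can run over the whole group.\<close>

lemma skew_torus_fourier:
  assumes A: "periodic (2 * int l + 1) A" "skew A"
    and T: "finite T" "\<And>p q. entry A p q \<noteq> 0 \<Longrightarrow> p - q \<in> T"
  shows "A = (\<Sum>(\<alpha>, n)\<in>UNIV \<times> T. scale_banded (torus_coeff l A (\<chi> \<alpha>) n / 2) (skew_torus_elem (\<chi> \<alpha>) n))"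
proof (rule banded_eqI)
  fix p q
  let ?c = "\<lambda>\<alpha> n. torus_coeff l A (\<chi> \<alpha>) n"
  have inv: "entry (torus_elem z n) (- q) (- p) = entry (torus_elem (inverse z) n) p q" for z n
  proof -
    have e: "- q + - p = - (p + q)" "(- q - - p = n) = (p - q = n)" by auto
    show ?thesis unfolding entry_torus_elem e by (simp only: power_int_inverse power_int_minus)
  qed
  have "entry A p q = (entry A p q - entry A (- q) (- p)) / 2"
    using A(2) unfolding skew_def by simp
  also have "entry A p q - entry A (- q) (- p)
      = (\<Sum>(\<alpha>, n)\<in>UNIV \<times> T. ?c \<alpha> n * entry (torus_elem (\<chi> \<alpha>) n) p q)
        - (\<Sum>(\<alpha>, n)\<in>UNIV \<times> T. ?c \<alpha> n * entry (torus_elem (\<chi> \<alpha>) n) (- q) (- p))"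
    by (rule arg_cong2[of _ _ _ _ "(-)"]; rule torus_fourier_entry[OF A(1) T])
  also have "\<dots> = (\<Sum>(\<alpha>, n)\<in>UNIV \<times> T. ?c \<alpha> n * entry (skew_torus_elem (\<chi> \<alpha>) n) p q)"
    unfolding sum_subtractf[symmetric]
    by (intro sum.cong) (auto simp: inv skew_torus_elem_def right_diff_distrib)
  also have "\<dots> / 2 = (\<Sum>(\<alpha>, n)\<in>UNIV \<times> T. ?c \<alpha> n / 2 * entry (skew_torus_elem (\<chi> \<alpha>) n) p q)"
    by (simp add: sum_divide_distrib case_prod_beta)
  finally show "entry A p q = entry (\<Sum>(\<alpha>, n)\<in>UNIV \<times> T.
      scale_banded (?c \<alpha> n / 2) (skew_torus_elem (\<chi> \<alpha>) n)) p q"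
    by (simp add: entry_sum case_prod_beta)
qed

end

section \<open>The isomorphism with \<open>D\<^sub>S\<close>\<close>

text \<open>An inductive set instead of a set of finite sums: elements of the presented algebra
  become accessible to rule induction.\<close>

inductive_set lin_span :: "('b, 'm) lie_structure_scheme \<Rightarrow> 'b set \<Rightarrow> 'b set" for L G where
  zero: "\<zero>\<^bsub>L\<^esub> \<in> lin_span L G"
| base: "x \<in> G \<Longrightarrow> x \<in> lin_span L G"
| add: "x \<in> lin_span L G \<Longrightarrow> y \<in> lin_span L G \<Longrightarrow> x \<oplus>\<^bsub>L\<^esub> y \<in> lin_span L G"
| smult: "x \<in> lin_span L G \<Longrightarrow> a \<odot>\<^bsub>L\<^esub> x \<in> lin_span L G"

context complex_lie_algebra
begin

lemma smult_closed' [simp]: "x \<in> carrier L \<Longrightarrow> a \<odot> x \<in> carrier L"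
  by (rule smult_closed) (simp_all add: complex_field_simps)

lemma smult_zero_left [simp]: "x \<in> carrier L \<Longrightarrow> 0 \<odot> x = \<zero>"
  using smult_l_null[of x] by (simp add: complex_field_simps)

lemma smult_add_left: "x \<in> carrier L \<Longrightarrow> (a + b) \<odot> x = a \<odot> x \<oplus> b \<odot> x"
  using smult_l_distr[of a b x] by (simp add: complex_field_simps)

lemma smult_add_right: "x \<in> carrier L \<Longrightarrow> y \<in> carrier L \<Longrightarrow> a \<odot> (x \<oplus> y) = a \<odot> x \<oplus> a \<odot> y"
  using smult_r_distr[of a x y] by (simp add: complex_field_simps)

lemma smult_smult: "x \<in> carrier L \<Longrightarrow> a \<odot> (b \<odot> x) = (a * b) \<odot> x"
  using smult_assoc1[of a b x] by (simp add: complex_field_simps)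

lemma smult_one_left [simp]: "x \<in> carrier L \<Longrightarrow> 1 \<odot> x = x"
  using smult_one[of x] by (simp add: complex_field_simps)

lemma bracket_zero_left [simp]: "x \<in> carrier L \<Longrightarrow> lie_bracket L \<zero> x = \<zero>"
  using bracket_smult_left[of \<zero> x 0] bracket_closed[of \<zero> x] by simp

lemma bracket_zero_right [simp]: "x \<in> carrier L \<Longrightarrow> lie_bracket L x \<zero> = \<zero>"
  using bracket_smult_right[of x \<zero> 0] bracket_closed[of x \<zero>] by simp

text \<open>The relations let the central generator act trivially only from the left. Expanding the
  bracket of the sum of \<open>x\<close> and \<open>y\<close> with itself yields the other
  side.\<close>

lemma bracket_eq_zero_swap:
  assumes x: "x \<in> carrier L" and y: "y \<in> carrier L" and 0: "lie_bracket L y x = \<zero>"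
  shows "lie_bracket L x y = \<zero>"
proof -
  have "\<zero> = lie_bracket L (x \<oplus> y) (x \<oplus> y)" using x y by (simp add: bracket_self)
  also have "\<dots> = lie_bracket L x x \<oplus> lie_bracket L y x \<oplus> (lie_bracket L x y \<oplus> lie_bracket L y y)"
    using x y bracket_closed by (simp add: bracket_add_left bracket_add_right)
  also have "\<dots> = lie_bracket L x y"
    using x y bracket_closed[of x y] by (simp add: bracket_self 0)
  finally show ?thesis by simp
qed

lemma lin_span_closed:
  assumes "G \<subseteq> carrier L" "x \<in> lin_span L G"
  shows "x \<in> carrier L"
  using assms(2) by induction (use assms(1) in auto)

lemma lin_span_bracket:
  assumes G: "G \<subseteq> carrier L"
    and GG: "\<And>g g'. g \<in> G \<Longrightarrow> g' \<in> G \<Longrightarrow> lie_bracket L g g' \<in> lin_span L G"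
    and x: "x \<in> lin_span L G" and y: "y \<in> lin_span L G"
  shows "lie_bracket L x y \<in> lin_span L G"
  using x
proof induction
  note c = lin_span_closed[OF G]
  case (base g)
  then have g: "g \<in> carrier L" using G by blast
  show ?case using y
  proof induction
    case (base g')
    then show ?case using GG \<open>g \<in> G\<close> by blast
  qed (simp_all add: c g bracket_add_right bracket_smult_right lin_span.zero lin_span.add lin_span.smult)
qed (simp_all add: lin_span_closed[OF G] y bracket_add_left bracket_smult_left
    lin_span.zero lin_span.add lin_span.smult)

end

text \<open>The generators then span a subalgebra, so nested brackets reduce to linear combinations
  and no normal form of terms is needed.\<close>

lemma presented_lie_lin_span:
  assumes G_def: "G = range (\<lambda>g. lie_class R (Gen g))"
    and GG: "\<And>g g'. lie_class R (Bracket (Gen g) (Gen g')) \<in> lin_span (presented_lie R) G"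
  shows "lie_class R t \<in> lin_span (presented_lie R) G"
proof (induction t)
  case (Bracket s t)
  interpret complex_lie_algebra "presented_lie R" by (rule complex_lie_algebra_presented_lie)
  have "lie_bracket (presented_lie R) (lie_class R s) (lie_class R t) \<in> lin_span (presented_lie R) G"
  proof (rule lin_span_bracket[OF _ _ Bracket])
    show "G \<subseteq> carrier (presented_lie R)" by (auto simp: G_def presented_lie_simps)
  qed (use GG in \<open>auto simp: G_def presented_lie_simps\<close>)
  then show ?case by (simp add: presented_lie_simps)
next
  case (Gen g)
  then show ?case by (auto simp: G_def intro: lin_span.base)
next
  case Zero
  show ?case using lin_span.zero[of "presented_lie R" G] by (simp add: presented_lie_simps)
next
  case (Plus s t)
  then show ?case using lin_span.add[OF Plus] by (simp add: presented_lie_simps)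
next
  case (Scale a t)
  then show ?case using lin_span.smult[OF Scale, of a] by (simp add: presented_lie_simps)
qed

lemma lie_hom_apply:
  assumes "h \<in> lie_hom L M"
  shows "x \<in> carrier L \<Longrightarrow> h x \<in> carrier M"
    "x \<in> carrier L \<Longrightarrow> y \<in> carrier L \<Longrightarrow> h (x \<oplus>\<^bsub>L\<^esub> y) = h x \<oplus>\<^bsub>M\<^esub> h y"
    "x \<in> carrier L \<Longrightarrow> h (a \<odot>\<^bsub>L\<^esub> x) = a \<odot>\<^bsub>M\<^esub> h x"
    "x \<in> carrier L \<Longrightarrow> y \<in> carrier L \<Longrightarrow> h (lie_bracket L x y) = lie_bracket M (h x) (h y)"
  using assms unfolding lie_hom_def by auto

lemma skew_torus_elem_inverse: "skew_torus_elem (inverse z) n = - skew_torus_elem z n"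
  by (simp add: skew_torus_elem_def)

lemma central_shift_inverse: "central_shift (inverse z) = - central_shift z"
  unfolding central_shift_def by (metis inverse_inverse_eq minus_diff_eq minus_divide_right)

section \<open>The homomorphism out of the presented algebra\<close>

context injective_odd_character
begin

text \<open>The value at \<open>C\<close> is read off by comparing
  \<open>skew_torus_elem_cocycle\<close> with the central term of the relation, whose two parts have
  the opposite order. The central part of a \<open>D\<close> generator realises the coboundary of
  \<open>central_shift\<close>; it sits in degree 0 because the cocycle pairs only opposite
  degrees.\<close>

fun gen_image :: "'s D_gen \<Rightarrow> complex banded \<times> complex" where
  "gen_image C = (0, - 2 * of_nat (2 * l + 1))"
| "gen_image (D \<alpha> n) = (skew_torus_elem (\<chi> \<alpha>) n,
    of_bool (n = 0) * (2 * of_nat (2 * l + 1) * central_shift (\<chi> \<alpha>)))"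

lemma gen_image_closed: "gen_image g \<in> carrier (skew_loop_lie l)"
  by (cases g) (simp_all add: skew_loop_lie_simps periodic_linear skew_linear
      periodic_skew_torus_elem[OF chi_root] skew_skew_torus_elem)

lemma gen_image_bracket:
  "lie_bracket (skew_loop_lie l) (gen_image (D \<alpha> n)) (gen_image (D \<beta> m)) =
    lie_eval (skew_loop_lie l) gen_image
     (Plus (Plus
       (Scale (\<chi> (m \<cdot>\<^sub>Z \<alpha> - n \<cdot>\<^sub>Z \<beta>) - \<chi> (n \<cdot>\<^sub>Z \<beta> - m \<cdot>\<^sub>Z \<alpha>)) (Gen (D (\<alpha> + \<beta>) (m + n))))
       (Scale (- (\<chi> (m \<cdot>\<^sub>Z \<alpha> + n \<cdot>\<^sub>Z \<beta>) - \<chi> (- (m \<cdot>\<^sub>Z \<alpha>) - n \<cdot>\<^sub>Z \<beta>))) (Gen (D (\<alpha> - \<beta>) (m + n)))))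
       (Scale ((q_int (\<chi> (\<alpha> + \<beta>)) m - q_int (\<chi> (\<alpha> - \<beta>)) m) * (if m + n = 0 then 1 else 0)) (Gen C)))"
proof -
  define z w where "z = \<chi> \<alpha>" and "w = \<chi> \<beta>"
  define N where "N = (of_nat (2 * l + 1) :: complex)"
  have nz: "z \<noteq> 0" "w \<noteq> 0" by (simp_all add: z_def w_def nonzero)
  have zw: "z ^ (2 * l + 1) = 1" "w ^ (2 * l + 1) = 1" unfolding z_def w_def by (rule chi_root)+
  have roots: "(z * w) ^ (2 * l + 1) = 1" "(z / w) ^ (2 * l + 1) = 1"
    by (simp_all only: power_mult_distrib power_divide zw) simp_all
  have coeffs: "\<chi> (m \<cdot>\<^sub>Z \<alpha> - n \<cdot>\<^sub>Z \<beta>) - \<chi> (n \<cdot>\<^sub>Z \<beta> - m \<cdot>\<^sub>Z \<alpha>) = z powi m / w powi n - w powi n / z powi m"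
    "\<chi> (m \<cdot>\<^sub>Z \<alpha> + n \<cdot>\<^sub>Z \<beta>) - \<chi> (- (m \<cdot>\<^sub>Z \<alpha>) - n \<cdot>\<^sub>Z \<beta>) = z powi m * w powi n - inverse (z powi m * w powi n)"
    by (simp_all add: chi_diff chi_minus hom chi_int_multiple z_def w_def field_simps nonzero)
  have central: "grade_cocycle l (skew_torus_elem z n) (skew_torus_elem w m)
    = of_bool (m + n = 0) * ((z powi m / w powi n - w powi n / z powi m) * (2 * N * central_shift (z * w))
      - (z powi m * w powi n - inverse (z powi m * w powi n)) * (2 * N * central_shift (z / w))
      + (q_int (z * w) m - q_int (z / w) m) * (- 2 * N))"
  proof (cases "m + n = 0")
    case True
    then have n: "n = - m" by simp
    \<comment> \<open>For \<open>n = - m\<close> both structure constants become an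
      \<open>m\<close>-th power minus its inverse, the factor that
      \<open>central_shift_q_int\<close> turns into a \<open>q_int\<close>.\<close>
    have "z powi m / w powi n = (z * w) powi m" "w powi n / z powi m = inverse ((z * w) powi m)"
      "z powi m * w powi n = (z / w) powi m"
      by (simp_all add: n power_int_minus power_int_mult_distrib power_int_divide_distrib divide_inverse
          power_int_inverse mult.commute)
    then have "(z powi m / w powi n - w powi n / z powi m) * (2 * N * central_shift (z * w))
        = 2 * N * (q_int (z * w) m - of_int m * of_bool (z * w = 1))"
      "(z powi m * w powi n - inverse (z powi m * w powi n)) * (2 * N * central_shift (z / w))
        = 2 * N * (q_int (z / w) m - of_int m * of_bool (z / w = 1))"
      using central_shift_q_int[OF roots(1), of m] central_shift_q_int[OF roots(2), of m]
      by (simp_all only: mult.assoc mult.left_commute)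
    moreover have "(z / w = 1) = (z = w)" using nz by auto
    ultimately show ?thesis
      using True by (simp only: skew_torus_elem_cocycle[OF zw] N_def) (simp add: algebra_simps)
  next
    case False
    then show ?thesis by (simp add: skew_torus_elem_cocycle[OF zw])
  qed
  have "lie_bracket (skew_loop_lie l) (gen_image (D \<alpha> n)) (gen_image (D \<beta> m))
      = (skew_torus_elem z n * skew_torus_elem w m - skew_torus_elem w m * skew_torus_elem z n,
         grade_cocycle l (skew_torus_elem z n) (skew_torus_elem w m))"
    by (simp add: skew_loop_lie_simps z_def w_def)
  moreover have "scale_banded (- c) A = - scale_banded c A" for c and A :: "complex banded"
    by (rule banded_eqI) simp
  ultimately show ?thesis
    unfolding coeffs central skew_torus_elem_commutator[OF nz]
    by (simp add: skew_loop_lie_simps hom chi_diff flip: z_def w_def N_def)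
      (auto simp: scale_banded.rep_eq N_def algebra_simps intro!: banded_eqI)
qed

lemma gen_image_relations:
  assumes "(s, t) \<in> D_relations \<chi>"
  shows "lie_eval (skew_loop_lie l) gen_image s = lie_eval (skew_loop_lie l) gen_image t"
  using assms
proof cases
  case (central u)
  obtain A a where "lie_eval (skew_loop_lie l) gen_image u = (A, a)" by force
  moreover have "grade_derivation 0 = (0 :: complex banded)" by (rule banded_eqI) simp
  ultimately show ?thesis
    by (simp add: central skew_loop_lie_simps grade_cocycle_def period_trace_def)
next
  case (neg \<alpha> n)
  have "scale_banded (- 1) A = - A" for A :: "complex banded" by (rule banded_eqI) simp
  then show ?thesis
    by (simp add: neg skew_loop_lie_simps chi_minus skew_torus_elem_inverse central_shift_inverse)
next
  case (bracket \<alpha> n \<beta> m)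
  show ?thesis unfolding bracket(2) gen_image_bracket[symmetric] bracket(1) by simp
qed

abbreviation "d_class \<equiv> \<lambda>(\<alpha>, n). lie_class (D_relations \<chi>) (Gen (D \<alpha> n))"
abbreviation "c_class \<equiv> lie_class (D_relations \<chi>) (Gen C)"
abbreviation "gen_classes \<equiv> range (\<lambda>g. lie_class (D_relations \<chi>) (Gen g))"

lemma D_lie_span: "carrier (D_lie \<chi>) = lin_span (D_lie \<chi>) gen_classes"
proof -
  let ?R = "D_relations \<chi>"
  interpret complex_lie_algebra "presented_lie ?R" by (rule complex_lie_algebra_presented_lie)
  have central: "lie_class ?R (Bracket (Gen C) t) = lie_class ?R Zero" for t
    unfolding lie_class_eq_iff by (intro lie_eq.rel D_relations.central)
  have central': "lie_class ?R (Bracket t (Gen C)) = lie_class ?R Zero" for t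
    using bracket_eq_zero_swap[of "lie_class ?R t" c_class] central[of t]
    by (simp add: presented_lie_simps)
  have "lie_class ?R (Bracket (Gen g) (Gen g')) \<in> lin_span (presented_lie ?R) gen_classes" for g g'
  proof (cases g)
    case C
    then show ?thesis using central lin_span.zero[of "presented_lie ?R"] by (simp add: presented_lie_simps)
  next
    case g: (D \<alpha> n)
    show ?thesis
    proof (cases g')
      case C
      then show ?thesis using central' lin_span.zero[of "presented_lie ?R"] by (simp add: presented_lie_simps)
    next
      case g': (D \<beta> m)
      note b = D_relations.bracket[where \<chi> = \<chi> and \<alpha> = \<alpha> and n = n and \<beta> = \<beta> and m = m,
          THEN lie_eq.rel, folded lie_class_eq_iff]
      show ?thesis
        unfolding g g' b presented_lie_simps(3,4)[symmetric]
        by (intro lin_span.add lin_span.smult lin_span.base rangeI)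
    qed
  qed
  then have "lie_class ?R t \<in> lin_span (D_lie \<chi>) gen_classes" for t
    unfolding D_lie_def by (rule presented_lie_lin_span[OF HOL.refl])
  moreover have "gen_classes \<subseteq> carrier (presented_lie ?R)" by (auto simp: presented_lie_simps)
  ultimately show ?thesis
    unfolding D_lie_def using lin_span_closed by (auto simp: presented_lie_simps(1))
qed

text \<open>The inverse of the isomorphism to \<open>skew_loop_lie l\<close>; \<open>finsum\<close> needs a finite index set, hence
  the parameter \<open>T\<close>, which has to contain all degrees that occur in \<open>x\<close>.\<close>

definition inverse_sum :: "int set \<Rightarrow> complex banded \<times> complex \<Rightarrow> 's D_gen lie_term set" where
  "inverse_sum T x = finsum (D_lie \<chi>) (\<lambda>(\<alpha>, n).
      (torus_coeff l (fst x) (\<chi> \<alpha>) n / 2) \<odot>\<^bsub>D_lie \<chi>\<^esub> d_class (\<alpha>, n)) (UNIV \<times> T)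
    \<oplus>\<^bsub>D_lie \<chi>\<^esub> (((\<Sum>\<alpha>\<in>UNIV. torus_coeff l (fst x) (\<chi> \<alpha>) 0 * central_shift (\<chi> \<alpha>)) / 2
      - snd x / (2 * of_nat (2 * l + 1))) \<odot>\<^bsub>D_lie \<chi>\<^esub> c_class)"

lemma complex_lie_algebra_D_lie: "complex_lie_algebra (D_lie \<chi>)"
  unfolding D_lie_def by (rule complex_lie_algebra_presented_lie)

lemma class_closed [simp]: "lie_class (D_relations \<chi>) t \<in> carrier (D_lie \<chi>)"
  by (simp add: D_lie_def presented_lie_simps)

lemma inverse_sum_add:
  assumes "finite T"
  shows "inverse_sum T (x \<oplus>\<^bsub>skew_loop_lie l\<^esub> y) = inverse_sum T x \<oplus>\<^bsub>D_lie \<chi>\<^esub> inverse_sum T y"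
proof -
  interpret Q: complex_lie_algebra "D_lie \<chi>" by (rule complex_lie_algebra_D_lie)
  obtain A a B b where x: "x = (A, a)" and y: "y = (B, b)" by force
  let ?f = "\<lambda>A (\<alpha>, n). (torus_coeff l A (\<chi> \<alpha>) n / 2) \<odot>\<^bsub>D_lie \<chi>\<^esub> d_class (\<alpha>, n)"
  let ?z = "\<lambda>A a. (\<Sum>\<alpha>\<in>UNIV. torus_coeff l A (\<chi> \<alpha>) 0 * central_shift (\<chi> \<alpha>)) / 2
      - a / (2 * of_nat (2 * l + 1))"
  have f: "?f A \<in> UNIV \<times> T \<rightarrow> carrier (D_lie \<chi>)" for A by auto
  have "finsum (D_lie \<chi>) (?f (A + B)) (UNIV \<times> T)
      = (\<Oplus>\<^bsub>D_lie \<chi>\<^esub>i\<in>UNIV \<times> T. ?f A i \<oplus>\<^bsub>D_lie \<chi>\<^esub> ?f B i)"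
    by (rule Q.finsum_cong') (auto simp: torus_coeff_linear add_divide_distrib Q.smult_add_left)
  also have "\<dots> = finsum (D_lie \<chi>) (?f A) (UNIV \<times> T) \<oplus>\<^bsub>D_lie \<chi>\<^esub> finsum (D_lie \<chi>) (?f B) (UNIV \<times> T)"
    by (rule Q.finsum_addf[OF f f])
  finally have s: "finsum (D_lie \<chi>) (?f (A + B)) (UNIV \<times> T)
      = finsum (D_lie \<chi>) (?f A) (UNIV \<times> T) \<oplus>\<^bsub>D_lie \<chi>\<^esub> finsum (D_lie \<chi>) (?f B) (UNIV \<times> T)" .
  have z: "?z (A + B) (a + b) = ?z A a + ?z B b"
    by (simp add: torus_coeff_linear distrib_right sum.distrib add_divide_distrib)
  show ?thesis
    using Q.finsum_closed[OF f, of A] Q.finsum_closed[OF f, of B]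
    unfolding inverse_sum_def x y skew_loop_lie_simps fst_conv snd_conv s z
    by (simp add: Q.smult_add_left Q.a_ac)
qed

lemma inverse_sum_smult:
  assumes "finite T"
  shows "inverse_sum T (c \<odot>\<^bsub>skew_loop_lie l\<^esub> x) = c \<odot>\<^bsub>D_lie \<chi>\<^esub> inverse_sum T x"
proof -
  interpret Q: complex_lie_algebra "D_lie \<chi>" by (rule complex_lie_algebra_D_lie)
  obtain A a where x: "x = (A, a)" by force
  let ?f = "\<lambda>A (\<alpha>, n). (torus_coeff l A (\<chi> \<alpha>) n / 2) \<odot>\<^bsub>D_lie \<chi>\<^esub> d_class (\<alpha>, n)"
  let ?z = "\<lambda>A a. (\<Sum>\<alpha>\<in>UNIV. torus_coeff l A (\<chi> \<alpha>) 0 * central_shift (\<chi> \<alpha>)) / 2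
      - a / (2 * of_nat (2 * l + 1))"
  have f: "?f A \<in> UNIV \<times> T \<rightarrow> carrier (D_lie \<chi>)" for A by auto
  have "finsum (D_lie \<chi>) (?f (scale_banded c A)) (UNIV \<times> T)
      = (\<Oplus>\<^bsub>D_lie \<chi>\<^esub>i\<in>UNIV \<times> T. c \<odot>\<^bsub>D_lie \<chi>\<^esub> ?f A i)"
    by (rule Q.finsum_cong') (auto simp: torus_coeff_linear Q.smult_smult)
  also have "\<dots> = c \<odot>\<^bsub>D_lie \<chi>\<^esub> finsum (D_lie \<chi>) (?f A) (UNIV \<times> T)"
    by (rule Q.finsum_smult_ldistr[symmetric]) (use assms f in \<open>auto simp: complex_field_simps\<close>)
  finally have s: "finsum (D_lie \<chi>) (?f (scale_banded c A)) (UNIV \<times> T)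
      = c \<odot>\<^bsub>D_lie \<chi>\<^esub> finsum (D_lie \<chi>) (?f A) (UNIV \<times> T)" .
  have z: "?z (scale_banded c A) (c * a) = c * ?z A a"
    by (simp add: torus_coeff_linear mult.assoc right_diff_distrib flip: sum_distrib_left)
  show ?thesis
    using Q.finsum_closed[OF f, of A]
    unfolding inverse_sum_def x skew_loop_lie_simps fst_conv snd_conv s z
    by (simp add: Q.smult_add_right Q.smult_smult)
qed

lemma d_class_minus: "d_class (- \<alpha>, n) = (- 1) \<odot>\<^bsub>D_lie \<chi>\<^esub> d_class (\<alpha>, n)"
  by (simp add: D_lie_def presented_lie_simps lie_class_eq_iff lie_eq.rel D_relations.neg)

text \<open>The Fourier coefficients give weight 1/2 to \<alpha> and -1/2 to -\<alpha>; the relation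
  \<open>neg\<close> merges both terms into one class.\<close>

lemma inverse_sum_gen_D:
  assumes "finite T" "m \<in> T"
  shows "inverse_sum T (gen_image (D \<alpha> m)) = d_class (\<alpha>, m)"
proof -
  interpret Q: complex_lie_algebra "D_lie \<chi>" by (rule complex_lie_algebra_D_lie)
  have coeff: "torus_coeff l (skew_torus_elem (\<chi> \<alpha>) m) (\<chi> \<beta>) n
      = of_bool (n = m) * (of_bool (\<beta> = \<alpha>) - of_bool (\<beta> = - \<alpha>))" for \<beta> n
  proof -
    have "(\<chi> \<alpha> = \<chi> \<beta>) = (\<beta> = \<alpha>)" "(inverse (\<chi> \<alpha>) = \<chi> \<beta>) = (\<beta> = - \<alpha>)"
      unfolding chi_minus[symmetric] inj_eq[OF inj] by auto
    then show ?thesis by (simp only: torus_coeff_skew_torus_elem[OF chi_root chi_root])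
  qed
  let ?f = "\<lambda>i. (1 / 2) \<odot>\<^bsub>D_lie \<chi>\<^esub> d_class i" and ?g = "\<lambda>i. (- 1 / 2) \<odot>\<^bsub>D_lie \<chi>\<^esub> d_class i"
  have closed: "d_class i \<in> carrier (D_lie \<chi>)" for i by (cases i) simp
  have "finsum (D_lie \<chi>) (\<lambda>(\<beta>, n).
      (torus_coeff l (skew_torus_elem (\<chi> \<alpha>) m) (\<chi> \<beta>) n / 2) \<odot>\<^bsub>D_lie \<chi>\<^esub> d_class (\<beta>, n)) (UNIV \<times> T)
    = (\<Oplus>\<^bsub>D_lie \<chi>\<^esub>i\<in>UNIV \<times> T. (if (\<alpha>, m) = i then ?f i else \<zero>\<^bsub>D_lie \<chi>\<^esub>)
        \<oplus>\<^bsub>D_lie \<chi>\<^esub> (if (- \<alpha>, m) = i then ?g i else \<zero>\<^bsub>D_lie \<chi>\<^esub>))"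
  proof (rule Q.finsum_cong')
    fix i :: "'s \<times> int" assume "i \<in> UNIV \<times> T"
    obtain \<beta> n where i: "i = (\<beta>, n)" by force
    \<comment> \<open>Covers the case \<alpha> = -\<alpha>, where both delta terms sit at the same
      index and the coefficient is zero.\<close>
    have "(1 / 2) \<odot>\<^bsub>D_lie \<chi>\<^esub> v \<oplus>\<^bsub>D_lie \<chi>\<^esub> (- 1 / 2) \<odot>\<^bsub>D_lie \<chi>\<^esub> v = \<zero>\<^bsub>D_lie \<chi>\<^esub>"
      if "v \<in> carrier (D_lie \<chi>)" for v
      using Q.smult_add_left[OF that, of "1 / 2" "- 1 / 2"] that by simp
    then show "(case i of (\<beta>, n) \<Rightarrow>
        (torus_coeff l (skew_torus_elem (\<chi> \<alpha>) m) (\<chi> \<beta>) n / 2) \<odot>\<^bsub>D_lie \<chi>\<^esub> d_class (\<beta>, n))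
      = (if (\<alpha>, m) = i then ?f i else \<zero>\<^bsub>D_lie \<chi>\<^esub>)
        \<oplus>\<^bsub>D_lie \<chi>\<^esub> (if (- \<alpha>, m) = i then ?g i else \<zero>\<^bsub>D_lie \<chi>\<^esub>)"
      by (auto simp: i coeff)
  qed (use closed in auto)
  also have "\<dots> = (\<Oplus>\<^bsub>D_lie \<chi>\<^esub>i\<in>UNIV \<times> T. if (\<alpha>, m) = i then ?f i else \<zero>\<^bsub>D_lie \<chi>\<^esub>)
      \<oplus>\<^bsub>D_lie \<chi>\<^esub> (\<Oplus>\<^bsub>D_lie \<chi>\<^esub>i\<in>UNIV \<times> T. if (- \<alpha>, m) = i then ?g i else \<zero>\<^bsub>D_lie \<chi>\<^esub>)"
    by (rule Q.finsum_addf) (use closed in auto)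
  also have "\<dots> = ?f (\<alpha>, m) \<oplus>\<^bsub>D_lie \<chi>\<^esub> ?g (- \<alpha>, m)"
    using assms closed by (intro arg_cong2[of _ _ _ _ "add (D_lie \<chi>)"] Q.finsum_singleton) auto
  also have "\<dots> = d_class (\<alpha>, m)"
    unfolding d_class_minus using closed[of "(\<alpha>, m)"]
    by (simp add: Q.smult_smult flip: Q.smult_add_left)
  finally have s: "finsum (D_lie \<chi>) (\<lambda>(\<beta>, n).
      (torus_coeff l (skew_torus_elem (\<chi> \<alpha>) m) (\<chi> \<beta>) n / 2) \<odot>\<^bsub>D_lie \<chi>\<^esub> d_class (\<beta>, n)) (UNIV \<times> T)
    = d_class (\<alpha>, m)" .
  \<comment> \<open>The central coefficient of \<open>inverse_sum\<close> cancels the correction in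
    \<open>gen_image\<close>; since \<open>central_shift\<close> is odd, \<alpha> and -\<alpha>
    contribute equally.\<close>
  have "(\<Sum>\<beta>\<in>UNIV. torus_coeff l (skew_torus_elem (\<chi> \<alpha>) m) (\<chi> \<beta>) 0 * central_shift (\<chi> \<beta>))
      = of_bool (m = 0) * ((\<Sum>\<beta>\<in>UNIV. if \<beta> = \<alpha> then central_shift (\<chi> \<beta>) else 0)
          - (\<Sum>\<beta>\<in>UNIV. if \<beta> = - \<alpha> then central_shift (\<chi> \<beta>) else 0))"
    unfolding sum_subtractf[symmetric] sum_distrib_left coeff by (intro sum.cong) auto
  also have "\<dots> = of_bool (m = 0) * (2 * central_shift (\<chi> \<alpha>))"
    by (simp add: chi_minus central_shift_inverse)
  finally have "(\<Sum>\<beta>\<in>UNIV. torus_coeff l (skew_torus_elem (\<chi> \<alpha>) m) (\<chi> \<beta>) 0 * central_shift (\<chi> \<beta>)) / 2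
      - of_bool (m = 0) * (2 * of_nat (2 * l + 1) * central_shift (\<chi> \<alpha>)) / (2 * of_nat (2 * l + 1)) = 0"
    using of_nat_odd_nonzero[of l]
    by (simp del: of_nat_add of_nat_Suc of_nat_mult)
  then show ?thesis
    unfolding inverse_sum_def gen_image.simps fst_conv snd_conv s by simp
qed

lemma inverse_sum_gen_C: "inverse_sum T (gen_image C) = c_class"
proof -
  interpret Q: complex_lie_algebra "D_lie \<chi>" by (rule complex_lie_algebra_D_lie)
  have "finsum (D_lie \<chi>) (\<lambda>(\<alpha>, n). (torus_coeff l 0 (\<chi> \<alpha>) n / 2) \<odot>\<^bsub>D_lie \<chi>\<^esub> d_class (\<alpha>, n)) (UNIV \<times> T)
      = finsum (D_lie \<chi>) (\<lambda>_ :: 's \<times> int. \<zero>\<^bsub>D_lie \<chi>\<^esub>) (UNIV \<times> T)"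
    by (rule Q.finsum_cong') (auto simp: torus_coeff_linear)
  moreover note of_nat_odd_nonzero[of l]
  ultimately show ?thesis
    by (simp add: inverse_sum_def torus_coeff_linear del: of_nat_add of_nat_Suc of_nat_mult)
qed

lemma inverse_sum_zero: "inverse_sum T (\<zero>\<^bsub>skew_loop_lie l\<^esub>) = \<zero>\<^bsub>D_lie \<chi>\<^esub>"
proof -
  interpret Q: complex_lie_algebra "D_lie \<chi>" by (rule complex_lie_algebra_D_lie)
  have "finsum (D_lie \<chi>) (\<lambda>(\<alpha>, n). (torus_coeff l 0 (\<chi> \<alpha>) n / 2) \<odot>\<^bsub>D_lie \<chi>\<^esub> d_class (\<alpha>, n)) (UNIV \<times> T)
      = finsum (D_lie \<chi>) (\<lambda>_ :: 's \<times> int. \<zero>\<^bsub>D_lie \<chi>\<^esub>) (UNIV \<times> T)"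
    by (rule Q.finsum_cong') (auto simp: torus_coeff_linear)
  then show ?thesis
    by (simp add: inverse_sum_def torus_coeff_linear skew_loop_lie_simps)
qed

text \<open>A left inverse of \<open>h\<close>, which yields injectivity. For fixed \<open>T\<close>
  it is linear, so the generators decide. Allowing every larger \<open>T\<close> lets one set serve
  two elements, both in the induction and when preimages are compared.\<close>

lemma inverse_sum_hom:
  assumes h: "h \<in> lie_hom (D_lie \<chi>) (skew_loop_lie l)"
    and gen: "\<And>g. h (lie_class (D_relations \<chi>) (Gen g)) = gen_image g"
    and y: "y \<in> lin_span (D_lie \<chi>) gen_classes"
  shows "\<exists>T0. finite T0 \<and> (\<forall>T. finite T \<longrightarrow> T0 \<subseteq> T \<longrightarrow> inverse_sum T (h y) = y)"
  using y
proof induction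
  interpret Q: complex_lie_algebra "D_lie \<chi>" by (rule complex_lie_algebra_D_lie)
  interpret M: complex_lie_algebra "skew_loop_lie l" by (rule complex_lie_algebra_skew_loop_lie)
  note hs = lie_hom_apply[OF h]
  case zero
  have "h (0 \<odot>\<^bsub>D_lie \<chi>\<^esub> \<zero>\<^bsub>D_lie \<chi>\<^esub>) = \<zero>\<^bsub>skew_loop_lie l\<^esub>"
    using hs(1)[of "\<zero>\<^bsub>D_lie \<chi>\<^esub>"] by (subst hs(3)) simp_all
  then show ?case by (auto simp: inverse_sum_zero)
next
  case (base y)
  then obtain g where y: "y = lie_class (D_relations \<chi>) (Gen g)" by auto
  show ?case
  proof (cases g)
    case C
    then show ?thesis by (auto simp add: y gen inverse_sum_gen_C simp del: gen_image.simps)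
  next
    case (D \<alpha> n)
    then show ?thesis
      using inverse_sum_gen_D[of _ n \<alpha>] unfolding y gen
      by (intro exI[of _ "{n}"]) (simp del: gen_image.simps)
  qed
next
  case (add x y)
  obtain T1 where "finite T1" "\<forall>T. finite T \<longrightarrow> T1 \<subseteq> T \<longrightarrow> inverse_sum T (h x) = x"
    using add.IH(1) by (elim exE conjE)
  moreover obtain T2 where "finite T2" "\<forall>T. finite T \<longrightarrow> T2 \<subseteq> T \<longrightarrow> inverse_sum T (h y) = y"
    using add.IH(2) by (elim exE conjE)
  moreover have "x \<in> carrier (D_lie \<chi>)" "y \<in> carrier (D_lie \<chi>)" using add by (simp_all add: D_lie_span)
  ultimately show ?case
    by (intro exI[of _ "T1 \<union> T2"]) (simp add: lie_hom_apply[OF h] inverse_sum_add)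
next
  case (smult x a)
  obtain T where "finite T" "\<forall>T'. finite T' \<longrightarrow> T \<subseteq> T' \<longrightarrow> inverse_sum T' (h x) = x"
    using smult.IH by (elim exE conjE)
  moreover have "x \<in> carrier (D_lie \<chi>)" using smult by (simp add: D_lie_span)
  ultimately show ?case
    by (intro exI[of _ T]) (simp add: lie_hom_apply[OF h] inverse_sum_smult)
qed

proposition D_lie_iso_skew_loop_lie:
  obtains h where "h \<in> lie_hom (D_lie \<chi>) (skew_loop_lie l)"
    "bij_betw h (carrier (D_lie \<chi>)) (carrier (skew_loop_lie l))"
proof -
  let ?Q = "D_lie \<chi>" and ?M = "skew_loop_lie l"
  interpret Q: complex_lie_algebra ?Q by (rule complex_lie_algebra_D_lie)
  interpret M: complex_lie_algebra ?M by (rule complex_lie_algebra_skew_loop_lie)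
  obtain h where h: "h \<in> lie_hom ?Q ?M" and gen: "\<And>g. h (lie_class (D_relations \<chi>) (Gen g)) = gen_image g"
    using presented_lie_universal[OF complex_lie_algebra_skew_loop_lie gen_image_closed gen_image_relations]
    unfolding D_lie_def by blast
  note hs = lie_hom_apply[OF h]
  have inj: "inj_on h (carrier ?Q)"
  proof (rule inj_onI)
    fix x y assume x: "x \<in> carrier ?Q" and y: "y \<in> carrier ?Q" and eq: "h x = h y"
    obtain T1 T2 where
      "finite T1" "\<forall>T. finite T \<longrightarrow> T1 \<subseteq> T \<longrightarrow> inverse_sum T (h x) = x"
      "finite T2" "\<forall>T. finite T \<longrightarrow> T2 \<subseteq> T \<longrightarrow> inverse_sum T (h y) = y"
      using inverse_sum_hom[OF h gen] x y unfolding D_lie_span by metis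
    then have "inverse_sum (T1 \<union> T2) (h x) = x" "inverse_sum (T1 \<union> T2) (h y) = y" by auto
    then show "x = y" unfolding eq by simp
  qed
  have im_add: "u \<oplus>\<^bsub>?M\<^esub> v \<in> h ` carrier ?Q" if uv: "u \<in> h ` carrier ?Q" "v \<in> h ` carrier ?Q" for u v
  proof -
    obtain x where "u = h x" "x \<in> carrier ?Q" using uv(1) by (rule imageE)
    moreover obtain y where "v = h y" "y \<in> carrier ?Q" using uv(2) by (rule imageE)
    ultimately show ?thesis by (intro image_eqI[of _ _ "x \<oplus>\<^bsub>?Q\<^esub> y"]) (simp_all add: hs(2))
  qed
  have im_smult: "c \<odot>\<^bsub>?M\<^esub> u \<in> h ` carrier ?Q" if u: "u \<in> h ` carrier ?Q" for u c
  proof -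
    obtain x where "u = h x" "x \<in> carrier ?Q" using u by (rule imageE)
    then show ?thesis by (intro image_eqI[of _ _ "c \<odot>\<^bsub>?Q\<^esub> x"]) (simp_all add: hs(3))
  qed
  note N = of_nat_odd_nonzero[of l]
  have im_gen: "gen_image g \<in> h ` carrier ?Q" for g
    unfolding gen[symmetric] by simp
  have scale_zero: "scale_banded c 0 = 0" for c :: complex by (rule banded_eqI) simp
  have im_central: "(0, c) \<in> h ` carrier ?Q" for c
    using im_smult[OF im_gen[of C], of "c / (- 2 * of_nat (2 * l + 1))"] N
    by (simp add: skew_loop_lie_simps scale_zero del: of_nat_add of_nat_Suc of_nat_mult)
  \<comment> \<open>The central line already lies in the image, so the central part of a generator
    can be removed.\<close>
  have im_torus: "(skew_torus_elem (\<chi> \<alpha>) n, 0) \<in> h ` carrier ?Q" for \<alpha> n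
    using im_add[OF im_gen[of "D \<alpha> n"] im_central[of "- snd (gen_image (D \<alpha> n))"]]
    by (simp add: skew_loop_lie_simps)
  have im_sum: "(\<Sum>i\<in>P. scale_banded (f i) (skew_torus_elem (\<chi> (fst i)) (snd i)), 0) \<in> h ` carrier ?Q"
    if "finite P" for P and f :: "'s \<times> int \<Rightarrow> complex"
    using that
  proof induction
    case (insert i P)
    show ?case
      using im_add[OF im_smult[OF im_torus, of "f i" "fst i" "snd i"] insert.IH] insert
      by (simp add: skew_loop_lie_simps)
  qed (simp add: im_central)
  have "(A, a) \<in> h ` carrier ?Q" if A: "(A, a) \<in> carrier ?M" for A a
  proof -
    have A': "periodic (2 * int l + 1) A" "skew A" using A by (simp_all add: skew_loop_lie_simps)
    obtain w where w: "\<And>p q. entry A p q \<noteq> 0 \<Longrightarrow> \<bar>p - q\<bar> \<le> w" using entry_bandE by blast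
    have "A = (\<Sum>(\<alpha>, n)\<in>UNIV \<times> {- w..w}.
        scale_banded (torus_coeff l A (\<chi> \<alpha>) n / 2) (skew_torus_elem (\<chi> \<alpha>) n))"
      by (rule skew_torus_fourier[OF A']) (use w in \<open>auto simp: abs_le_iff\<close>, force+)
    then have "(A, 0) \<in> h ` carrier ?Q"
      using im_sum[of "UNIV \<times> {- w..w}" "\<lambda>(\<alpha>, n). torus_coeff l A (\<chi> \<alpha>) n / 2"]
      by (simp add: case_prod_beta)
    from im_add[OF this im_central[of a]] show ?thesis by (simp add: skew_loop_lie_simps)
  qed
  then have "carrier ?M \<subseteq> h ` carrier ?Q" by auto
  moreover have "h ` carrier ?Q \<subseteq> carrier ?M" using hs(1) by auto
  ultimately show ?thesis using that h inj by (auto simp: bij_betw_def)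
qed

end

section \<open>The discrete Fourier transform on one period\<close>

definition period :: "nat \<Rightarrow> nat" where
  "period l = 2 * l + 1"

lemma period_pos: "period l > 0"
  by (simp add: period_def)

lemma of_nat_period_nonzero: "of_nat (period l) \<noteq> (0 :: complex)"
  unfolding period_def by (rule of_nat_odd_nonzero)

definition wave :: "nat \<Rightarrow> int \<Rightarrow> nat \<Rightarrow> complex" where
  "wave l a x = primitive_root (period l) powi (a * int x)"

lemma primitive_root_nonzero: "primitive_root N \<noteq> 0"
  by (simp add: primitive_root_def)

lemma wave_add: "wave l (a + b) x = wave l a x * wave l b x"
  by (simp add: wave_def distrib_right power_int_add primitive_root_nonzero)

text \<open>A geometric sum whose ratio is a root of unity. The ratio is 1 only for
  \<open>a = b\<close>, since two elements of the block differ by less than the period.\<close>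

lemma sum_wave_nat:
  assumes "a \<in> block l" "b \<in> block l"
  shows "(\<Sum>x<period l. wave l a x * wave l (- b) x) = of_bool (a = b) * of_nat (period l)"
proof -
  let ?q = "primitive_root (period l) powi (a - b)"
  have e: "wave l a x * wave l (- b) x = ?q ^ x" for x
    unfolding wave_add[symmetric] by (simp add: wave_def power_int_power')
  have root: "?q ^ (period l) = 1"
    using root_of_unity_powi_mod[OF primitive_root_power[OF period_pos], of l "(a - b) * int (period l)" 0] period_pos[of l]
    by (simp add: power_int_power')
  have one: "?q = 1 \<longleftrightarrow> a = b"
  proof -
    have "?q = 1 \<longleftrightarrow> int (period l) dvd a - b" by (rule primitive_root_powi_eq_1_iff[OF period_pos])
    also have "\<dots> \<longleftrightarrow> a = b"
    proof
      assume d: "int (period l) dvd a - b"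
      have "\<bar>a - b\<bar> < int (period l)" using assms by (auto simp: block_def period_def)
      then show "a = b" using d dvd_imp_le_int[of "a - b" "int (period l)"] by auto
    qed simp
    finally show ?thesis .
  qed
  have "(\<Sum>x<period l. ?q ^ x) = of_bool (a = b) * of_nat (period l)"
  proof (cases "a = b")
    case False
    then have "?q \<noteq> 1" using one by simp
    then show ?thesis unfolding sum_gp_strict root using False by simp
  qed simp
  then show ?thesis unfolding e .
qed

text \<open>The dual orthogonality, summed over frequencies; \<open>sum_block_powi\<close> evaluates
  it.\<close>

lemma sum_wave_block:
  assumes "x < period l" "y < period l"
  shows "(\<Sum>a\<in>block l. wave l a x * wave l (- a) y) = of_bool (x = y) * of_nat (period l)"
proof -
  let ?q = "primitive_root (period l) powi (int x - int y)"
  have e: "wave l a x * wave l (- a) y = ?q powi a" for a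
    by (simp add: wave_def primitive_root_nonzero algebra_simps flip: power_int_add power_int_mult)
  have root: "?q ^ (period l) = 1"
    using root_of_unity_powi_mod[OF primitive_root_power[OF period_pos], of l "(int x - int y) * int (period l)" 0] period_pos[of l]
    by (simp add: power_int_power')
  have one: "?q = 1 \<longleftrightarrow> x = y"
  proof -
    have "?q = 1 \<longleftrightarrow> int (period l) dvd int x - int y" by (rule primitive_root_powi_eq_1_iff[OF period_pos])
    also have "\<dots> \<longleftrightarrow> x = y"
    proof
      assume d: "int (period l) dvd int x - int y"
      have "\<bar>int x - int y\<bar> < int (period l)" using assms by auto
      then show "x = y" using d dvd_imp_le_int[of "int x - int y" "int (period l)"] by auto
    qed simp
    finally show ?thesis .
  qed
  have "(\<Sum>a\<in>block l. ?q powi a) = (if ?q = 1 then of_nat (2 * l + 1) else 0)"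
    by (rule sum_block_powi) (use root in \<open>simp only: period_def\<close>)
  then show ?thesis unfolding e one by (simp add: period_def)
qed

text \<open>Conjugation by the Fourier matrix; the single division takes the place of two
  normalising square roots.\<close>

definition dft :: "nat \<Rightarrow> (int \<Rightarrow> int \<Rightarrow> complex) \<Rightarrow> nat \<Rightarrow> nat \<Rightarrow> complex" where
  "dft l K x y = (\<Sum>a\<in>block l. \<Sum>b\<in>block l. K a b * (wave l a x * wave l (- b) y)) / of_nat (period l)"

definition inverse_dft :: "nat \<Rightarrow> (nat \<Rightarrow> nat \<Rightarrow> complex) \<Rightarrow> int \<Rightarrow> int \<Rightarrow> complex" where
  "inverse_dft l F a b = (\<Sum>x<period l. \<Sum>y<period l. F x y * (wave l (- a) x * wave l b y)) / of_nat (period l)"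

lemma sum_swap3: "(\<Sum>y\<in>J. \<Sum>c\<in>I. \<Sum>d\<in>K. g y c d) = (\<Sum>c\<in>I. \<Sum>d\<in>K. \<Sum>y\<in>J. g y c d)"
  by (subst sum.swap) (intro sum.cong HOL.refl sum.swap)

lemma sum_swap4:
  "(\<Sum>x\<in>J. \<Sum>y\<in>J'. \<Sum>c\<in>I. \<Sum>d\<in>K. g x y c d) = (\<Sum>c\<in>I. \<Sum>d\<in>K. \<Sum>x\<in>J. \<Sum>y\<in>J'. g x y c d)"
  unfolding sum_swap3[where J = J'] by (rule sum_swap3)

lemma dft_cong:
  "(\<And>a b. a \<in> block l \<Longrightarrow> b \<in> block l \<Longrightarrow> K a b = L a b) \<Longrightarrow> dft l K x y = dft l L x y"
  by (simp add: dft_def)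

lemma dft_linear:
  "dft l (\<lambda>a b. K a b + L a b) x y = dft l K x y + dft l L x y"
  "dft l (\<lambda>a b. K a b - L a b) x y = dft l K x y - dft l L x y"
  "dft l (\<lambda>a b. c * K a b) x y = c * dft l K x y"
  "dft l (\<lambda>a b. - K a b) x y = - dft l K x y"
  by (simp_all add: dft_def distrib_right left_diff_distrib sum.distrib sum_subtractf sum_negf
      add_divide_distrib diff_divide_distrib sum_distrib_left mult.assoc)

lemma dft_sum: "dft l (\<lambda>a b. \<Sum>m\<in>M. K m a b) x y = (\<Sum>m\<in>M. dft l (K m) x y)"
proof (cases "finite M")
  case True
  then show ?thesis
  proof induction
    case (insert m M)
    then show ?case by (simp add: dft_linear)
  qed (simp add: dft_def)
qed (simp add: dft_def)

text \<open>Here the reflection becomes transposition: exchanging \<open>x\<close> and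
  \<open>y\<close> exchanges the two waves up to the signs of their frequencies, which the symmetric
  block absorbs.\<close>

lemma dft_transpose: "dft l K y x = dft l (\<lambda>a b. K (- b) (- a)) x y"
proof -
  have u: "(\<Sum>a\<in>block l. g (- a)) = (\<Sum>a\<in>block l. g a)" for g :: "int \<Rightarrow> complex"
    by (rule sum.reindex_bij_witness[of _ uminus uminus]) (auto simp: block_def)
  have "(\<Sum>a\<in>block l. \<Sum>b\<in>block l. K (- b) (- a) * (wave l a x * wave l (- b) y))
      = (\<Sum>a\<in>block l. \<Sum>b\<in>block l. K b a * (wave l (- a) x * wave l b y))"
    using u[of "\<lambda>a. \<Sum>b\<in>block l. K (- b) a * (wave l (- a) x * wave l (- b) y)"]
      u[of "\<lambda>b. K b a * (wave l (- a) x * wave l b y)" for a] by simp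
  also have "\<dots> = (\<Sum>b\<in>block l. \<Sum>a\<in>block l. K b a * (wave l b y * wave l (- a) x))"
    by (subst sum.swap) (simp add: mult.commute)
  finally show ?thesis by (simp add: dft_def)
qed

text \<open>The bilinear Parseval identity; it collapses the inner index in
  \<open>dft_mult\<close>.\<close>

lemma wave_parseval:
  "(\<Sum>y<period l. (\<Sum>b\<in>block l. f b * wave l (- b) y) * (\<Sum>c\<in>block l. g c * wave l c y))
    = of_nat (period l) * (\<Sum>b\<in>block l. f b * g b)"
proof -
  have "(\<Sum>y<period l. (\<Sum>b\<in>block l. f b * wave l (- b) y) * (\<Sum>c\<in>block l. g c * wave l c y))
      = (\<Sum>y<period l. \<Sum>(b, c)\<in>block l \<times> block l. f b * g c * (wave l c y * wave l (- b) y))"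
    unfolding sum_product sum.cartesian_product by (intro sum.cong HOL.refl) (auto simp: mult_ac)
  also have "\<dots> = (\<Sum>(b, c)\<in>block l \<times> block l.
      f b * g c * (\<Sum>y<period l. wave l c y * wave l (- b) y))"
    by (subst sum.swap) (simp add: sum_distrib_left case_prod_beta)
  also have "\<dots> = (\<Sum>b\<in>block l. \<Sum>c\<in>block l. if c = b then f b * g c * of_nat (period l) else 0)"
    unfolding sum.cartesian_product
    by (intro sum.cong HOL.refl) (auto simp: sum_wave_nat)
  also have "\<dots> = (\<Sum>b\<in>block l. f b * g b * of_nat (period l))"
    by (intro sum.cong HOL.refl) (simp add: sum.delta)
  finally show ?thesis by (simp only: sum_distrib_left mult.commute)
qed

lemma dft_mult:
  "(\<Sum>y<period l. dft l K x y * dft l L y z) = dft l (\<lambda>a c. \<Sum>b\<in>block l. K a b * L b c) x z"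
proof -
  let ?N = "of_nat (period l) :: complex" and ?I = "block l"
  let ?g = "\<lambda>b. \<Sum>c\<in>?I. L b c * wave l (- c) z"
  have K: "dft l K x y = (\<Sum>a\<in>?I. wave l a x * (\<Sum>b\<in>?I. K a b * wave l (- b) y)) / ?N" for y
    unfolding dft_def sum_distrib_left by (simp add: mult_ac)
  have L: "dft l L y z = (\<Sum>b\<in>?I. ?g b * wave l b y) / ?N" for y
    unfolding dft_def sum_distrib_right by (simp add: mult_ac)
  have "(\<Sum>y<period l. dft l K x y * dft l L y z)
      = (\<Sum>y<period l. \<Sum>a\<in>?I. wave l a x *
          ((\<Sum>b\<in>?I. K a b * wave l (- b) y) * (\<Sum>b\<in>?I. ?g b * wave l b y))) / (?N * ?N)"
    unfolding K L times_divide_times_eq sum_divide_distrib[symmetric] sum_distrib_right mult.assoc ..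
  also have "\<dots> = (\<Sum>a\<in>?I. wave l a x * (?N * (\<Sum>b\<in>?I. K a b * ?g b))) / (?N * ?N)"
    by (subst sum.swap) (simp only: sum_distrib_left[symmetric] wave_parseval)
  also have "\<dots> = (\<Sum>a\<in>?I. wave l a x * (\<Sum>b\<in>?I. K a b * ?g b)) / ?N"
    using of_nat_period_nonzero[of l]
    by (simp add: mult.left_commute[of _ ?N] sum_distrib_left[symmetric])
  also have "\<dots> = dft l (\<lambda>a c. \<Sum>b\<in>?I. K a b * L b c) x z"
  proof -
    have "(\<Sum>b\<in>?I. K a b * ?g b) = (\<Sum>c\<in>?I. (\<Sum>b\<in>?I. K a b * L b c) * wave l (- c) z)" for a
      unfolding sum_distrib_left sum_distrib_right mult.assoc by (rule sum.swap)
    then show ?thesis unfolding dft_def by (simp only: sum_distrib_left mult_ac)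
  qed
  finally show ?thesis .
qed

lemma dft_trace: "(\<Sum>x<period l. dft l K x x) = (\<Sum>a\<in>block l. K a a)"
proof -
  let ?N = "of_nat (period l) :: complex" and ?I = "block l"
  have "(\<Sum>x<period l. dft l K x x)
      = (\<Sum>a\<in>?I. \<Sum>b\<in>?I. \<Sum>x<period l. K a b * (wave l a x * wave l (- b) x)) / ?N"
    unfolding dft_def sum_divide_distrib[symmetric]
    by (subst sum.swap, subst (2) sum.swap) (rule HOL.refl)
  also have "\<dots> = (\<Sum>a\<in>?I. \<Sum>b\<in>?I. if b = a then K a b * ?N else 0) / ?N"
    unfolding sum_distrib_left[symmetric]
    by (intro arg_cong2[of _ _ _ _ "(/)"] sum.cong HOL.refl) (simp add: sum_wave_nat)
  also have "\<dots> = (\<Sum>a\<in>?I. K a a)"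
    using of_nat_period_nonzero[of l] by (simp add: sum.delta sum_distrib_right[symmetric] cong: sum.cong)
  finally show ?thesis .
qed

lemma inverse_dft_dft:
  assumes "a \<in> block l" "b \<in> block l"
  shows "inverse_dft l (dft l K) a b = K a b"
proof -
  let ?N = "of_nat (period l) :: complex" and ?I = "block l"
  have "inverse_dft l (dft l K) a b
      = (\<Sum>x<period l. \<Sum>y<period l. \<Sum>c\<in>?I. \<Sum>d\<in>?I.
          K c d * (wave l c x * wave l (- a) x) * (wave l b y * wave l (- d) y)) / ?N / ?N"
    unfolding inverse_dft_def dft_def sum_divide_distrib sum_distrib_right
    by (intro sum.cong HOL.refl) (simp add: mult_ac)
  also have "\<dots> = (\<Sum>c\<in>?I. \<Sum>d\<in>?I. \<Sum>x<period l. \<Sum>y<period l.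
          K c d * (wave l c x * wave l (- a) x) * (wave l b y * wave l (- d) y)) / ?N / ?N"
    by (subst sum_swap4) (rule HOL.refl)
  also have "\<dots> = (\<Sum>c\<in>?I. \<Sum>d\<in>?I. K c d * (of_bool (c = a) * ?N) * (of_bool (b = d) * ?N)) / ?N / ?N"
    using assms by (intro arg_cong2[of _ _ _ _ "(/)"] sum.cong HOL.refl)
      (simp add: sum_wave_nat flip: sum_distrib_left sum_distrib_right)
  also have "\<dots> = (\<Sum>c\<in>?I. \<Sum>d\<in>?I. if d = b then if c = a then K c d * ?N * ?N else 0 else 0) / ?N / ?N"
    by (intro arg_cong2[of _ _ _ _ "(/)"] sum.cong HOL.refl) auto
  also have "\<dots> = K a b"
    using assms of_nat_period_nonzero[of l] by (simp add: sum.delta)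
  finally show ?thesis .
qed

lemma dft_inverse_dft:
  assumes "x < period l" "y < period l"
  shows "dft l (inverse_dft l F) x y = F x y"
proof -
  let ?N = "of_nat (period l) :: complex" and ?I = "block l" and ?J = "{..<period l}"
  have "dft l (inverse_dft l F) x y
      = (\<Sum>a\<in>?I. \<Sum>b\<in>?I. \<Sum>u\<in>?J. \<Sum>v\<in>?J.
          F u v * (wave l a x * wave l (- a) u) * (wave l b v * wave l (- b) y)) / ?N / ?N"
    unfolding inverse_dft_def dft_def sum_divide_distrib sum_distrib_right
    by (intro sum.cong HOL.refl) (simp add: mult_ac)
  also have "\<dots> = (\<Sum>u\<in>?J. \<Sum>v\<in>?J. \<Sum>a\<in>?I. \<Sum>b\<in>?I.
          F u v * (wave l a x * wave l (- a) u) * (wave l b v * wave l (- b) y)) / ?N / ?N"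
    by (subst sum_swap4) (rule HOL.refl)
  also have "\<dots> = (\<Sum>u\<in>?J. \<Sum>v\<in>?J. F u v * (of_bool (x = u) * ?N) * (of_bool (v = y) * ?N)) / ?N / ?N"
    using assms by (intro arg_cong2[of _ _ _ _ "(/)"] sum.cong HOL.refl)
      (simp add: sum_wave_block flip: sum_distrib_left sum_distrib_right)
  also have "\<dots> = (\<Sum>u\<in>?J. \<Sum>v\<in>?J. if v = y then if u = x then F u v * ?N * ?N else 0 else 0) / ?N / ?N"
    by (intro arg_cong2[of _ _ _ _ "(/)"] sum.cong HOL.refl) auto
  also have "\<dots> = F x y"
    using assms of_nat_period_nonzero[of l] by (simp add: sum.delta)
  finally show ?thesis .
qed

lemma inverse_dft_cong:
  "(\<And>x y. x < period l \<Longrightarrow> y < period l \<Longrightarrow> F x y = G x y) \<Longrightarrow> inverse_dft l F a b = inverse_dft l G a b"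
  unfolding inverse_dft_def by (intro arg_cong2[of _ _ _ _ "(/)"] sum.cong HOL.refl) auto

lemma inverse_dft_transpose: "inverse_dft l F (- b) (- a) = inverse_dft l (\<lambda>x y. F y x) a b"
  unfolding inverse_dft_def by (subst sum.swap) (simp add: mult.commute)

lemma inverse_dft_neg: "inverse_dft l (\<lambda>x y. - F x y) a b = - inverse_dft l F a b"
  by (simp add: inverse_dft_def sum_negf)

section \<open>The isomorphism with the affine algebra\<close>

lemma so_lie_finsum_index:
  assumes "finite M" "\<And>m. m \<in> M \<Longrightarrow> f m \<in> carrier (so_lie n)" "x < n" "y < n"
  shows "finsum (so_lie n) f M $$ (x, y) = (\<Sum>m\<in>M. f m $$ (x, y))"
  using assms(1,2)
proof induction
  interpret complex_lie_algebra "so_lie n" by (rule complex_lie_algebra_so_lie)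
  case empty
  show ?case using assms by (simp add: so_lie_simps(2))
next
  interpret complex_lie_algebra "so_lie n" by (rule complex_lie_algebra_so_lie)
  case (insert m M)
  have closed: "finsum (so_lie n) f M \<in> carrier (so_lie n)" "f m \<in> carrier (so_lie n)"
    using insert by (auto intro: finsum_closed)
  have "finsum (so_lie n) f (insert m M) = f m \<oplus>\<^bsub>so_lie n\<^esub> finsum (so_lie n) f M"
    using insert closed by (intro finsum_insert) auto
  moreover have "dim_row (finsum (so_lie n) f M) = n" "dim_col (finsum (so_lie n) f M) = n"
    using closed by (auto simp: so_lie_simps)
  moreover have "finsum (so_lie n) f M $$ (x, y) = (\<Sum>m\<in>M. f m $$ (x, y))"
    using insert by blast
  ultimately show ?case using insert(1,2) assms(3,4) by (simp add: so_lie_simps(3))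
qed

text \<open>The coefficient of t^k. By periodicity the blocks with columns in the base period
  represent all blocks at distance \<open>k\<close>.\<close>

definition loop_matrix :: "nat \<Rightarrow> complex banded \<Rightarrow> int \<Rightarrow> complex mat" where
  "loop_matrix l A k = mat (period l) (period l)
     (\<lambda>(x, y). dft l (\<lambda>a b. entry A (a + k * int (period l)) b) x y)"

lemma loop_matrix_index:
  "x < period l \<Longrightarrow> y < period l \<Longrightarrow>
    loop_matrix l A k $$ (x, y) = dft l (\<lambda>a b. entry A (a + k * int (period l)) b) x y"
  by (simp add: loop_matrix_def)

lemma loop_matrix_carrier [simp]: "loop_matrix l A k \<in> carrier_mat (period l) (period l)"
  by (simp add: loop_matrix_def)

lemma loop_matrix_dim [simp]: "dim_row (loop_matrix l A k) = period l" "dim_col (loop_matrix l A k) = period l"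
  by (simp_all add: loop_matrix_def)

lemma inverse_dft_loop_matrix:
  assumes "a \<in> block l" "b \<in> block l"
  shows "inverse_dft l (\<lambda>x y. loop_matrix l A k $$ (x, y)) a b = entry A (a + k * int (period l)) b"
proof -
  have "inverse_dft l (\<lambda>x y. loop_matrix l A k $$ (x, y)) a b
      = inverse_dft l (dft l (\<lambda>a b. entry A (a + k * int (period l)) b)) a b"
    by (rule inverse_dft_cong) (simp add: loop_matrix_index)
  then show ?thesis using inverse_dft_dft[OF assms] by simp
qed

lemma loop_matrix_nonzero:
  assumes "a \<in> block l" "b \<in> block l" "entry A (a + k * int (period l)) b \<noteq> 0"
  shows "loop_matrix l A k \<noteq> 0\<^sub>m (period l) (period l)"
proof
  assume "loop_matrix l A k = 0\<^sub>m (period l) (period l)"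
  then have "inverse_dft l (\<lambda>x y. loop_matrix l A k $$ (x, y)) a b = inverse_dft l (\<lambda>x y. 0) a b"
    by (intro inverse_dft_cong) simp
  also have "\<dots> = 0" by (simp add: inverse_dft_def)
  finally show False using assms by (simp add: inverse_dft_loop_matrix)
qed

lemma int_period: "int (period l) = 2 * int l + 1"
  by (simp add: period_def)

lemma finite_loop_matrix_support:
  "finite {k. loop_matrix l A k \<noteq> 0\<^sub>m (period l) (period l)}"
proof (rule finite_subset[OF _ finite_block_shifts[of l A]], clarify)
  fix k assume nz: "loop_matrix l A k \<noteq> 0\<^sub>m (period l) (period l)"
  show "\<exists>a\<in>block l. \<exists>b\<in>block l. entry A (a + k * (2 * int l + 1)) b \<noteq> 0"
  proof (rule ccontr)
    assume "\<not> ?thesis"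
    then have "dft l (\<lambda>a b. entry A (a + k * int (period l)) b) x y = dft l (\<lambda>a b. 0) x y" for x y
      by (intro dft_cong) (simp add: int_period)
    then have "loop_matrix l A k = 0\<^sub>m (period l) (period l)"
      by (intro eq_matI) (simp_all add: loop_matrix_index dft_def)
    then show False using nz by simp
  qed
qed

text \<open>The reflection sends \<open>(a + k * N, b)\<close> to \<open>(- b, - a - k * N)\<close>,
  and a shift by \<open>k\<close> periods returns it to a block of the same degree. So each
  coefficient is skew by itself.\<close>

lemma loop_matrix_so:
  assumes A: "periodic (int (period l)) A" "skew A"
  shows "loop_matrix l A k \<in> carrier (so_lie (period l))"
proof -
  have e: "entry A (- b + k * int (period l)) (- a) = - entry A (a + k * int (period l)) b" for a b
  proof -
    have "entry A (- b + k * int (period l)) (- a)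
        = entry A (- b + k * int (period l)) (- (a + k * int (period l)) + k * int (period l))" by simp
    also have "\<dots> = entry A (- b) (- (a + k * int (period l)))" by (rule periodic_shift[OF A(1)])
    also have "\<dots> = - entry A (a + k * int (period l)) b" using A(2) unfolding skew_def by blast
    finally show ?thesis .
  qed
  have "transpose_mat (loop_matrix l A k) = - loop_matrix l A k"
  proof (rule eq_matI)
    fix x y assume "x < dim_row (- loop_matrix l A k)" "y < dim_col (- loop_matrix l A k)"
    then have xy: "x < period l" "y < period l" by simp_all
    have "transpose_mat (loop_matrix l A k) $$ (x, y) = dft l (\<lambda>a b. entry A (a + k * int (period l)) b) y x"
      using xy by (simp add: loop_matrix_index)
    also have "\<dots> = dft l (\<lambda>a b. - entry A (a + k * int (period l)) b) x y"
      by (subst dft_transpose) (simp only: e)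
    finally show "transpose_mat (loop_matrix l A k) $$ (x, y) = (- loop_matrix l A k) $$ (x, y)"
      using xy by (simp add: dft_linear loop_matrix_index)
  qed simp_all
  then show ?thesis by (simp add: so_lie_simps)
qed

lemma loop_matrix_linear:
  "loop_matrix l (A + B) k = loop_matrix l A k + loop_matrix l B k"
  "loop_matrix l (scale_banded c A) k = c \<cdot>\<^sub>m loop_matrix l A k"
  by (auto intro!: eq_matI simp: loop_matrix_index dft_linear)

lemma loop_matrix_times_index:
  assumes "x < period l" "z < period l"
  shows "(loop_matrix l A k * loop_matrix l B j) $$ (x, z)
    = dft l (\<lambda>a c. \<Sum>b\<in>block l. entry A (a + k * int (period l)) b * entry B (b + j * int (period l)) c) x z"
proof -
  have "(loop_matrix l A k * loop_matrix l B j) $$ (x, z)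
      = (\<Sum>y<period l. dft l (\<lambda>a b. entry A (a + k * int (period l)) b) x y
          * dft l (\<lambda>a b. entry B (a + j * int (period l)) b) y z)"
    using assms by (subst mat_times_index[of _ "period l"]) (auto simp: loop_matrix_index simp del: index_mult_mat(1) intro!: sum.cong)
  then show ?thesis by (simp only: dft_mult)
qed

text \<open>The affine bracket sums over the degrees of its first argument in both products of the
  commutator. This lemma and the next one write both products over the same degrees of
  \<open>A\<close>.\<close>

lemma entry_times_left_support:
  fixes A B :: "complex banded"
  assumes A: "periodic (int (period l)) A" and M: "finite M"
    and supp: "{m. \<exists>a\<in>block l. \<exists>b\<in>block l. entry A (a + m * int (period l)) b \<noteq> 0} \<subseteq> M"
    and a: "a \<in> block l"
  shows "(\<Sum>m\<in>M. \<Sum>b\<in>block l. entry A (a + m * int (period l)) b * entry B (b + (k - m) * int (period l)) c)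
    = entry (A * B) (a + k * int (period l)) c"
proof -
  let ?N = "int (period l)"
  \<comment> \<open>\<open>entry_times_blocks\<close> counts degrees from the row
    \<open>a + k * ?N\<close>, hence the shift by \<open>k\<close>.\<close>
  have "entry (A * B) (a + k * ?N) c = (\<Sum>m\<in>(\<lambda>m. m - k) ` M. \<Sum>b\<in>block l.
      entry A (a + k * ?N + m * ?N) b * entry B (b - m * ?N) c)"
  proof (rule entry_times_blocks[OF int_period A])
    fix m b assume b: "b \<in> block l" "entry A (a + k * ?N + m * ?N) b \<noteq> 0"
    then have "entry A (a + (m + k) * ?N) b \<noteq> 0" by (simp add: algebra_simps)
    then have "m + k \<in> M" using supp a b(1) by blast
    then show "m \<in> (\<lambda>m. m - k) ` M" by (intro image_eqI[of _ _ "m + k"]) auto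
  qed (use M in simp)
  also have "\<dots> = (\<Sum>m\<in>M. \<Sum>b\<in>block l. entry A (a + m * ?N) b * entry B (b + (k - m) * ?N) c)"
    by (subst sum.reindex) (auto intro!: inj_onI sum.cong simp: algebra_simps)
  finally show ?thesis by simp
qed

lemma entry_times_right_support:
  fixes A B :: "complex banded"
  assumes B: "periodic (int (period l)) B" and M: "finite M"
    and supp: "{m. \<exists>a\<in>block l. \<exists>b\<in>block l. entry A (a + m * int (period l)) b \<noteq> 0} \<subseteq> M"
    and c: "c \<in> block l"
  shows "(\<Sum>m\<in>M. \<Sum>b\<in>block l. entry B (a + (k - m) * int (period l)) b * entry A (b + m * int (period l)) c)
    = entry (B * A) (a + k * int (period l)) c"
proof -
  let ?N = "int (period l)"
  have "entry (B * A) (a + k * ?N) c = (\<Sum>m\<in>uminus ` M. \<Sum>b\<in>block l.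
      entry B (a + k * ?N + m * ?N) b * entry A (b - m * ?N) c)"
  proof (rule entry_times_blocks[OF int_period B])
    fix m b assume b: "b \<in> block l" "entry A (b - m * ?N) c \<noteq> 0"
    then have "entry A (b + - m * ?N) c \<noteq> 0" by simp
    then have "- m \<in> M" using supp c b(1) by blast
    then show "m \<in> uminus ` M" by (intro image_eqI[of _ _ "- m"]) auto
  qed (use M in simp)
  also have "\<dots> = (\<Sum>m\<in>M. \<Sum>b\<in>block l. entry B (a + (k - m) * ?N) b * entry A (b + m * ?N) c)"
    by (subst sum.reindex) (auto intro!: inj_onI sum.cong simp: algebra_simps)
  finally show ?thesis by simp
qed

section \<open>Comparison of the brackets and cocycles\<close>

text \<open>The principal grading of \<open>A\<close> and the loop degree differ by the diagonal weights summed here,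
  so \<open>grade_cocycle\<close> and the affine cocycle differ by the coboundary of this functional.\<close>

definition weight_trace :: "nat \<Rightarrow> complex banded \<Rightarrow> complex" where
  "weight_trace l A = (\<Sum>a\<in>block l. of_int a * entry A a a)"

text \<open>The degree \<open>p - q\<close> of the entry at \<open>(a + m * N, b)\<close> splits as
  \<open>m * N + a - b\<close>. The first part gives N times the loop cocycle; the weights
  \<open>a\<close> and \<open>b\<close> give the weighted diagonals of \<open>A * B\<close> and
  \<open>B * A\<close>.\<close>

lemma loop_cocycle:
  fixes A B :: "complex banded"
  assumes A: "periodic (int (period l)) A" and B: "periodic (int (period l)) B"
    and M: "finite M"
    and supp: "{m. \<exists>a\<in>block l. \<exists>b\<in>block l. entry A (a + m * int (period l)) b \<noteq> 0} \<subseteq> M"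
  shows "of_nat (period l) * (\<Sum>m\<in>M. of_int m * (\<Sum>a\<in>block l. \<Sum>b\<in>block l.
      entry A (a + m * int (period l)) b * entry B (b + - m * int (period l)) a))
    = grade_cocycle l A B - weight_trace l (A * B - B * A)"
proof -
  let ?N = "int (period l)" and ?I = "block l"
  let ?t = "\<lambda>m a b. entry A (a + m * ?N) b * entry B (b + - m * ?N) a"
  have dA: "periodic ?N (grade_derivation A)" by (rule periodic_grade_derivation[OF A])
  have sdA: "{m. \<exists>a\<in>?I. \<exists>b\<in>?I. entry (grade_derivation A) (a + m * ?N) b \<noteq> 0} \<subseteq> M"
    using supp by auto
  have "grade_cocycle l A B = (\<Sum>a\<in>?I. \<Sum>m\<in>M. \<Sum>b\<in>?I. of_int (a + m * ?N - b) * ?t m a b)"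
    unfolding grade_cocycle_def period_trace_def
  proof (intro sum.cong HOL.refl)
    fix a assume "a \<in> ?I"
    from entry_times_left_support[OF dA M sdA this, where B = B and k = 0 and c = a]
    show "entry (grade_derivation A * B) a a = (\<Sum>m\<in>M. \<Sum>b\<in>?I. of_int (a + m * ?N - b) * ?t m a b)"
      by (simp add: mult.assoc)
  qed
  moreover have "(\<Sum>a\<in>?I. of_int a * entry (A * B) a a) = (\<Sum>a\<in>?I. \<Sum>m\<in>M. \<Sum>b\<in>?I. of_int a * ?t m a b)"
  proof (intro sum.cong HOL.refl)
    fix a assume "a \<in> ?I"
    from entry_times_left_support[OF A M supp this, where B = B and k = 0 and c = a]
    have e: "entry (A * B) a a = (\<Sum>m\<in>M. \<Sum>b\<in>?I. ?t m a b)" by simp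
    show "of_int a * entry (A * B) a a = (\<Sum>m\<in>M. \<Sum>b\<in>?I. of_int a * ?t m a b)"
      unfolding e by (simp only: sum_distrib_left)
  qed
  moreover have "(\<Sum>b\<in>?I. of_int b * entry (B * A) b b) = (\<Sum>b\<in>?I. \<Sum>m\<in>M. \<Sum>a\<in>?I. of_int b * ?t m a b)"
  proof (intro sum.cong HOL.refl)
    fix b assume "b \<in> ?I"
    from entry_times_right_support[OF B M supp this, where a = b and k = 0]
    have e: "entry (B * A) b b = (\<Sum>m\<in>M. \<Sum>a\<in>?I. ?t m a b)" by (simp add: mult.commute)
    show "of_int b * entry (B * A) b b = (\<Sum>m\<in>M. \<Sum>a\<in>?I. of_int b * ?t m a b)"
      unfolding e by (simp only: sum_distrib_left)
  qed
  moreover have "(\<Sum>b\<in>?I. \<Sum>m\<in>M. \<Sum>a\<in>?I. of_int b * ?t m a b)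
      = (\<Sum>a\<in>?I. \<Sum>m\<in>M. \<Sum>b\<in>?I. of_int b * ?t m a b)"
    by (subst sum_swap3) (rule sum.swap)
  moreover have "of_nat (period l) * (\<Sum>m\<in>M. of_int m * (\<Sum>a\<in>?I. \<Sum>b\<in>?I. ?t m a b))
      = (\<Sum>a\<in>?I. \<Sum>m\<in>M. \<Sum>b\<in>?I. of_int (m * ?N) * ?t m a b)"
    unfolding sum_distrib_left by (subst sum.swap) (simp add: mult_ac)
  moreover have "of_int (a + m * ?N - b) * ?t m a b
      = of_int a * ?t m a b + of_int (m * ?N) * ?t m a b - of_int b * ?t m a b" for a m b
    by (simp add: algebra_simps)
  ultimately show ?thesis
    unfolding weight_trace_def
    by (simp only: entry_simps right_diff_distrib sum_subtractf sum.distrib) simp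
qed

lemma affine_lie_simps:
  "(f, a) \<in> carrier (affine_lie G B) \<longleftrightarrow> (\<forall>n. f n \<in> carrier G) \<and> finite (laurent_support G f)"
  "(f, a) \<oplus>\<^bsub>affine_lie G B\<^esub> (g, b) = ((\<lambda>n. f n \<oplus>\<^bsub>G\<^esub> g n), a + b)"
  "c \<odot>\<^bsub>affine_lie G B\<^esub> (f, a) = ((\<lambda>n. c \<odot>\<^bsub>G\<^esub> f n), c * a)"
  "lie_bracket (affine_lie G B) (f, a) (g, b) =
       ((\<lambda>k. \<Oplus>\<^bsub>G\<^esub>m\<in>laurent_support G f. lie_bracket G (f m) (g (k - m))),
        (\<Sum>m\<in>laurent_support G f. of_int m * B (f m) (g (- m))))"
  by (simp_all add: affine_lie_def)

text \<open>The central component is dictated by two identities: on skew matrices the form is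
  \<open>- \<kappa>\<close> times the trace of the product, and \<open>loop_cocycle\<close> rewrites
  the trace cocycle at the cost of a factor \<open>period l\<close>.\<close>

definition loop_map :: "nat \<Rightarrow> complex \<Rightarrow> complex banded \<times> complex \<Rightarrow> (int \<Rightarrow> complex mat) \<times> complex" where
  "loop_map l \<kappa> x = (loop_matrix l (fst x),
     \<kappa> / of_nat (period l) * (weight_trace l (fst x) - snd x))"

lemma loop_matrix_support:
  "laurent_support (so_lie (period l)) (loop_matrix l A) = {k. loop_matrix l A k \<noteq> 0\<^sub>m (period l) (period l)}"
  by (simp add: laurent_support_def so_lie_simps)

lemma block_shifts_subset_support:
  "{m. \<exists>a\<in>block l. \<exists>b\<in>block l. entry A (a + m * int (period l)) b \<noteq> 0}
    \<subseteq> {k. loop_matrix l A k \<noteq> 0\<^sub>m (period l) (period l)}"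
  using loop_matrix_nonzero by blast

text \<open>Block multiplication of periodic matrices is convolution of Laurent coefficients, and
  the Fourier transform respects each block product.\<close>

lemma loop_matrix_bracket:
  assumes A: "periodic (int (period l)) A" "skew A" and B: "periodic (int (period l)) B" "skew B"
    and M: "M = laurent_support (so_lie (period l)) (loop_matrix l A)"
  shows "(\<Oplus>\<^bsub>so_lie (period l)\<^esub>m\<in>M. lie_bracket (so_lie (period l)) (loop_matrix l A m) (loop_matrix l B (k - m)))
    = loop_matrix l (A * B - B * A) k"
proof -
  let ?G = "so_lie (period l)" and ?N = "int (period l)"
  let ?br = "\<lambda>m. lie_bracket ?G (loop_matrix l A m) (loop_matrix l B (k - m))"
  interpret complex_lie_algebra ?G by (rule complex_lie_algebra_so_lie)
  have M': "finite M" "{m. \<exists>a\<in>block l. \<exists>b\<in>block l. entry A (a + m * ?N) b \<noteq> 0} \<subseteq> M"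
    unfolding M loop_matrix_support by (rule finite_loop_matrix_support, rule block_shifts_subset_support)
  have br: "?br m \<in> carrier ?G" for m
    by (intro bracket_closed loop_matrix_so A B)
  then have "finsum ?G ?br M \<in> carrier ?G" by (intro finsum_closed) auto
  then have dims: "dim_row (finsum ?G ?br M) = period l" "dim_col (finsum ?G ?br M) = period l"
    by (auto simp: so_lie_simps)
  show ?thesis
  proof (rule eq_matI)
    fix x z assume "x < dim_row (loop_matrix l (A * B - B * A) k)" "z < dim_col (loop_matrix l (A * B - B * A) k)"
    then have xz: "x < period l" "z < period l" by simp_all
    have "finsum ?G ?br M $$ (x, z) = (\<Sum>m\<in>M. ?br m $$ (x, z))"
      by (rule so_lie_finsum_index) (use M'(1) br xz in auto)
    also have "\<dots> = (\<Sum>m\<in>M. (loop_matrix l A m * loop_matrix l B (k - m)) $$ (x, z)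
        - (loop_matrix l B (k - m) * loop_matrix l A m) $$ (x, z))"
      using xz by (simp add: so_lie_simps del: index_mult_mat(1))
    also have "\<dots> = dft l (\<lambda>a c. \<Sum>m\<in>M. \<Sum>b\<in>block l. entry A (a + m * ?N) b * entry B (b + (k - m) * ?N) c) x z
        - dft l (\<lambda>a c. \<Sum>m\<in>M. \<Sum>b\<in>block l. entry B (a + (k - m) * ?N) b * entry A (b + m * ?N) c) x z"
      using xz by (simp only: loop_matrix_times_index sum_subtractf dft_sum)
    also have "\<dots> = dft l (\<lambda>a c. entry (A * B) (a + k * ?N) c) x z - dft l (\<lambda>a c. entry (B * A) (a + k * ?N) c) x z"
      by (intro arg_cong2[of _ _ _ _ "(-)"] dft_cong entry_times_left_support[OF A(1) M']
          entry_times_right_support[OF B(1) M'])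
    also have "\<dots> = loop_matrix l (A * B - B * A) k $$ (x, z)"
      using xz by (simp add: loop_matrix_index dft_linear)
    finally show "finsum ?G ?br M $$ (x, z) = loop_matrix l (A * B - B * A) k $$ (x, z)" .
  qed (use dims in simp_all)
qed

text \<open>For skew \<open>B\<close> the entrywise pairing is minus the trace of the product, and
  the Fourier transform preserves traces.\<close>

lemma loop_matrix_pairing:
  assumes B: "periodic (int (period l)) B" "skew B"
  shows "(\<Sum>x<period l. \<Sum>y<period l. loop_matrix l A k $$ (x, y) * loop_matrix l B j $$ (x, y))
    = - (\<Sum>a\<in>block l. \<Sum>b\<in>block l. entry A (a + k * int (period l)) b * entry B (b + j * int (period l)) a)"
proof -
  have sk: "loop_matrix l B j $$ (x, y) = - loop_matrix l B j $$ (y, x)"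
    if "x < period l" "y < period l" for x y
  proof -
    have "transpose_mat (loop_matrix l B j) = - loop_matrix l B j"
      using loop_matrix_so[OF B] by (simp add: so_lie_simps)
    then have "transpose_mat (loop_matrix l B j) $$ (y, x) = (- loop_matrix l B j) $$ (y, x)" by simp
    then show ?thesis using that by simp
  qed
  have "(\<Sum>x<period l. \<Sum>y<period l. loop_matrix l A k $$ (x, y) * loop_matrix l B j $$ (x, y))
      = (\<Sum>x<period l. - (loop_matrix l A k * loop_matrix l B j) $$ (x, x))"
  proof (rule sum.cong[OF HOL.refl])
    fix x assume "x \<in> {..<period l}"
    then have x: "x < period l" by simp
    have "(loop_matrix l A k * loop_matrix l B j) $$ (x, x)
        = (\<Sum>y<period l. loop_matrix l A k $$ (x, y) * loop_matrix l B j $$ (y, x))"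
      by (rule mat_times_index) (use x in auto)
    also have "- \<dots> = (\<Sum>y<period l. loop_matrix l A k $$ (x, y) * loop_matrix l B j $$ (x, y))"
      unfolding sum_negf[symmetric]
    proof (rule sum.cong[OF HOL.refl])
      fix y assume "y \<in> {..<period l}"
      then show "- (loop_matrix l A k $$ (x, y) * loop_matrix l B j $$ (y, x))
          = loop_matrix l A k $$ (x, y) * loop_matrix l B j $$ (x, y)"
        using sk[of x y] x by simp
    qed
    finally show "(\<Sum>y<period l. loop_matrix l A k $$ (x, y) * loop_matrix l B j $$ (x, y))
        = - (loop_matrix l A k * loop_matrix l B j) $$ (x, x)" by (rule HOL.sym)
  qed
  also have "\<dots> = - (\<Sum>x<period l. dft l (\<lambda>a c. \<Sum>b\<in>block l.
      entry A (a + k * int (period l)) b * entry B (b + j * int (period l)) c) x x)"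
    unfolding sum_negf by (intro arg_cong[of _ _ uminus] sum.cong HOL.refl) (simp add: loop_matrix_times_index del: index_mult_mat(1))
  finally show ?thesis unfolding dft_trace .
qed

lemma loop_map_hom:
  assumes form: "\<And>A C. A \<in> carrier (so_lie (period l)) \<Longrightarrow> C \<in> carrier (so_lie (period l)) \<Longrightarrow>
      Bf A C = \<kappa> * (\<Sum>i<period l. \<Sum>j<period l. A $$ (i, j) * C $$ (i, j))"
  shows "loop_map l \<kappa> \<in> lie_hom (skew_loop_lie l) (affine_lie (so_lie (period l)) Bf)"
proof -
  let ?L = "skew_loop_lie l" and ?M = "affine_lie (so_lie (period l)) Bf"
  have wt: "weight_trace l (A + B) = weight_trace l A + weight_trace l B"
    "weight_trace l (scale_banded c A) = c * weight_trace l A" for A B c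
    by (simp_all add: weight_trace_def distrib_left sum.distrib sum_distrib_left mult_ac)
  have car: "(A, a) \<in> carrier ?L \<longleftrightarrow> periodic (int (period l)) A \<and> skew A" for A a
    by (simp add: skew_loop_lie_simps int_period)
  have closed: "loop_map l \<kappa> (A, a) \<in> carrier ?M" if "(A, a) \<in> carrier ?L" for A a
    using that finite_loop_matrix_support
    by (simp add: car loop_map_def affine_lie_simps loop_matrix_so loop_matrix_support)
  have add: "loop_map l \<kappa> ((A, a) \<oplus>\<^bsub>?L\<^esub> (B, b)) = loop_map l \<kappa> (A, a) \<oplus>\<^bsub>?M\<^esub> loop_map l \<kappa> (B, b)" for A a B b
    by (simp add: loop_map_def skew_loop_lie_simps affine_lie_simps so_lie_simps wt fun_eq_iff
        loop_matrix_linear add_divide_distrib diff_divide_distrib algebra_simps)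
  have smult: "loop_map l \<kappa> (c \<odot>\<^bsub>?L\<^esub> (A, a)) = c \<odot>\<^bsub>?M\<^esub> loop_map l \<kappa> (A, a)" for c A a
    by (simp add: loop_map_def skew_loop_lie_simps affine_lie_simps so_lie_simps wt fun_eq_iff
        loop_matrix_linear add_divide_distrib diff_divide_distrib algebra_simps)
  have bracket: "loop_map l \<kappa> (lie_bracket ?L (A, a) (B, b))
      = lie_bracket ?M (loop_map l \<kappa> (A, a)) (loop_map l \<kappa> (B, b))"
    if "(A, a) \<in> carrier ?L" "(B, b) \<in> carrier ?L" for A a B b
  proof -
    define M where "M = laurent_support (so_lie (period l)) (loop_matrix l A)"
    have A: "periodic (int (period l)) A" "skew A" and B: "periodic (int (period l)) B" "skew B"
      using that by (simp_all add: car)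
    have M': "finite M" "{m. \<exists>a\<in>block l. \<exists>b\<in>block l. entry A (a + m * int (period l)) b \<noteq> 0} \<subseteq> M"
      unfolding M_def loop_matrix_support by (rule finite_loop_matrix_support, rule block_shifts_subset_support)
    have "(\<Sum>m\<in>M. of_int m * Bf (loop_matrix l A m) (loop_matrix l B (- m)))
        = - \<kappa> * (\<Sum>m\<in>M. of_int m * (\<Sum>a\<in>block l. \<Sum>b\<in>block l.
            entry A (a + m * int (period l)) b * entry B (b + - m * int (period l)) a))" (is "_ = _ * ?S")
      unfolding sum_distrib_left[of "- \<kappa>"]
      by (intro sum.cong HOL.refl)
        (simp only: form[OF loop_matrix_so[OF A] loop_matrix_so[OF B]] loop_matrix_pairing[OF B], simp)
    also have "\<dots> = \<kappa> / of_nat (period l) * (weight_trace l (A * B - B * A) - grade_cocycle l A B)"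
    proof -
      have "weight_trace l (A * B - B * A) - grade_cocycle l A B = - (of_nat (period l) * ?S)"
        unfolding loop_cocycle[OF A(1) B(1) M'] by simp
      then show ?thesis using of_nat_period_nonzero[of l] by simp
    qed
    finally have "(\<Sum>m\<in>M. of_int m * Bf (loop_matrix l A m) (loop_matrix l B (- m)))
        = \<kappa> / of_nat (period l) * (weight_trace l (A * B - B * A) - grade_cocycle l A B)" .
    then show ?thesis
      by (simp add: loop_map_def skew_loop_lie_simps affine_lie_simps flip: M_def)
        (simp add: fun_eq_iff loop_matrix_bracket[OF A B M_def])
  qed
  show ?thesis
    unfolding lie_hom_def using closed add smult bracket by (auto simp: split_paired_all)
qed

section \<open>Bijectivity of the loop map\<close>

lemma entry_centred:
  assumes "periodic (int (period l)) A"
  shows "entry A p q = entry A (centred_mod l p + (centred_div l p - centred_div l q) * int (period l)) (centred_mod l q)"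
proof -
  let ?N = "int (period l)"
  have "entry A (centred_mod l p + (centred_div l p - centred_div l q) * ?N + centred_div l q * ?N)
      (centred_mod l q + centred_div l q * ?N)
    = entry A (centred_mod l p + (centred_div l p - centred_div l q) * ?N) (centred_mod l q)"
    by (rule periodic_shift[OF assms])
  moreover have "centred_mod l p + (centred_div l p - centred_div l q) * ?N + centred_div l q * ?N
      = centred_mod l p + centred_div l p * ?N" by (simp add: algebra_simps)
  ultimately show ?thesis by (simp only: int_period centred_mod_div)
qed

lemma loop_matrix_inject:
  assumes A: "periodic (int (period l)) A" and B: "periodic (int (period l)) B"
    and eq: "loop_matrix l A = loop_matrix l B"
  shows "A = B"
proof (rule banded_eqI)
  fix p q
  have "entry A (a + k * int (period l)) b = entry B (a + k * int (period l)) b"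
    if "a \<in> block l" "b \<in> block l" for a b k
    using inverse_dft_loop_matrix[OF that, of A k] inverse_dft_loop_matrix[OF that, of B k] eq by simp
  then show "entry A p q = entry B p q"
    unfolding entry_centred[OF A, of p q] entry_centred[OF B, of p q] by simp
qed

lemma centred_minus: "centred_mod l (- p) = - centred_mod l p" "centred_div l (- p) = - centred_div l p"
proof -
  have "- centred_mod l p \<in> block l" using centred_mod_in_block[of l p] by (simp add: block_def)
  moreover have "- p = - centred_mod l p + - centred_div l p * (2 * int l + 1)"
    using centred_mod_div[of l p] by linarith
  ultimately show "centred_mod l (- p) = - centred_mod l p" "centred_div l (- p) = - centred_div l p"
    using centred_unique[of "- centred_mod l p" l "- centred_div l p"] by simp_all
qed

lemma centred_shift:
  "centred_mod l (p + int (period l)) = centred_mod l p" "centred_div l (p + int (period l)) = centred_div l p + 1"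
proof -
  have "p + int (period l) = centred_mod l p + (centred_div l p + 1) * (2 * int l + 1)"
    using centred_mod_div[of l p] by (simp add: int_period distrib_right)
  then show "centred_mod l (p + int (period l)) = centred_mod l p"
    "centred_div l (p + int (period l)) = centred_div l p + 1"
    using centred_unique[of "centred_mod l p" l "centred_div l p + 1"] by simp_all
qed

text \<open>The matrix is assembled from inverse transforms read at centred residues. Finite support
  of \<open>f\<close> bounds the band, and skewness of the coefficients returns through
  \<open>inverse_dft_transpose\<close>.\<close>

lemma loop_matrix_surj:
  assumes so: "\<And>k. f k \<in> carrier (so_lie (period l))"
    and supp: "finite (laurent_support (so_lie (period l)) f)"
  obtains A where "periodic (int (period l)) A" "skew A" "loop_matrix l A = f"
proof -
  let ?N = "int (period l)"
  define K where "K k = inverse_dft l (\<lambda>x y. f k $$ (x, y))" for k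
  define E where "E p q = K (centred_div l p - centred_div l q) (centred_mod l p) (centred_mod l q)" for p q
  let ?S = "laurent_support (so_lie (period l)) f"
  have K0: "K k a b = 0" if "k \<notin> ?S" for k a b
  proof -
    have "f k = 0\<^sub>m (period l) (period l)" using that by (simp add: laurent_support_def so_lie_simps)
    then have "K k a b = inverse_dft l (\<lambda>x y. 0) a b" unfolding K_def by (intro inverse_dft_cong) simp
    then show ?thesis by (simp add: inverse_dft_def)
  qed
  \<comment> \<open>For empty support this maximum is unspecified, but the bound is only claimed for
    degrees in \<open>?S\<close>.\<close>
  define s where "s = Max (abs ` ?S)"
  have s: "k \<in> ?S \<Longrightarrow> \<bar>k\<bar> \<le> s" for k
    unfolding s_def using supp by (intro Max_ge) auto
  have band: "\<exists>w. \<forall>p q. E p q \<noteq> 0 \<longrightarrow> \<bar>p - q\<bar> \<le> w"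
  proof (intro exI[of _ "2 * int l + s * ?N"] allI impI)
    fix p q assume "E p q \<noteq> 0"
    then have "centred_div l p - centred_div l q \<in> ?S" using K0 unfolding E_def by blast
    then have "\<bar>centred_div l p - centred_div l q\<bar> \<le> s" by (rule s)
    then have "\<bar>centred_div l p - centred_div l q\<bar> * ?N \<le> s * ?N" by (intro mult_right_mono) auto
    then have "\<bar>(centred_div l p - centred_div l q) * ?N\<bar> \<le> s * ?N" by (simp add: abs_mult)
    moreover have "p - q = centred_mod l p - centred_mod l q + (centred_div l p - centred_div l q) * ?N"
      using centred_mod_div[of l p] centred_mod_div[of l q] by (simp add: int_period left_diff_distrib)
    moreover have "\<bar>centred_mod l p - centred_mod l q\<bar> \<le> 2 * int l"
      using centred_mod_in_block[of l p] centred_mod_in_block[of l q]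
      unfolding block_def atLeastAtMost_iff by linarith
    ultimately show "\<bar>p - q\<bar> \<le> 2 * int l + s * ?N" by linarith
  qed
  define A where "A = Banded E"
  have entry_A: "entry A p q = E p q" for p q
    using band unfolding A_def by (subst Banded_inverse) auto
  have "periodic ?N A"
    by (simp add: periodic_def entry_A E_def centred_shift)
  moreover have "skew A"
    unfolding skew_def
  proof (intro allI)
    fix p q
    have sk: "f k $$ (y, x) = - f k $$ (x, y)" if "x < period l" "y < period l" for k x y
    proof -
      have f: "f k \<in> carrier_mat (period l) (period l)" "transpose_mat (f k) = - f k"
        using so[of k] by (simp_all add: so_lie_simps)
      have "transpose_mat (f k) $$ (x, y) = (- f k) $$ (x, y)" using f(2) by simp
      then show ?thesis using f(1) that by auto
    qed
    have "K k (- b) (- a) = - K k a b" for k a b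
      unfolding K_def inverse_dft_transpose inverse_dft_neg[symmetric]
      by (rule inverse_dft_cong) (rule sk)
    then show "entry A (- q) (- p) = - entry A p q"
      by (simp add: entry_A E_def centred_minus)
  qed
  moreover have "loop_matrix l A = f"
  proof
    fix k
    have f: "f k \<in> carrier_mat (period l) (period l)" using so[of k] by (simp add: so_lie_simps)
    show "loop_matrix l A k = f k"
    proof (rule eq_matI)
      fix x y assume "x < dim_row (f k)" "y < dim_col (f k)"
      then have xy: "x < period l" "y < period l" using f by auto
      have "loop_matrix l A k $$ (x, y) = dft l (inverse_dft l (\<lambda>x y. f k $$ (x, y))) x y"
        unfolding loop_matrix_index[OF xy]
      proof (rule dft_cong)
        fix a b assume "a \<in> block l" "b \<in> block l"
        then show "entry A (a + k * ?N) b = inverse_dft l (\<lambda>x y. f k $$ (x, y)) a b"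
          using centred_unique[of a l k] centred_unique[of b l 0] by (simp add: entry_A E_def K_def int_period)
      qed
      also have "\<dots> = f k $$ (x, y)" by (rule dft_inverse_dft[OF xy])
      finally show "loop_matrix l A k $$ (x, y) = f k $$ (x, y)" .
    qed (use f in auto)
  qed
  ultimately show ?thesis by (rule that)
qed

proposition loop_map_bij:
  assumes "\<kappa> \<noteq> 0"
  shows "bij_betw (loop_map l \<kappa>) (carrier (skew_loop_lie l)) (carrier (affine_lie (so_lie (period l)) Bf))"
  unfolding bij_betw_def
proof
  let ?L = "skew_loop_lie l" and ?M = "affine_lie (so_lie (period l)) Bf"
  have car: "(A, a) \<in> carrier ?L \<longleftrightarrow> periodic (int (period l)) A \<and> skew A" for A a
    by (simp add: skew_loop_lie_simps int_period)
  have nz: "\<kappa> / of_nat (period l) \<noteq> 0" using assms of_nat_period_nonzero[of l] by simp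
  show "inj_on (loop_map l \<kappa>) (carrier ?L)"
  proof (rule inj_onI; clarify)
    fix A a B b assume "(A, a) \<in> carrier ?L" "(B, b) \<in> carrier ?L"
      and eq: "loop_map l \<kappa> (A, a) = loop_map l \<kappa> (B, b)"
    then have "A = B" using loop_matrix_inject[of l A B] by (simp add: car loop_map_def)
    then show "A = B \<and> a = b" using eq nz by (simp add: loop_map_def)
  qed
  show "loop_map l \<kappa> ` carrier ?L = carrier ?M"
  proof (intro equalityI subsetI)
    fix y assume "y \<in> loop_map l \<kappa> ` carrier ?L"
    then obtain A a where "(A, a) \<in> carrier ?L" "y = loop_map l \<kappa> (A, a)" by force
    then show "y \<in> carrier ?M"
      using finite_loop_matrix_support
      by (simp add: car loop_map_def affine_lie_simps loop_matrix_so loop_matrix_support)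
  next
    fix y assume y: "y \<in> carrier ?M"
    obtain f e where fe: "y = (f, e)" by force
    obtain A where A: "periodic (int (period l)) A" "skew A" "loop_matrix l A = f"
      using loop_matrix_surj[of f l] y by (auto simp: fe affine_lie_simps)
    have "y = loop_map l \<kappa> (A, weight_trace l A - e / (\<kappa> / of_nat (period l)))"
      using nz by (simp add: loop_map_def fe A(3))
    then show "y \<in> loop_map l \<kappa> ` carrier ?L" using A by (auto simp: car)
  qed
qed

lemma lie_hom_compose:
  assumes "h \<in> lie_hom L M" "g \<in> lie_hom M K"
  shows "g \<circ> h \<in> lie_hom L K"
  using assms unfolding lie_hom_def by (auto simp: Pi_iff)

theorem theorem3p7:
  fixes l :: nat
    and \<chi> :: "'s::{finite, ab_group_add} \<Rightarrow> complex"
    and B :: "complex mat \<Rightarrow> complex mat \<Rightarrow> complex"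
  assumes "l \<ge> 1"
    and "card (UNIV :: 's set) = 2 * l + 1"
    and "\<And>\<alpha>. \<chi> \<alpha> \<noteq> 0"
    and "\<And>\<alpha> \<beta>. \<chi> (\<alpha> + \<beta>) = \<chi> \<alpha> * \<chi> \<beta>"
    and "inj \<chi>"
    and "nondegenerate_invariant_form (so_lie (2 * l + 1)) B"
  shows "lie_isomorphic (D_lie \<chi>) (affine_B l B)"
proof -
  interpret injective_odd_character l \<chi>
    using assms(2-5) by unfold_locales
  obtain h where h: "h \<in> lie_hom (D_lie \<chi>) (skew_loop_lie l)"
    "bij_betw h (carrier (D_lie \<chi>)) (carrier (skew_loop_lie l))"
    by (rule D_lie_iso_skew_loop_lie)
  \<comment> \<open>Being odd, the size avoids the exceptional value 4 for every rank.\<close>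
  have "2 * l + 1 \<ge> 3" "2 * l + 1 \<noteq> 4" using assms(1) by presburger+
  with assms(6) obtain \<kappa> where \<kappa>: "\<kappa> \<noteq> 0"
    "\<And>A E. A \<in> carrier (so_lie (2 * l + 1)) \<Longrightarrow> E \<in> carrier (so_lie (2 * l + 1)) \<Longrightarrow>
      B A E = \<kappa> * (\<Sum>i<2 * l + 1. \<Sum>j<2 * l + 1. A $$ (i, j) * E $$ (i, j))"
    by (rule so_invariant_form_unique) blast
  have "loop_map l \<kappa> \<in> lie_hom (skew_loop_lie l) (affine_B l B)"
    using loop_map_hom[of l B \<kappa>] \<kappa>(2) unfolding period_def by blast
  then have "loop_map l \<kappa> \<circ> h \<in> lie_hom (D_lie \<chi>) (affine_B l B)"
    by (rule lie_hom_compose[OF h(1)])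
  moreover have "bij_betw (loop_map l \<kappa> \<circ> h) (carrier (D_lie \<chi>)) (carrier (affine_B l B))"
    using bij_betw_trans[OF h(2) loop_map_bij[OF \<kappa>(1)]] unfolding period_def .
  ultimately show ?thesis unfolding lie_isomorphic_def by blast
qed

end
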